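(* For fixed real parameters $\kappa$ and $u_0$, the Whittaker function $$Z(\mu) := W_{\kappa,\mu}(e^{u_0})$$ is an entire function of $\mu\in\mathbb{C}$ of order $1$ and maximal type. It is real-valued on both the real axis and the imaginary axis. It is an even function of $\mu$, i.e. it satisfies the functional equation $Z(\mu)=Z(-\mu)$. Moreover: (1) The zeros of $Z(\mu)$ lie on the real and imaginary axes. All zeros of $Z(\mu)$ are simple zeros, except for a possible zero at $\mu=0$, which if it occurs is a double zero. (2) For each $\kappa$ the function $Z(\mu)$ has finitely many real zeros. There are no real zeros when $\kappa\le 0$, and for $\kappa\ge 0$ they all lie in the open interval $-\kappa<\mu<\kappa$. (3) There are infinitely many imaginary zeros. The total number $N(T)$ of zeros of $Z(\mu)$ with $|\mathrm{Im}(\mu)|\le T$ satisfies the asymptotic formula $$N(T) = \frac2\pi T\log T + \frac2\pi\left(2\log 2-1-u_0\right)T + O(1)$$ as $T\to\infty$, where the $O$-constant depends on $\kappa$ and $u_0$.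
   Context: Whittaker $W$-function: for complex $\kappa,\mu$ and real $x>0$, $W_{\kappa,\mu}(x)$ is the solution on $(0,\infty)$ of Whittaker's equation $f''(x)+\left(-\frac14+\frac{\kappa}{x}+\frac{\frac14-\mu^2}{x^2}\right)f(x)=0$ determined uniquely by the asymptotics $W_{\kappa,\mu}(x)=e^{-x/2}x^{\kappa}\left(1+O(1/x)\right)$ as $x\to+\infty$. An entire function $F$ of order $1$ is of maximal (infinite) type if $\limsup_{r\to\infty} r^{-1}\log\max_{|\mu|=r}|F(\mu)| = \infty$. *)

theory Defs
  imports "HOL-Complex_Analysis.Complex_Analysis" "HOL-Library.Landau_Symbols"
    "HOL-Library.Liminf_Limsup"
begin

(* Complex-valued solutions on (0,\<infinity>) of Whittaker's equation; values of f and f'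
   outside (0,\<infinity>) are unconstrained. *)
definition whittaker_eq :: "complex \<Rightarrow> complex \<Rightarrow> (real \<Rightarrow> complex) \<Rightarrow> bool" where
  "whittaker_eq \<kappa> \<mu> f \<longleftrightarrow>
     (\<exists>f' f''. \<forall>x>0.
        (f has_vector_derivative f' x) (at x) \<and>
        (f' has_vector_derivative f'' x) (at x) \<and>
        f'' x + (- 1/4 + \<kappa> / of_real x + (1/4 - \<mu>^2) / of_real x ^ 2) * f x = 0)"

definition whittaker_asymp :: "complex \<Rightarrow> (real \<Rightarrow> complex) \<Rightarrow> bool" where
  "whittaker_asymp \<kappa> f \<longleftrightarrow>
     (\<exists>\<epsilon>::real \<Rightarrow> complex. \<epsilon> \<in> O[at_top](\<lambda>x. 1 / of_real x) \<and>
        (\<forall>x>0. f x = of_real (exp (- x / 2)) * (of_real x powr \<kappa>) * (1 + \<epsilon> x)))"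

(* The solution is unique only as a function on (0,\<infinity>), so the description is applied to
   its value at x > 0 rather than to the function on the whole type. *)
definition whittaker_W :: "complex \<Rightarrow> complex \<Rightarrow> real \<Rightarrow> complex" where
  "whittaker_W \<kappa> \<mu> x = (THE w. \<exists>f. whittaker_eq \<kappa> \<mu> f \<and> whittaker_asymp \<kappa> f \<and> w = f x)"

definition max_modulus :: "(complex \<Rightarrow> complex) \<Rightarrow> real \<Rightarrow> real" where
  "max_modulus F r = (SUP z\<in>sphere 0 r. norm (F z))"

(* Meaningful for entire F. If F is constant, the conventions ln 0 = 0 and
   ln (- x) = ln x still yield the usual value 0. *)
definition entire_order :: "(complex \<Rightarrow> complex) \<Rightarrow> ereal" where
  "entire_order F = Limsup at_top (\<lambda>r. ereal (ln (ln (max_modulus F r)) / ln r))"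

definition order_one_maximal_type :: "(complex \<Rightarrow> complex) \<Rightarrow> bool" where
  "order_one_maximal_type F \<longleftrightarrow>
     entire_order F = 1 \<and> Limsup at_top (\<lambda>r. ereal (ln (max_modulus F r) / r)) = \<infinity>"

definition strip_zeros :: "(complex \<Rightarrow> complex) \<Rightarrow> real \<Rightarrow> complex set" where
  "strip_zeros F T = {z. F z = 0 \<and> \<bar>Im z\<bar> \<le> T}"

(* Zeros are counted with multiplicity; the sum is the intended number only if
   strip_zeros F T is finite. *)
definition zero_count :: "(complex \<Rightarrow> complex) \<Rightarrow> real \<Rightarrow> int" where
  "zero_count F T = (\<Sum>z\<in>strip_zeros F T. zorder F z)"

end

theory Submission
  imports Defs "HOL-Real_Asymp.Real_Asymp"
begin

text \<open>
Put \<open>u = ln x\<close> and \<open>g(u) = exp (- u / 2) * W(exp u)\<close>. Whittaker's equation becomes the Schroedinger equation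
\<open>- g'' + V g = - \<mu>\<^sup>2 g\<close> with the Morse potential \<open>V(u) = exp (2 * u) / 4 - \<kappa> * exp u\<close>, and the prescribed
asymptotics single out the solution that decays at \<open>+\<infinity>\<close>. Hence \<open>Z(\<mu>) = 0\<close> means that \<open>\<lambda> = - \<mu>\<^sup>2\<close> is an
eigenvalue of \<open>- d\<^sup>2/du\<^sup>2 + V\<close> on \<open>[u\<^sub>0, \<infinity>)\<close> with a Dirichlet condition at \<open>u\<^sub>0\<close>. This is a self-adjoint
problem with discrete spectrum, which explains every assertion: the eigenvalues are real and simple, so \<open>\<mu>\<close>
is real or imaginary and \<open>\<mu> = 0\<close> counts twice; they lie above the minimum \<open>- \<kappa>\<^sup>2\<close> of \<open>V\<close> (above \<open>0\<close> if
\<open>\<kappa> \<le> 0\<close>), which confines the real zeros; and Weyl's law, in its sharp one-dimensional form, counts them.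

The proof makes these facts explicit on the equation itself. Dividing out the leading behaviour,
\<open>W = exp (- x / 2) * x powr \<kappa> * h\<close>, one gets \<open>(P h')' = - c P h\<close> with \<open>P = weight \<kappa>\<close>, \<open>c = (\<kappa> - 1/2)\<^sup>2 - \<mu>\<^sup>2\<close>
and \<open>h \<rightarrow> 1\<close> at \<open>+\<infinity>\<close>. Solving by iterated tail integrals yields \<open>h = (\<Sum>n. b\<^sub>n * (- c) ^ n)\<close> with \<open>b\<^sub>n \<ge> 0\<close>
bounded by \<open>M ^ n / n!\<close>, where \<open>M = O(1/x)\<close> (\<open>iterate_step\<close>). So \<open>h\<close> is entire in \<open>c\<close> with real coefficients,
and \<open>Z\<close> is entire, even, and real on both axes; a Wronskian argument (\<open>whittaker_unique\<close>) shows that this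
solution is the Whittaker function. As the coefficients have alternating signs, the maximum of \<open>|h|\<close> on a
circle is attained at negative \<open>c\<close>, that is for large real \<open>\<mu>\<close>, where differential inequalities give \<open>ln h\<close>
between multiples of \<open>|\<mu>| ln |\<mu>|\<close> (\<open>profile_growth\<close>); this is order one and maximal type.

The spectral facts come from one identity: with \<open>A = P h'\<close>, the function \<open>Im (A * cnj h)\<close> has derivative
\<open>- Im c * P * |h|\<^sup>2\<close> and vanishes at \<open>+\<infinity>\<close>. Quantitatively, for \<open>Im c \<ge> 0\<close> it is at least a multiple of \<open>Im c\<close>
(\<open>imag_flux_lower_bound\<close>), so zeros in \<open>c\<close> are real, and letting \<open>Im c\<close> tend to \<open>0\<close>, the phase of \<open>A + i h\<close>
is strictly monotone in real \<open>c\<close> (\<open>phase_derivative_positive\<close>), which contains the simplicity of the zeros.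

For the count, choose a continuous phase of \<open>A + i h\<close> on the whole \<open>(u, c)\<close> plane. The zeros in \<open>c\<close> at \<open>u\<^sub>0\<close>
are the crossings of multiples of \<open>\<pi>\<close>; going around the rectangle with corners \<open>(u\<^sub>0, 0)\<close>, \<open>(U, 0)\<close>,
\<open>(U, C)\<close>, \<open>(u\<^sub>0, C)\<close>, their number is, up to \<open>O(1)\<close>, \<open>1 / \<pi>\<close> times the change of phase in \<open>u\<close> along the side
\<open>c = C\<close> (\<open>eigenvalue_count_by_phase\<close>), because the phase is constant on \<open>c = 0\<close> and changes by less than \<open>\<pi>\<close>
on the side \<open>u = U\<close> for large \<open>U\<close>. On the side \<open>c = C\<close>, with \<open>C = (\<kappa> - 1/2)\<^sup>2 + T\<^sup>2\<close>, Pruefer's equation for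
the phase is integrated with error \<open>O(1)\<close> (\<open>wkb_region_estimate\<close>, \<open>phase_estimate\<close>); the main term is the
integral of \<open>sqrt (T\<^sup>2 - exp (2 * u) / 4)\<close>, which is elementary. Each eigenvalue contributes \<open>2\<close> to the
number of zeros of \<open>Z\<close>.
\<close>

section \<open>Integrals over a half-line\<close>

text \<open>
Monotonicity together with the limit at infinity replaces all estimates of improper integrals: to compare two
functions that vanish at infinity it is enough to compare their derivatives.
\<close>

lemma antitone_vanishing_nonneg:
  fixes D d :: "real \<Rightarrow> real"
  assumes D: "\<And>u. u \<ge> a \<Longrightarrow> (D has_real_derivative d u) (at u)"
    and d: "\<And>u. u \<ge> a \<Longrightarrow> d u \<le> 0"
    and lim: "(D \<longlongrightarrow> 0) at_top" and "u \<ge> a"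
  shows "D u \<ge> 0"
proof (rule tendsto_upperbound[OF lim])
  show "\<forall>\<^sub>F v in at_top. D v \<le> D u"
    using eventually_ge_at_top[of u]
  proof eventually_elim
    case (elim v)
    show ?case
      by (rule DERIV_nonpos_imp_nonincreasing[OF elim]) (use D d \<open>u \<ge> a\<close> in \<open>meson order_trans\<close>)
  qed
qed simp

text \<open>
An antiderivative of \<open>f\<close> increases, and adding \<open>B\<close> makes it decrease; so it is bounded and converges, and
subtracting it from its limit gives the tail integral.
\<close>

lemma tail_antiderivative_exists:
  fixes f B b :: "real \<Rightarrow> real"
  assumes f: "\<And>u. isCont f u" "\<And>u. 0 \<le> f u"
    and B: "\<And>u. (B has_real_derivative - b u) (at u)" "\<And>u. f u \<le> b u" "(B \<longlongrightarrow> 0) at_top"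
  shows "\<exists>F. (\<forall>u. (F has_real_derivative - f u) (at u)) \<and> (F \<longlongrightarrow> 0) at_top"
proof -
  have "\<exists>A. \<forall>x. (-\<infinity>) < ereal x \<longrightarrow> ereal x < \<infinity> \<longrightarrow> (A has_vector_derivative f x) (at x)"
    by (rule einterval_antiderivative) (use f in auto)
  then obtain A where A: "\<And>x. (A has_real_derivative f x) (at x)"
    by (auto simp: has_real_derivative_iff_has_vector_derivative)
  have mono: "A u \<le> A v" if "u \<le> v" for u v
    by (rule DERIV_nonneg_imp_nondecreasing[OF that]) (use A f in blast)
  have anti: "A v + B v \<le> A u + B u" if "u \<le> v" for u v
    by (rule DERIV_nonpos_imp_nonincreasing[OF that])
       (auto intro!: exI derivative_eq_intros A B simp: B)
  have B0: "B u \<ge> 0" for u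
    by (rule antitone_vanishing_nonneg[of u B "\<lambda>u. - b u"])
       (use B f order_trans[OF f(2) B(2)] in auto)
  have bdd: "bdd_above (range A)"
  proof (rule bdd_aboveI2)
    fix u show "A u \<le> A 0 + B 0"
      using anti[of 0 u] mono[of u 0] B0[of u] B0[of 0] by (cases "u \<ge> 0") auto
  qed
  define L where "L = (SUP u. A u)"
  have lim: "(A \<longlongrightarrow> L) at_top"
  proof (rule order_tendstoI)
    fix y assume "y < L"
    then obtain u where "y < A u" unfolding L_def using bdd less_cSUP_iff[of UNIV A y] by auto
    then have "\<And>x. x \<ge> u \<Longrightarrow> y < A x" using mono by (meson less_le_trans)
    then show "\<forall>\<^sub>F x in at_top. y < A x" unfolding eventually_at_top_linorder by blast
  next
    fix y assume "L < y"
    then have "A x < y" for x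
      using cSUP_upper[OF UNIV_I bdd, of x] unfolding L_def by linarith
    then show "\<forall>\<^sub>F x in at_top. A x < y" by simp
  qed
  show ?thesis
  proof (intro exI conjI allI)
    show "((\<lambda>u. L - A u) has_real_derivative - f u) (at u)" for u
      by (auto intro!: derivative_eq_intros A)
    show "((\<lambda>u. L - A u) \<longlongrightarrow> 0) at_top"
      using tendsto_diff[OF tendsto_const lim, of L] by simp
  qed
qed

definition tail_integral :: "(real \<Rightarrow> real) \<Rightarrow> real \<Rightarrow> real" where
  "tail_integral f = (SOME F. (\<forall>u. (F has_real_derivative - f u) (at u)) \<and> (F \<longlongrightarrow> 0) at_top)"

lemma tail_integral:
  fixes f B b :: "real \<Rightarrow> real"
  assumes f: "\<And>u. isCont f u" "\<And>u. 0 \<le> f u"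
    and B: "\<And>u. (B has_real_derivative - b u) (at u)" "\<And>u. f u \<le> b u" "(B \<longlongrightarrow> 0) at_top"
  shows "(tail_integral f has_real_derivative - f u) (at u)"
    and "(tail_integral f \<longlongrightarrow> 0) at_top"
    and "0 \<le> tail_integral f u" and "tail_integral f u \<le> B u"
proof -
  have *: "(\<forall>u. (tail_integral f has_real_derivative - f u) (at u)) \<and> (tail_integral f \<longlongrightarrow> 0) at_top"
    unfolding tail_integral_def
    using tail_antiderivative_exists[OF f B] by (rule someI_ex)
  then show lim: "(tail_integral f \<longlongrightarrow> 0) at_top" by auto
  from * show d: "(tail_integral f has_real_derivative - f u) (at u)" for u by auto
  show "0 \<le> tail_integral f u"
    by (rule antitone_vanishing_nonneg[of u _ "\<lambda>u. - f u"]) (use d lim f in auto)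
  have "0 \<le> B u - tail_integral f u"
    by (rule antitone_vanishing_nonneg[of u _ "\<lambda>u. - b u + f u"])
       (use B tendsto_diff[OF B(3) lim] in \<open>auto intro!: derivative_eq_intros d B\<close>)
  then show "tail_integral f u \<le> B u" by simp
qed

section \<open>Iterated tail integrals\<close>

text \<open>
The weight of the Sturm--Liouville form \<open>(P h')' = - c P h\<close>, in the variable \<open>u = ln x\<close>.
\<close>

definition weight :: "real \<Rightarrow> real \<Rightarrow> real" where
  "weight \<kappa> u = exp (- exp u + (2 * \<kappa> - 1) * u)"

text \<open>
Coefficient \<open>n\<close> of the solution as a power series in \<open>- c\<close>: solving \<open>(P h')' = - c P h\<close>, \<open>h \<rightarrow> 1\<close>, by
successive approximation, each step integrates twice from infinity.
\<close>

primrec iterate :: "real \<Rightarrow> nat \<Rightarrow> real \<Rightarrow> real" where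
  "iterate \<kappa> 0 = (\<lambda>_. 1)"
| "iterate \<kappa> (Suc n) = tail_integral
     (\<lambda>u. tail_integral (\<lambda>v. weight \<kappa> v * iterate \<kappa> n v) u / weight \<kappa> u)"

declare iterate.simps(2) [simp del]

definition flux :: "real \<Rightarrow> nat \<Rightarrow> real \<Rightarrow> real" where
  "flux \<kappa> n = tail_integral (\<lambda>v. weight \<kappa> v * iterate \<kappa> n v)"

text \<open>
The tail integral of \<open>P\<close> divided by \<open>P\<close> behaves like \<open>exp (- u)\<close> for \<open>u \<rightarrow> \<infinity>\<close>, but for \<open>\<kappa> > 1\<close> it grows faster
than that for \<open>u \<rightarrow> - \<infinity>\<close>. The second exponential, with a sufficiently large exponent and coefficient, takes
care of the latter, so that one bound holds on the whole line.
\<close>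

definition majorant_exponent :: "real \<Rightarrow> nat" where "majorant_exponent \<kappa> = nat \<lceil>2 * \<bar>\<kappa>\<bar>\<rceil> + 2"
definition majorant_coeff :: "real \<Rightarrow> real" where "majorant_coeff \<kappa> = (2 * \<bar>2 * \<kappa> - 2\<bar>) ^ (majorant_exponent \<kappa> - 1)"

definition slope :: "real \<Rightarrow> real \<Rightarrow> real" where
  "slope \<kappa> u = 2 * exp (- u) + majorant_coeff \<kappa> * exp (- real (majorant_exponent \<kappa>) * u)"
definition majorant :: "real \<Rightarrow> real \<Rightarrow> real" where
  "majorant \<kappa> u = 2 * exp (- u) + majorant_coeff \<kappa> / real (majorant_exponent \<kappa>) * exp (- real (majorant_exponent \<kappa>) * u)"

lemma weight_pos [simp]: "weight \<kappa> u > 0"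
  by (simp add: weight_def)

lemma weight_deriv:
  "(weight \<kappa> has_real_derivative weight \<kappa> u * (- exp u + (2 * \<kappa> - 1))) (at u)"
  unfolding weight_def by (auto intro!: derivative_eq_intros)

lemma weight_tendsto_0: "(weight \<kappa> \<longlongrightarrow> 0) at_top"
  unfolding weight_def by real_asymp

lemma majorant_exponent: "majorant_exponent \<kappa> \<ge> 2" "real (majorant_exponent \<kappa>) + 1 \<ge> 2 * \<kappa>" "real (majorant_exponent \<kappa>) > 0"
  unfolding majorant_exponent_def by linarith+

lemma majorant_coeff_nonneg: "majorant_coeff \<kappa> \<ge> 0"
  by (simp add: majorant_coeff_def)

lemma slope_nonneg: "slope \<kappa> u \<ge> 0" and majorant_nonneg: "majorant \<kappa> u \<ge> 0"
  by (auto simp: slope_def majorant_def intro!: add_nonneg_nonneg mult_nonneg_nonneg majorant_coeff_nonneg divide_nonneg_nonneg)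

lemma majorant_deriv: "(majorant \<kappa> has_real_derivative - slope \<kappa> u) (at u)"
  unfolding majorant_def slope_def using majorant_exponent(3)[of \<kappa>]
  by (auto intro!: derivative_eq_intros)

lemma slope_tendsto_0: "(slope \<kappa> \<longlongrightarrow> 0) at_top" and majorant_tendsto_0: "(majorant \<kappa> \<longlongrightarrow> 0) at_top"
proof -
  have *: "((\<lambda>u. 2 * exp (- u) + A * exp (- j * u)) \<longlongrightarrow> 0) at_top" if "j > 0" for A j :: real
  proof -
    have e: "((\<lambda>u. exp (- j * u)) \<longlongrightarrow> 0) at_top" using that by real_asymp
    have "((\<lambda>u::real. exp (- u)) \<longlongrightarrow> 0) at_top" by real_asymp
    from tendsto_add[OF tendsto_mult[OF tendsto_const this, of 2] tendsto_mult[OF tendsto_const e, of A]]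
    show ?thesis by simp
  qed
  show "(slope \<kappa> \<longlongrightarrow> 0) at_top" "(majorant \<kappa> \<longlongrightarrow> 0) at_top"
    unfolding slope_def majorant_def by (rule *[OF majorant_exponent(3)])+
qed

lemma slope_antimono: "u \<le> v \<Longrightarrow> slope \<kappa> v \<le> slope \<kappa> u"
  and majorant_antimono: "u \<le> v \<Longrightarrow> majorant \<kappa> v \<le> majorant \<kappa> u"
  unfolding slope_def majorant_def
  by (intro add_mono mult_left_mono; simp add: majorant_coeff_nonneg mult_left_mono)+

lemma majorant_le:
  assumes "u \<ge> 0" shows "majorant \<kappa> u \<le> (2 + majorant_coeff \<kappa>) * exp (- u)"
proof -
  have "real (majorant_exponent \<kappa>) * u \<ge> 1 * u" using majorant_exponent(1)[of \<kappa>] assms by (intro mult_right_mono) auto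
  then have "majorant_coeff \<kappa> / real (majorant_exponent \<kappa>) * exp (- real (majorant_exponent \<kappa>) * u) \<le> majorant_coeff \<kappa> * exp (- u)"
    using majorant_exponent(1)[of \<kappa>] majorant_coeff_nonneg[of \<kappa>] mult_left_mono[of 1 "real (majorant_exponent \<kappa>)" "majorant_coeff \<kappa>"]
    by (intro mult_mono) (auto simp: divide_le_eq)
  then show ?thesis by (simp add: majorant_def algebra_simps)
qed

lemma slope_le:
  assumes "u \<ge> 0" shows "slope \<kappa> u \<le> (2 + majorant_coeff \<kappa>) * exp (- u)"
proof -
  have "real (majorant_exponent \<kappa>) * u \<ge> 1 * u" using majorant_exponent(1)[of \<kappa>] assms by (intro mult_right_mono) auto
  then have "majorant_coeff \<kappa> * exp (- real (majorant_exponent \<kappa>) * u) \<le> majorant_coeff \<kappa> * exp (- u)"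
    using majorant_coeff_nonneg[of \<kappa>] by (intro mult_left_mono) auto
  then show ?thesis by (simp add: slope_def algebra_simps)
qed

text \<open>
Minus the derivative of \<open>weight \<kappa> u * slope \<kappa> u\<close>.
\<close>

definition weighted_slope_decay :: "real \<Rightarrow> real \<Rightarrow> real" where
  "weighted_slope_decay \<kappa> u = weight \<kappa> u * ((exp u - (2 * \<kappa> - 1)) * slope \<kappa> u
     + 2 * exp (- u) + majorant_coeff \<kappa> * real (majorant_exponent \<kappa>) * exp (- real (majorant_exponent \<kappa>) * u))"

lemma weighted_slope_deriv:
  "((\<lambda>u. weight \<kappa> u * slope \<kappa> u) has_real_derivative - weighted_slope_decay \<kappa> u) (at u)"
  unfolding slope_def weighted_slope_decay_def
  by (auto intro!: derivative_eq_intros weight_deriv simp: algebra_simps)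

text \<open>
This inequality says that \<open>weight * slope\<close> dominates the tail integral of the weight. Divided by the weight
and with \<open>y = exp (- u)\<close>, it reduces to \<open>1 \<le> 2 - 2 k y + (2 k y) ^ (j - 1)\<close>, where \<open>k = |2 \<kappa> - 2|\<close> and
\<open>j \<ge> 2\<close>.
\<close>

lemma weighted_slope_decay_ge: "weight \<kappa> u \<le> weighted_slope_decay \<kappa> u"
proof -
  define y where "y = exp (- u)"
  define j where "j = majorant_exponent \<kappa>"
  define k where "k = \<bar>2 * \<kappa> - 2\<bar>"
  have y: "y > 0" "exp u = 1 / y" by (auto simp: y_def exp_minus field_simps)
  have e: "exp (- real j * u) = y ^ j"
    unfolding y_def by (simp add: exp_of_nat_mult[symmetric] )
  have j: "j \<ge> 2" "real j + 1 \<ge> 2 * \<kappa>" using majorant_exponent by (auto simp: j_def)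
  have A: "majorant_coeff \<kappa> = (2 * k) ^ (j - 1)" by (simp add: majorant_coeff_def j_def k_def)
  have yj: "y ^ j = y * y ^ (j - 1)" using j by (metis One_nat_def Suc_1 Suc_le_D diff_Suc_1 power_Suc)
  have "(exp u - (2 * \<kappa> - 1)) * slope \<kappa> u
     + 2 * exp (- u) + majorant_coeff \<kappa> * real (majorant_exponent \<kappa>) * exp (- real (majorant_exponent \<kappa>) * u)
     = 2 + 2 * (2 - 2 * \<kappa>) * y + majorant_coeff \<kappa> * y ^ (j - 1) + majorant_coeff \<kappa> * y ^ j * (real j + 1 - 2 * \<kappa>)"
    unfolding slope_def j_def[symmetric] e y_def[symmetric] y(2) using y(1)
    by (simp add: yj field_simps)
  also have "\<dots> \<ge> 2 - 2 * k * y + (2 * k * y) ^ (j - 1)"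
  proof -
    have "majorant_coeff \<kappa> * y ^ j * (real j + 1 - 2 * \<kappa>) \<ge> 0"
      using j y majorant_coeff_nonneg[of \<kappa>] by simp
    moreover have "2 * (2 - 2 * \<kappa>) * y \<ge> - (2 * k * y)"
      using y mult_right_mono[of "- k" "2 - 2 * \<kappa>" "2 * y"] by (auto simp: k_def algebra_simps)
    ultimately show ?thesis unfolding A by (simp add: power_mult_distrib)
  qed
  finally have *: "2 - 2 * k * y + (2 * k * y) ^ (j - 1) \<le> (exp u - (2 * \<kappa> - 1)) * slope \<kappa> u
     + 2 * exp (- u) + majorant_coeff \<kappa> * real (majorant_exponent \<kappa>) * exp (- real (majorant_exponent \<kappa>) * u)" .
  \<comment> \<open>Either the linear term is at most \<open>1\<close>, or its power \<open>j - 1 \<ge> 1\<close> dominates it.\<close>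
  have "1 \<le> 2 - 2 * k * y + (2 * k * y) ^ (j - 1)"
  proof (cases "2 * k * y \<le> 1")
    case True
    have "0 \<le> (2 * k * y) ^ (j - 1)" using y by (simp add: k_def)
    then show ?thesis using True by linarith
  next
    case False
    then have "2 * k * y \<le> (2 * k * y) ^ (j - 1)"
      using self_le_power[of "2 * k * y" "j - 1"] j by auto
    then show ?thesis by linarith
  qed
  then have "1 \<le> (exp u - (2 * \<kappa> - 1)) * slope \<kappa> u
     + 2 * exp (- u) + majorant_coeff \<kappa> * real (majorant_exponent \<kappa>) * exp (- real (majorant_exponent \<kappa>) * u)" using * by linarith
  then show ?thesis
    unfolding weighted_slope_decay_def using mult_left_mono[OF _ less_imp_le[OF weight_pos[of \<kappa> u]], of 1] by simp
qed

text \<open>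
The bound \<open>M ^ n / n!\<close> reproduces itself because \<open>slope\<close> is minus the derivative of \<open>M = majorant\<close>: the inner
integral is at most \<open>weight * slope * M ^ n / n!\<close>, and then \<open>slope * M ^ n / n!\<close> is an exact derivative.
\<close>

lemma iterate_step:
  assumes b: "\<And>u. isCont (iterate \<kappa> n) u" "\<And>u. 0 \<le> iterate \<kappa> n u"
    and bb: "\<And>u. iterate \<kappa> n u \<le> majorant \<kappa> u ^ n / fact n"
  shows "(flux \<kappa> n has_real_derivative - (weight \<kappa> u * iterate \<kappa> n u)) (at u)"
    and "0 \<le> flux \<kappa> n u" and "flux \<kappa> n u \<le> weight \<kappa> u * slope \<kappa> u * majorant \<kappa> u ^ n / fact n"
    and "(iterate \<kappa> (Suc n) has_real_derivative - (flux \<kappa> n u / weight \<kappa> u)) (at u)"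
    and "0 \<le> iterate \<kappa> (Suc n) u" and "iterate \<kappa> (Suc n) u \<le> majorant \<kappa> u ^ Suc n / fact (Suc n)"
proof -
  let ?B = "\<lambda>u. weight \<kappa> u * slope \<kappa> u * (majorant \<kappa> u ^ n / fact n)"
  let ?b = "\<lambda>u. weighted_slope_decay \<kappa> u * (majorant \<kappa> u ^ n / fact n) 
                + weight \<kappa> u * slope \<kappa> u * (real n * majorant \<kappa> u ^ (n - 1) * slope \<kappa> u / fact n)"
  have fB: "(?B has_real_derivative - ?b u) (at u)" for u
    by (rule DERIV_cong[OF DERIV_mult[OF weighted_slope_deriv DERIV_cdivide[OF DERIV_power[OF majorant_deriv]]]])
       (simp add: algebra_simps)
  have fle: "weight \<kappa> u * iterate \<kappa> n u \<le> ?b u" for u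
  proof -
    have "weight \<kappa> u * iterate \<kappa> n u \<le> weighted_slope_decay \<kappa> u * (majorant \<kappa> u ^ n / fact n)"
      using bb[of u] weighted_slope_decay_ge[of \<kappa> u] b(2)[of u]
      by (intro mult_mono) (auto intro: order_trans[OF less_imp_le[OF weight_pos]])
    moreover have "0 \<le> weight \<kappa> u * slope \<kappa> u * (real n * majorant \<kappa> u ^ (n - 1) * slope \<kappa> u / fact n)"
      using slope_nonneg majorant_nonneg less_imp_le[OF weight_pos] by (intro mult_nonneg_nonneg divide_nonneg_nonneg) auto
    ultimately show ?thesis by linarith
  qed
  have wc: "isCont (weight \<kappa>) u" for u using weight_deriv DERIV_isCont by blast
  have lim: "(?B \<longlongrightarrow> 0) at_top"
    using tendsto_mult[OF tendsto_mult[OF weight_tendsto_0[of \<kappa>] slope_tendsto_0[of \<kappa>]]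
        tendsto_divide[OF tendsto_power[OF majorant_tendsto_0[of \<kappa>], of n] tendsto_const], of "fact n"] by simp
  note fl = tail_integral[of "\<lambda>v. weight \<kappa> v * iterate \<kappa> n v" ?B ?b, folded flux_def, OF _ _ fB fle lim]
  have flc: "isCont (\<lambda>v. weight \<kappa> v * iterate \<kappa> n v) u" "0 \<le> weight \<kappa> u * iterate \<kappa> n u" for u
    using wc b less_imp_le[OF weight_pos] by (auto intro!: continuous_intros)
  show 1: "(flux \<kappa> n has_real_derivative - (weight \<kappa> u * iterate \<kappa> n u)) (at u)"
    and 2: "0 \<le> flux \<kappa> n u" for u
    using fl flc by auto
  show 3: "flux \<kappa> n u \<le> weight \<kappa> u * slope \<kappa> u * majorant \<kappa> u ^ n / fact n" for u
    using fl(4) flc by simp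
  let ?C = "\<lambda>u. majorant \<kappa> u ^ Suc n / fact (Suc n)"
  let ?c = "\<lambda>u. majorant \<kappa> u ^ n * slope \<kappa> u / fact n"
  have gB: "(?C has_real_derivative - ?c u) (at u)" for u
    by (rule DERIV_cong[OF DERIV_cdivide[OF DERIV_power[OF majorant_deriv]]])
       (simp add: mult.commute del: of_nat_Suc)
  have gle: "flux \<kappa> n u / weight \<kappa> u \<le> ?c u" for u
    using 3[of u] weight_pos[of \<kappa> u] by (simp add: divide_simps mult_ac)
  have glim: "(?C \<longlongrightarrow> 0) at_top"
    using tendsto_divide[OF tendsto_power[OF majorant_tendsto_0[of \<kappa>], of "Suc n"] tendsto_const, of "fact (Suc n)"] by simp
  have gc: "isCont (\<lambda>u. flux \<kappa> n u / weight \<kappa> u) u" "0 \<le> flux \<kappa> n u / weight \<kappa> u" for u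
    using wc DERIV_isCont[OF 1] 2 less_imp_le[OF weight_pos] weight_pos less_irrefl
    by (auto intro!: continuous_intros) (metis less_irrefl weight_pos)
  have it: "iterate \<kappa> (Suc n) = tail_integral (\<lambda>u. flux \<kappa> n u / weight \<kappa> u)"
    by (simp add: flux_def iterate.simps(2))
  note g = tail_integral[of "\<lambda>u. flux \<kappa> n u / weight \<kappa> u" ?C ?c, folded it, OF gc gB gle glim]
  show "(iterate \<kappa> (Suc n) has_real_derivative - (flux \<kappa> n u / weight \<kappa> u)) (at u)"
    "0 \<le> iterate \<kappa> (Suc n) u" "iterate \<kappa> (Suc n) u \<le> majorant \<kappa> u ^ Suc n / fact (Suc n)"
    using g by auto
qed

lemma iterate_bounds:
  "isCont (iterate \<kappa> n) u \<and> 0 \<le> iterate \<kappa> n u \<and> iterate \<kappa> n u \<le> majorant \<kappa> u ^ n / fact n"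
proof (induction n arbitrary: u)
  case (Suc n)
  then show ?case
    using iterate_step[of \<kappa> n] DERIV_isCont by blast
qed auto

lemmas iterate_nonneg = iterate_bounds[THEN conjunct2, THEN conjunct1]
lemmas iterate_le = iterate_bounds[THEN conjunct2, THEN conjunct2]

lemma
  shows flux_deriv: "(flux \<kappa> n has_real_derivative - (weight \<kappa> u * iterate \<kappa> n u)) (at u)"
    and flux_nonneg: "0 \<le> flux \<kappa> n u" 
    and flux_le: "flux \<kappa> n u \<le> weight \<kappa> u * slope \<kappa> u * majorant \<kappa> u ^ n / fact n"
    and iterate_deriv: "(iterate \<kappa> (Suc n) has_real_derivative - (flux \<kappa> n u / weight \<kappa> u)) (at u)"
proof -
  have b: "\<And>u. isCont (iterate \<kappa> n) u" "\<And>u. 0 \<le> iterate \<kappa> n u"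
    "\<And>u. iterate \<kappa> n u \<le> majorant \<kappa> u ^ n / fact n" using iterate_bounds by blast+
  show "(flux \<kappa> n has_real_derivative - (weight \<kappa> u * iterate \<kappa> n u)) (at u)" "0 \<le> flux \<kappa> n u"
    "flux \<kappa> n u \<le> weight \<kappa> u * slope \<kappa> u * majorant \<kappa> u ^ n / fact n"
    "(iterate \<kappa> (Suc n) has_real_derivative - (flux \<kappa> n u / weight \<kappa> u)) (at u)"
    by (rule iterate_step[OF b])+
qed

section \<open>The recessive solution as a power series in the spectral parameter\<close>

lemma has_vector_derivative_suminf:
  fixes f f' :: "nat \<Rightarrow> real \<Rightarrow> 'a :: banach"
  assumes f: "\<And>n x. a < x \<Longrightarrow> x < b \<Longrightarrow> (f n has_vector_derivative f' n x) (at x)"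
    and M: "\<And>n x. a < x \<Longrightarrow> x < b \<Longrightarrow> norm (f' n x) \<le> M n" "summable M"
    and sm: "\<And>x. a < x \<Longrightarrow> x < b \<Longrightarrow> summable (\<lambda>n. f n x)"
    and x: "a < x" "x < b"
  shows "((\<lambda>x. \<Sum>n. f n x) has_vector_derivative (\<Sum>n. f' n x)) (at x)"
proof -
  let ?S = "{a<..<b}"
  let ?g' = "\<lambda>x. \<Sum>n. f' n x"
  have ul: "uniform_limit ?S (\<lambda>n x. \<Sum>i<n. f' i x) ?g' sequentially"
    by (rule Weierstrass_m_test[OF _ M(2)]) (use M in auto)
  have "\<exists>g. \<forall>x\<in>?S. (\<lambda>n. f n x) sums g x \<and> (g has_derivative (\<lambda>h. h *\<^sub>R ?g' x)) (at x within ?S)"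
  proof (rule has_derivative_series[where f' = "\<lambda>n x h. h *\<^sub>R f' n x"])
    show "(f n has_derivative (\<lambda>h. h *\<^sub>R f' n x)) (at x within ?S)" if "x \<in> ?S" for n x
      using f[of x n] that has_derivative_at_withinI by (auto simp: has_vector_derivative_def)
    fix e :: real assume e: "e > 0"
    have "\<forall>\<^sub>F n in sequentially. \<forall>x\<in>?S. dist (\<Sum>i<n. f' i x) (?g' x) < e"
      using uniform_limitD[OF ul e] .
    then show "\<forall>\<^sub>F n in sequentially. \<forall>x\<in>?S. \<forall>h. norm ((\<Sum>i<n. h *\<^sub>R f' i x) - h *\<^sub>R ?g' x) \<le> e * norm h"
    proof eventually_elim
      case (elim n)
      show ?case
      proof (intro ballI allI)
        fix x h assume "x \<in> ?S"
        have "norm ((\<Sum>i<n. h *\<^sub>R f' i x) - h *\<^sub>R ?g' x) = norm h * norm ((\<Sum>i<n. f' i x) - ?g' x)"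
          by (simp add: scaleR_right.sum[symmetric] scaleR_diff_right[symmetric])
        also have "\<dots> \<le> norm h * e"
          using elim \<open>x \<in> ?S\<close> by (intro mult_left_mono) (auto simp: dist_norm intro: less_imp_le)
        finally show "norm ((\<Sum>i<n. h *\<^sub>R f' i x) - h *\<^sub>R ?g' x) \<le> e * norm h" by (simp add: mult.commute)
      qed
    qed
  next
    show "x \<in> ?S" using x by simp
    show "(\<lambda>n. f n x) sums (\<Sum>n. f n x)" using sm[OF x] by (rule summable_sums)
  qed simp
  then obtain g where "\<forall>x\<in>?S. (\<lambda>n. f n x) sums g x \<and> (g has_derivative (\<lambda>h. h *\<^sub>R ?g' x)) (at x within ?S)"
    by blast
  then have g: "\<And>x. x \<in> ?S \<Longrightarrow> (\<lambda>n. f n x) sums g x"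
    "\<And>x. x \<in> ?S \<Longrightarrow> (g has_vector_derivative ?g' x) (at x within ?S)"
    unfolding has_vector_derivative_def by blast+
  have "(g has_vector_derivative ?g' x) (at x)"
    using g(2)[of x] x at_within_open[of x ?S] by (simp add: open_greaterThanLessThan)
  then show ?thesis
    by (rule has_vector_derivative_transform_within_open[where S = ?S])
       (use x g(1) sums_unique in auto)
qed

text \<open>
The functions \<open>h\<close> and \<open>A = P h'\<close>, for real as well as for complex \<open>c\<close>. They satisfy the first-order system
\<open>h' = A / P\<close>, \<open>A' = - c P h\<close>.
\<close>

definition profile :: "real \<Rightarrow> 'a \<Rightarrow> real \<Rightarrow> 'a :: {banach, real_normed_field}" where
  "profile \<kappa> c u = (\<Sum>n. of_real (iterate \<kappa> n u) * (- c) ^ n)"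

definition momentum :: "real \<Rightarrow> 'a \<Rightarrow> real \<Rightarrow> 'a :: {banach, real_normed_field}" where
  "momentum \<kappa> c u = c * (\<Sum>n. of_real (flux \<kappa> n u) * (- c) ^ n)"

lemma exp_terms_summable: "summable (\<lambda>n. (a::real) * (x ^ n / fact n))"
  using summable_exp[of x] by (intro summable_mult) (simp add: divide_inverse mult.commute)

lemma exp_terms_suminf: "(\<Sum>n. x ^ n / fact n) = exp (x::real)"
  by (simp add: exp_def divide_inverse mult.commute)

lemma profile_term_le:
  fixes c :: "'a :: {banach, real_normed_field}"
  assumes "norm c \<le> r" "a \<le> u"
  shows "norm (of_real (iterate \<kappa> n u) * (- c) ^ n) \<le> (r * majorant \<kappa> a) ^ n / fact n"
proof -
  have "norm (of_real (iterate \<kappa> n u) * (- c) ^ n) = iterate \<kappa> n u * norm c ^ n"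
    using iterate_nonneg[of \<kappa> n u] by (simp add: norm_mult norm_power)
  also have "\<dots> \<le> (majorant \<kappa> a ^ n / fact n) * r ^ n"
    using assms majorant_nonneg[of \<kappa>]
    by (intro mult_mono power_mono order_trans[OF iterate_le] divide_right_mono majorant_antimono) auto
  finally show ?thesis by (simp add: power_mult_distrib mult_ac)
qed

lemma momentum_term_le:
  fixes c :: "'a :: {banach, real_normed_field}"
  assumes "norm c \<le> r" "a \<le> u"
  shows "norm (of_real (flux \<kappa> n u) * (- c) ^ n)
          \<le> weight \<kappa> u * slope \<kappa> a * ((r * majorant \<kappa> a) ^ n / fact n)"
proof -
  have "norm (of_real (flux \<kappa> n u) * (- c) ^ n) = flux \<kappa> n u * norm c ^ n"
    using flux_nonneg[of \<kappa> n u] by (simp add: norm_mult norm_power)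
  also have "\<dots> \<le> (weight \<kappa> u * slope \<kappa> a * majorant \<kappa> a ^ n / fact n) * r ^ n"
    using assms majorant_nonneg[of \<kappa>] slope_nonneg[of \<kappa>] less_imp_le[OF weight_pos[of \<kappa> u]]
    by (intro mult_mono power_mono order_trans[OF flux_le] divide_right_mono majorant_antimono slope_antimono) 
       (auto intro!: mult_nonneg_nonneg divide_nonneg_nonneg)
  finally show ?thesis by (simp add: power_mult_distrib mult_ac)
qed

lemma profile_summable:
  fixes c :: "'a :: {banach, real_normed_field}"
  shows "summable (\<lambda>n. norm (of_real (iterate \<kappa> n u) * (- c) ^ n))"
  by (rule summable_comparison_test_ev[OF _ exp_terms_summable[of 1 "norm c * majorant \<kappa> u"]])
     (use profile_term_le[of c "norm c" u u \<kappa>] in auto)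

lemma momentum_summable:
  fixes c :: "'a :: {banach, real_normed_field}"
  shows "summable (\<lambda>n. norm (of_real (flux \<kappa> n u) * (- c) ^ n))"
  by (rule summable_comparison_test_ev[OF _ exp_terms_summable[of "weight \<kappa> u * slope \<kappa> u" "norm c * majorant \<kappa> u"]])
     (use momentum_term_le[of c "norm c" u u \<kappa>] in auto)

text \<open>
As the majorant tends to \<open>0\<close> at infinity, this is both the normalisation \<open>h \<rightarrow> 1\<close> with its rate and, for
bounded \<open>c\<close>, a bound on \<open>h\<close> that is uniform in \<open>c\<close>.
\<close>

lemma profile_minus_1_le:
  fixes c :: "'a :: {banach, real_normed_field}"
  shows "norm (profile \<kappa> c u - 1) \<le> exp (norm c * majorant \<kappa> u) - 1"
proof -
  let ?t = "\<lambda>n. of_real (iterate \<kappa> n u) * (- c) ^ n"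
  let ?e = "\<lambda>n. (norm c * majorant \<kappa> u) ^ n / fact n"
  have s: "summable ?t" using summable_norm_cancel[OF profile_summable] .
  have e: "summable ?e" using exp_terms_summable[of 1] by simp
  have "profile \<kappa> c u - 1 = (\<Sum>n. ?t (Suc n))"
    using suminf_split_head[OF s] by (simp add: profile_def)
  also have "norm \<dots> \<le> (\<Sum>n. ?e (Suc n))"
  proof (rule norm_suminf_le)
    show "norm (?t (Suc n)) \<le> ?e (Suc n)" for n by (rule profile_term_le) auto
    show "summable (\<lambda>n. ?e (Suc n))" using e by (subst summable_Suc_iff)
  qed
  also have "\<dots> = exp (norm c * majorant \<kappa> u) - 1"
    using suminf_split_head[OF e] by (simp add: exp_terms_suminf)
  finally show ?thesis .
qed

lemma profile_le:
  fixes c :: "'a :: {banach, real_normed_field}"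
  shows "norm (profile \<kappa> c u) \<le> exp (norm c * majorant \<kappa> u)"
  using norm_triangle_ineq[of "profile \<kappa> c u - 1" 1] profile_minus_1_le[of \<kappa> c u] by simp

lemma momentum_le:
  fixes c :: "'a :: {banach, real_normed_field}"
  shows "norm (momentum \<kappa> c u) \<le> norm c * (weight \<kappa> u * slope \<kappa> u * exp (norm c * majorant \<kappa> u))"
proof -
  have "norm (\<Sum>n. of_real (flux \<kappa> n u) * (- c) ^ n)
     \<le> (\<Sum>n. weight \<kappa> u * slope \<kappa> u * ((norm c * majorant \<kappa> u) ^ n / fact n))"
    by (rule norm_suminf_le[OF _ exp_terms_summable])
       (use momentum_term_le[of c "norm c" u u \<kappa>] in auto)
  also have "\<dots> = weight \<kappa> u * slope \<kappa> u * exp (norm c * majorant \<kappa> u)"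
    using exp_terms_summable[of 1 "norm c * majorant \<kappa> u"] 
    by (subst suminf_mult) (auto simp: exp_terms_suminf)
  finally show ?thesis
    unfolding momentum_def norm_mult by (rule mult_left_mono) simp
qed

lemma profile_tendsto: 
  fixes c :: "'a :: {banach, real_normed_field}"
  shows "(profile \<kappa> c \<longlongrightarrow> 1) at_top"
proof -
  have "((\<lambda>u. exp (norm c * majorant \<kappa> u) - 1) \<longlongrightarrow> exp (norm c * 0) - 1) at_top"
    by (intro tendsto_intros majorant_tendsto_0)
  then have "((\<lambda>u. profile \<kappa> c u - 1) \<longlongrightarrow> 0) at_top"
    by (intro tendsto_0_le[where K = 1 and g = "\<lambda>u. profile \<kappa> c u - 1" and f = "\<lambda>u. exp (norm c * majorant \<kappa> u) - 1"])
       (auto intro!: always_eventually order_trans[OF profile_minus_1_le])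
  then show ?thesis by (simp add: LIM_zero_iff)
qed

lemma momentum_tendsto: 
  fixes c :: "'a :: {banach, real_normed_field}"
  shows "(momentum \<kappa> c \<longlongrightarrow> 0) at_top"
proof (rule tendsto_0_le[where K = 1])
  show "((\<lambda>u. norm c * (weight \<kappa> u * slope \<kappa> u * exp (norm c * majorant \<kappa> u))) \<longlongrightarrow> 0) at_top"
    by (rule tendsto_eq_rhs, (rule tendsto_intros weight_tendsto_0 slope_tendsto_0 majorant_tendsto_0)+) auto
  show "\<forall>\<^sub>F u in at_top. norm (momentum \<kappa> c u)
     \<le> norm (norm c * (weight \<kappa> u * slope \<kappa> u * exp (norm c * majorant \<kappa> u))) * 1"
    by (auto intro!: always_eventually order_trans[OF momentum_le])
qed

lemma profile_deriv:
  fixes c :: "'a :: {banach, real_normed_field}"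
  shows "(profile \<kappa> c has_vector_derivative momentum \<kappa> c u / of_real (weight \<kappa> u)) (at u)"
proof -
  let ?f' = "\<lambda>n u. case n of 0 \<Rightarrow> 0 | Suc m \<Rightarrow> of_real (- (flux \<kappa> m u / weight \<kappa> u)) * (- c) ^ n"
  let ?M = "\<lambda>n. case n of 0 \<Rightarrow> 0 | Suc m \<Rightarrow> norm c * slope \<kappa> (u - 1) * ((norm c * majorant \<kappa> (u - 1)) ^ m / fact m)"
  have fe: "norm (of_real (- (flux \<kappa> m x / weight \<kappa> x)) * (- c) ^ Suc m)
      = norm c * (norm (of_real (flux \<kappa> m x) * (- c) ^ m) / weight \<kappa> x)" for m x
    by (simp add: norm_mult norm_power less_imp_le[OF weight_pos] norm_divide)
  have "(profile \<kappa> c has_vector_derivative (\<Sum>n. ?f' n u)) (at u)"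
    unfolding profile_def
  proof (rule has_vector_derivative_suminf[where a = "u - 1" and b = "u + 1" and M = ?M])
    show "((\<lambda>x. of_real (iterate \<kappa> n x) * (- c) ^ n) has_vector_derivative ?f' n x) (at x)" for n x
    proof (cases n)
      case (Suc m)
      have "((\<lambda>x. of_real (iterate \<kappa> n x) :: 'a) has_vector_derivative of_real (- (flux \<kappa> m x / weight \<kappa> x))) (at x)"
        using iterate_deriv[of \<kappa> m x] unfolding Suc
        by (intro has_vector_derivative_of_real) (simp add: has_real_derivative_iff_has_vector_derivative)
      from has_vector_derivative_mult_left[OF this, of "(- c) ^ n"] show ?thesis unfolding Suc nat.case .
    qed auto
    show "norm (?f' n x) \<le> ?M n" if "u - 1 < x" for n x
    proof (cases n)
      case (Suc m)
      show ?thesis using momentum_term_le[of c "norm c" "u - 1" x \<kappa> m] that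
        unfolding Suc nat.case fe mult.assoc
        by (intro mult_left_mono) (auto simp: pos_divide_le_eq mult_ac)
    qed auto
    have "summable (\<lambda>m. ?M (Suc m))" unfolding nat.case by (rule exp_terms_summable)
    then show "summable ?M" by (subst (asm) summable_Suc_iff)
    show "summable (\<lambda>n. of_real (iterate \<kappa> n x) * (- c) ^ n)" for x
      using summable_norm_cancel[OF profile_summable] .
  qed auto
  also have "(\<Sum>n. ?f' n u) = (\<Sum>n. (c / of_real (weight \<kappa> u)) * (of_real (flux \<kappa> n u) * (- c) ^ n))"
  proof -
    have "summable (\<lambda>m. (c / of_real (weight \<kappa> u)) * (of_real (flux \<kappa> m u) * (- c) ^ m))"
      using summable_norm_cancel[OF momentum_summable] by (intro summable_mult)
    then have "summable (\<lambda>m. ?f' (Suc m) u)" by (simp add: mult_ac)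
    then have "summable (\<lambda>m. ?f' m u)" by (subst (asm) summable_Suc_iff)
    from suminf_split_head[OF this] show ?thesis by (simp add: mult_ac)
  qed
  also have "\<dots> = momentum \<kappa> c u / of_real (weight \<kappa> u)"
    unfolding momentum_def
    by (subst suminf_mult[OF summable_norm_cancel[OF momentum_summable]]) simp
  finally show ?thesis .
qed

lemma weight_bounded: "\<exists>K. \<forall>x. a \<le> x \<and> x \<le> b \<longrightarrow> weight \<kappa> x \<le> K"
proof -
  have "isCont (weight \<kappa>) x" for x by (rule DERIV_isCont[OF weight_deriv])
  then have "compact (weight \<kappa> ` {a..b})"
    by (intro compact_continuous_image continuous_at_imp_continuous_on ballI) auto
  then obtain K where "\<forall>y \<in> weight \<kappa> ` {a..b}. norm y \<le> K"
    using compact_imp_bounded bounded_iff by blast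
  then have "\<forall>x. a \<le> x \<and> x \<le> b \<longrightarrow> weight \<kappa> x \<le> K" by (force dest: abs_le_D1)
  then show ?thesis by blast
qed

lemma momentum_deriv:
  fixes c :: "'a :: {banach, real_normed_field}"
  shows "(momentum \<kappa> c has_vector_derivative - c * of_real (weight \<kappa> u) * profile \<kappa> c u) (at u)"
proof -
  let ?f' = "\<lambda>n u. of_real (- (weight \<kappa> u * iterate \<kappa> n u)) * (- c) ^ n"
  obtain K where K: "\<And>x. u - 1 \<le> x \<Longrightarrow> x \<le> u + 1 \<Longrightarrow> weight \<kappa> x \<le> K"
    using weight_bounded[of "u-1" "u+1" \<kappa>] by auto
  let ?M = "\<lambda>n. K * ((norm c * majorant \<kappa> (u - 1)) ^ n / fact n)"
  have "((\<lambda>x. \<Sum>n. of_real (flux \<kappa> n x) * (- c) ^ n) has_vector_derivative (\<Sum>n. ?f' n u)) (at u)"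
  proof (rule has_vector_derivative_suminf[where a = "u - 1" and b = "u + 1" and M = ?M])
    show "((\<lambda>x. of_real (flux \<kappa> n x) * (- c) ^ n) has_vector_derivative ?f' n x) (at x)" for n x
      by (intro has_vector_derivative_mult_left has_vector_derivative_of_real)
         (simp add: flux_deriv has_real_derivative_iff_has_vector_derivative[symmetric])
    show "norm (?f' n x) \<le> ?M n" if "u - 1 < x" "x < u + 1" for n x
    proof -
      have "norm (?f' n x) = weight \<kappa> x * norm (of_real (iterate \<kappa> n x) * (- c) ^ n)"
        by (simp add: norm_mult norm_power less_imp_le[OF weight_pos])
      also have "\<dots> \<le> ?M n"
        using that profile_term_le[of c "norm c" "u - 1" x \<kappa> n] K[of x] less_le_trans[OF weight_pos K[of x]]
        by (intro mult_mono) auto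
      finally show ?thesis .
    qed
    show "summable ?M" by (rule exp_terms_summable)
    show "summable (\<lambda>n. of_real (flux \<kappa> n x) * (- c) ^ n)" for x
      using summable_norm_cancel[OF momentum_summable] .
  qed auto
  also have "(\<Sum>n. ?f' n u) = (\<Sum>n. - of_real (weight \<kappa> u) * (of_real (iterate \<kappa> n u) * (- c) ^ n))"
    by (simp add: mult_ac)
  also have "\<dots> = - of_real (weight \<kappa> u) * profile \<kappa> c u"
    unfolding profile_def by (rule suminf_mult[OF summable_norm_cancel[OF profile_summable]])
  finally have "((\<lambda>x. \<Sum>n. of_real (flux \<kappa> n x) * (- c) ^ n) has_vector_derivative - of_real (weight \<kappa> u) * profile \<kappa> c u) (at u)" .
  from has_vector_derivative_mult_right[OF this, of c] show ?thesis
    unfolding momentum_def by (simp add: mult_ac)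
qed

lemma profile_of_real: "profile \<kappa> (of_real c :: 'a :: {banach, real_normed_field}) u = of_real (profile \<kappa> c u)"
  unfolding profile_def using suminf_of_real[OF summable_norm_cancel[OF profile_summable[of \<kappa> u c]], where 'a = 'a]
  by simp

lemma momentum_of_real: "momentum \<kappa> (of_real c :: 'a :: {banach, real_normed_field}) u = of_real (momentum \<kappa> c u)"
  unfolding momentum_def using suminf_of_real[OF summable_norm_cancel[OF momentum_summable[of \<kappa> u c]], where 'a = 'a]
  by simp

lemma profile_cnj: "profile \<kappa> (cnj c) u = cnj (profile \<kappa> c u)"
  unfolding profile_def
  using bounded_linear.suminf[OF bounded_linear_cnj summable_norm_cancel[OF profile_summable[of \<kappa> u c]]] by simp

lemma profile_param_deriv:
  fixes c :: "'a :: {banach, real_normed_field}"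
  shows "\<exists>D. ((\<lambda>c. profile \<kappa> c u) has_field_derivative D) (at c)"
proof -
  have "summable (\<lambda>n. of_real (iterate \<kappa> n u) * y ^ n)" for y :: 'a
    using summable_norm_cancel[OF profile_summable[of \<kappa> u "- y"]] by simp
  from termdiffs_strong_converges_everywhere[OF this, of "- c"] obtain D where
    "((\<lambda>y. \<Sum>n. of_real (iterate \<kappa> n u) * y ^ n) has_field_derivative D) (at (- c))" by blast
  from DERIV_chain2[OF this DERIV_minus[OF DERIV_ident]] show ?thesis
    unfolding profile_def by blast
qed

lemma momentum_param_deriv:
  fixes c :: "'a :: {banach, real_normed_field}"
  shows "\<exists>D. ((\<lambda>c. momentum \<kappa> c u) has_field_derivative D) (at c)"
proof -
  have "summable (\<lambda>n. of_real (flux \<kappa> n u) * y ^ n)" for y :: 'a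
    using summable_norm_cancel[OF momentum_summable[of \<kappa> u "- y"]] by simp
  from termdiffs_strong_converges_everywhere[OF this, of "- c"] obtain D where
    "((\<lambda>y. \<Sum>n. of_real (flux \<kappa> n u) * y ^ n) has_field_derivative D) (at (- c))" by blast
  from DERIV_mult[OF DERIV_ident DERIV_chain2[OF this DERIV_minus[OF DERIV_ident]]] show ?thesis
    unfolding momentum_def by blast
qed

text \<open>
Joint continuity in \<open>(u, c)\<close> is what allows one continuous phase to be chosen on the whole plane.
\<close>

lemma jointly_continuous_suminf:
  fixes f :: "nat \<Rightarrow> real \<Rightarrow> real" and M :: "real \<Rightarrow> real \<Rightarrow> real \<Rightarrow> nat \<Rightarrow> real"
  assumes f: "\<And>n u. isCont (f n) u"
    and M: "\<And>a b r n u c. a \<le> u \<Longrightarrow> u \<le> b \<Longrightarrow> norm c \<le> r \<Longrightarrow> norm (f n u * (- c) ^ n) \<le> M a b r n" 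
      "\<And>a b r. summable (M a b r)"
  shows "continuous_on UNIV (\<lambda>(u, c). \<Sum>n. f n u * (- c) ^ n)"
proof (rule continuous_at_imp_continuous_on, safe)
  fix u c :: real
  let ?S = "{u - 1<..<u + 1} \<times> {c - 1<..<c + 1}"
  have c: "norm d \<le> \<bar>c\<bar> + 1" if "d \<in> {c - 1<..<c + 1}" for d using that by auto
  have "continuous_on ?S (\<lambda>p. \<Sum>n. f n (fst p) * (- snd p) ^ n)"
  proof (rule uniform_limit_theorem[OF _ Weierstrass_m_test[OF _ M(2)]])
    have fc: "continuous_on UNIV (f n)" for n using f by (simp add: continuous_at_imp_continuous_on)
    show "\<forall>\<^sub>F n in sequentially. continuous_on ?S (\<lambda>p. \<Sum>i<n. f i (fst p) * (- snd p) ^ i)"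
      by (intro always_eventually allI continuous_intros continuous_on_compose2[OF fc]) auto
    show "norm (f n (fst p) * (- snd p) ^ n) \<le> M (u - 1) (u + 1) (\<bar>c\<bar> + 1) n" if "p \<in> ?S" for n p
      using that by (intro M(1) c) auto
  qed auto
  then have "continuous (at (u, c)) (\<lambda>p. \<Sum>n. f n (fst p) * (- snd p) ^ n)"
    by (subst (asm) continuous_on_eq_continuous_at) (auto intro!: open_Times)
  then show "continuous (at (u, c)) (\<lambda>(u, c). \<Sum>n. f n u * (- c) ^ n)"
    by (simp add: case_prod_beta')
qed

lemma profile_continuous: "continuous_on UNIV (\<lambda>(u, c::real). profile \<kappa> c u)"
  unfolding profile_def of_real_eq_id id_def
proof (rule jointly_continuous_suminf)
  show "norm (iterate \<kappa> n u * (- c) ^ n) \<le> (r * majorant \<kappa> a) ^ n / fact n" 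
    if "a \<le> u" "norm c \<le> r" for a r n u c
    using profile_term_le[of c r a u \<kappa> n] that by simp
  show "summable (\<lambda>n. (r * majorant \<kappa> a) ^ n / fact n)" for r a
    using exp_terms_summable[of 1] by simp
qed (use iterate_bounds in auto)

lemma momentum_continuous: "continuous_on UNIV (\<lambda>(u, c::real). momentum \<kappa> c u)"
proof -
  define K where "K a b = (SOME K. \<forall>x. a \<le> x \<and> x \<le> b \<longrightarrow> weight \<kappa> x \<le> K)" for a b
  have K: "weight \<kappa> x \<le> K a b" if "a \<le> x" "x \<le> b" for a b x
    using someI_ex[OF weight_bounded[of a b \<kappa>]] that by (simp add: K_def)
  have "continuous_on UNIV (\<lambda>(u, c::real). \<Sum>n. flux \<kappa> n u * (- c) ^ n)"
  proof (rule jointly_continuous_suminf)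
    show "isCont (flux \<kappa> n) u" for n u by (rule DERIV_isCont[OF flux_deriv])
    show "norm (flux \<kappa> n u * (- c) ^ n) \<le> (K a b * slope \<kappa> a) * ((r * majorant \<kappa> a) ^ n / fact n)" 
      if u: "a \<le> u" "u \<le> b" "norm c \<le> r" for a b r n u c
    proof -
      have "0 \<le> r" using u(3) norm_ge_zero order_trans by blast
      have "norm (flux \<kappa> n u * (- c) ^ n) \<le> weight \<kappa> u * slope \<kappa> a * ((r * majorant \<kappa> a) ^ n / fact n)"
        using momentum_term_le[of c r a u \<kappa> n] u by simp
      also have "\<dots> \<le> (K a b * slope \<kappa> a) * ((r * majorant \<kappa> a) ^ n / fact n)"
        by (intro mult_right_mono K u slope_nonneg divide_nonneg_nonneg zero_le_power mult_nonneg_nonneg majorant_nonneg \<open>0 \<le> r\<close>) auto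
      finally show ?thesis .
    qed
    show "summable (\<lambda>n. (K a b * slope \<kappa> a) * ((r * majorant \<kappa> a) ^ n / fact n))" for a b r
      by (rule exp_terms_summable)
  qed
  from continuous_on_mult[OF continuous_on_snd[OF continuous_on_id] this]
  show ?thesis by (simp add: momentum_def case_prod_beta')
qed

section \<open>The Schroedinger form of the equation\<close>

text \<open>
The square root of the weight. The product \<open>g = amp * h\<close> satisfies an equation without first-order term;
\<open>wave'\<close> is its derivative, and \<open>wavenumber\<close> is the factor in \<open>g'' = - wavenumber * g\<close>, that is \<open>- \<mu>\<^sup>2 - V\<close>
when \<open>c = (\<kappa> - 1/2)\<^sup>2 - \<mu>\<^sup>2\<close>.
\<close>

definition amp :: "real \<Rightarrow> real \<Rightarrow> real" where
  "amp \<kappa> u = exp (- exp u / 2 + (\<kappa> - 1/2) * u)"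

definition wave :: "real \<Rightarrow> real \<Rightarrow> real \<Rightarrow> real" where
  "wave \<kappa> c u = amp \<kappa> u * profile \<kappa> c u"

definition wave' :: "real \<Rightarrow> real \<Rightarrow> real \<Rightarrow> real" where
  "wave' \<kappa> c u = amp \<kappa> u * (\<kappa> - 1/2 - exp u / 2) * profile \<kappa> c u + momentum \<kappa> c u / amp \<kappa> u"

definition wavenumber :: "real \<Rightarrow> real \<Rightarrow> real \<Rightarrow> real" where
  "wavenumber \<kappa> c u = c - (\<kappa> - 1/2)\<^sup>2 - (exp (2 * u) / 4 - \<kappa> * exp u)"

lemma amp_pos [simp]: "amp \<kappa> u > 0"
  by (simp add: amp_def)

lemma amp_square: "amp \<kappa> u * amp \<kappa> u = weight \<kappa> u"
  unfolding amp_def weight_def exp_add[symmetric] by (simp add: algebra_simps)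

lemma amp_deriv: "(amp \<kappa> has_real_derivative amp \<kappa> u * (\<kappa> - 1/2 - exp u / 2)) (at u)"
  unfolding amp_def by (auto intro!: derivative_eq_intros)

lemma profile_real_deriv: "(profile \<kappa> c has_real_derivative momentum \<kappa> c u / weight \<kappa> u) (at u)"
  using profile_deriv[of \<kappa> c u] by (simp add: has_real_derivative_iff_has_vector_derivative)

lemma momentum_real_deriv: "(momentum \<kappa> c has_real_derivative - c * weight \<kappa> u * profile \<kappa> c u) (at u)"
  using momentum_deriv[of \<kappa> c u] by (simp add: has_real_derivative_iff_has_vector_derivative)

lemma wave_deriv: "(wave \<kappa> c has_real_derivative wave' \<kappa> c u) (at u)"
proof -
  have "momentum \<kappa> c u / weight \<kappa> u * amp \<kappa> u = momentum \<kappa> c u / amp \<kappa> u"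
    unfolding amp_square[symmetric] using less_imp_neq[OF amp_pos[of \<kappa> u]] by (simp add: field_simps)
  then show ?thesis
    unfolding wave_def[abs_def] wave'_def
    by (auto intro!: derivative_eq_intros amp_deriv profile_real_deriv)
qed

lemma wave'_deriv: "(wave' \<kappa> c has_real_derivative - wavenumber \<kappa> c u * wave \<kappa> c u) (at u)"
proof -
  define w where "w = amp \<kappa> u"
  define h where "h = profile \<kappa> c u"
  define A where "A = momentum \<kappa> c u"
  define x where "x = exp u"
  define r where "r = \<kappa> - 1/2 - x / 2"
  have w: "w > 0" by (simp add: w_def)
  have W: "weight \<kappa> u = w * w" by (simp add: w_def amp_square)
  have x2: "exp (2 * u) = x * x" by (simp add: x_def exp_add[symmetric])
  have a: "(amp \<kappa> has_real_derivative w * r) (at u)"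
    using amp_deriv[of \<kappa> u] by (simp add: w_def r_def x_def)
  have rd: "((\<lambda>u. \<kappa> - 1/2 - exp u / 2) has_real_derivative - x / 2) (at u)"
    by (auto intro!: derivative_eq_intros simp: x_def)
  note pd = profile_real_deriv[of \<kappa> c u, unfolded W, folded A_def]
    and md = momentum_real_deriv[of \<kappa> c u, unfolded W, folded h_def]
  have "(wave' \<kappa> c has_real_derivative
     ((w * r * r + w * (- x / 2)) * h + w * r * (A / (w * w)))
      + ((- c * (w * w) * h) * w - A * (w * r)) / (w * w)) (at u)"
    unfolding wave'_def[abs_def]
    by (rule DERIV_cong[OF DERIV_add[OF DERIV_mult[OF DERIV_mult[OF a rd] pd] DERIV_divide[OF md a]]])
       (use w in \<open>simp_all add: w_def[symmetric] h_def[symmetric] A_def[symmetric] x_def[symmetric]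
          r_def[symmetric] mult_ac\<close>)
  also have "((w * r * r + w * (- x / 2)) * h + w * r * (A / (w * w)))
      + ((- c * (w * w) * h) * w - A * (w * r)) / (w * w) = - wavenumber \<kappa> c u * wave \<kappa> c u"
    using w unfolding wavenumber_def wave_def w_def[symmetric] h_def[symmetric] x2 x_def[symmetric] r_def
    by (simp add: field_simps power2_eq_square)
  finally show ?thesis .
qed

lemma wave_tendsto: "(wave \<kappa> c \<longlongrightarrow> 0) at_top" and wave'_tendsto: "(wave' \<kappa> c \<longlongrightarrow> 0) at_top"
proof -
  have a: "(amp \<kappa> \<longlongrightarrow> 0) at_top" unfolding amp_def by real_asymp
  have ar: "((\<lambda>u. amp \<kappa> u * (\<kappa> - 1/2 - exp u / 2)) \<longlongrightarrow> 0) at_top"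
    unfolding amp_def by real_asymp
  show "(wave \<kappa> c \<longlongrightarrow> 0) at_top"
    unfolding wave_def[abs_def] using tendsto_mult[OF a profile_tendsto[of \<kappa> c]] by simp
  have "((\<lambda>u. momentum \<kappa> c u / amp \<kappa> u) \<longlongrightarrow> 0) at_top"
  proof (rule tendsto_0_le[where K = 1])
    show "((\<lambda>u. norm c * (amp \<kappa> u * slope \<kappa> u * exp (norm c * majorant \<kappa> u))) \<longlongrightarrow> 0) at_top"
      by (rule tendsto_eq_rhs, (rule tendsto_intros a slope_tendsto_0 majorant_tendsto_0)+) auto
    have "norm (momentum \<kappa> c u / amp \<kappa> u) \<le> norm c * (amp \<kappa> u * slope \<kappa> u * exp (norm c * majorant \<kappa> u))" for u
      using momentum_le[of \<kappa> c u] less_imp_le[OF amp_pos[of \<kappa> u]]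
      by (simp add: amp_square[symmetric] divide_le_eq mult_ac)
    then show "\<forall>\<^sub>F u in at_top. norm (momentum \<kappa> c u / amp \<kappa> u)
       \<le> norm (norm c * (amp \<kappa> u * slope \<kappa> u * exp (norm c * majorant \<kappa> u))) * 1"
      by (intro always_eventually allI) (metis abs_ge_self mult.right_neutral order_trans real_norm_def)
  qed
  from tendsto_add[OF tendsto_mult[OF ar profile_tendsto[of \<kappa> c]] this]
  show "(wave' \<kappa> c \<longlongrightarrow> 0) at_top"
    unfolding wave'_def[abs_def] by simp
qed

text \<open>
In the classically forbidden region \<open>g\<close> does not vanish: \<open>(g g')' = g'\<^sup>2 - wavenumber * g\<^sup>2 \<ge> 0\<close> and
\<open>g g' \<rightarrow> 0\<close>, so if \<open>g\<close> vanished at \<open>a\<close>, then \<open>g g'\<close> would vanish identically beyond \<open>a\<close>, and with it \<open>g\<close>.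
\<close>

lemma profile_nonzero_if_wavenumber_nonpos:
  assumes q: "\<And>u. u \<ge> a \<Longrightarrow> wavenumber \<kappa> c u \<le> 0"
  shows "profile \<kappa> c a \<noteq> 0"
proof
  assume h0: "profile \<kappa> c a = 0"
  let ?D = "\<lambda>u. - (wave \<kappa> c u * wave' \<kappa> c u)"
  have D: "(?D has_real_derivative - (wave' \<kappa> c u ^ 2 - wavenumber \<kappa> c u * wave \<kappa> c u ^ 2)) (at u)" for u
    by (auto intro!: derivative_eq_intros wave_deriv wave'_deriv simp: power2_eq_square algebra_simps)
  have dle: "- (wave' \<kappa> c u ^ 2 - wavenumber \<kappa> c u * wave \<kappa> c u ^ 2) \<le> 0" if "u \<ge> a" for u
    using mult_nonpos_nonneg[OF q[OF that] zero_le_power2[of "wave \<kappa> c u"]] zero_le_power2[of "wave' \<kappa> c u"]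
    by linarith
  have "?D u = 0" if "u \<ge> a" for u
  proof -
    have "?D u \<ge> 0"
      by (rule antitone_vanishing_nonneg[OF D dle _ that])
         (use tendsto_minus[OF tendsto_mult[OF wave_tendsto[of \<kappa> c] wave'_tendsto[of \<kappa> c]]] in auto)
    moreover have "?D u \<le> ?D a"
      by (rule DERIV_nonpos_imp_nonincreasing[OF that]) (use D dle in blast)
    ultimately show ?thesis using h0 by (simp add: wave_def)
  qed
  then have z: "((\<lambda>u. wave \<kappa> c u ^ 2) has_real_derivative 0) (at u)" if "u \<ge> a" for u
    using that by (intro DERIV_cong[OF DERIV_power[OF wave_deriv]]) auto
  have "wave \<kappa> c u = 0" if "u \<ge> a" for u
  proof -
    have "wave \<kappa> c u ^ 2 \<le> wave \<kappa> c a ^ 2"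
      by (rule DERIV_nonpos_imp_nonincreasing[OF that]) (use z in blast)
    then show ?thesis by (simp add: wave_def h0)
  qed
  then have "profile \<kappa> c u = 0" if "u \<ge> a" for u
    using that less_imp_neq[OF amp_pos[of \<kappa> u]] by (auto simp: wave_def)
  then have "(profile \<kappa> c \<longlongrightarrow> 0) at_top"
    by (intro tendsto_eventually) (auto simp: eventually_at_top_linorder)
  then show False
    using tendsto_unique[OF _ profile_tendsto[of \<kappa> c]] by fastforce
qed

section \<open>The Herglotz property\<close>

text \<open>
The imaginary part of \<open>A * cnj h\<close>, a Wronskian of \<open>h\<close> and its complex conjugate; it measures the failure of
\<open>c\<close> to be real.
\<close>

definition imag_flux :: "real \<Rightarrow> complex \<Rightarrow> real \<Rightarrow> real" where
  "imag_flux \<kappa> c u = Im (momentum \<kappa> c u * cnj (profile \<kappa> c u))"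

lemma imag_flux_deriv:
  "(imag_flux \<kappa> c has_real_derivative - (Im c * (weight \<kappa> u * norm (profile \<kappa> c u) ^ 2))) (at u)"
proof -
  let ?h = "profile \<kappa> c u" and ?A = "momentum \<kappa> c u" and ?P = "of_real (weight \<kappa> u) :: complex"
  have 1: "((\<lambda>u. cnj (profile \<kappa> c u)) has_vector_derivative cnj (?A / ?P)) (at u)"
    by (rule bounded_linear.has_vector_derivative[OF bounded_linear_cnj profile_deriv])
  have "((\<lambda>u. Im (momentum \<kappa> c u * cnj (profile \<kappa> c u))) has_vector_derivative
      Im (?A * cnj (?A / ?P) + (- c * ?P * ?h) * cnj ?h)) (at u)"
    by (rule bounded_linear.has_vector_derivative[OF bounded_linear_Im
          has_vector_derivative_mult[OF momentum_deriv 1]])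
  also have "Im (?A * cnj (?A / ?P) + (- c * ?P * ?h) * cnj ?h) = - (Im c * (weight \<kappa> u * norm ?h ^ 2))"
  proof -
    have "?A * cnj (?A / ?P) = of_real (norm ?A ^ 2 / weight \<kappa> u)"
      by (simp add: complex_norm_square del: of_real_power)
    then have "Im (?A * cnj (?A / ?P)) = 0" by (simp only: Im_complex_of_real)
    moreover have "Im ((- c * ?P * ?h) * cnj ?h) = - (Im c * (weight \<kappa> u * norm ?h ^ 2))"
      unfolding cmod_power2 by (simp add: power2_eq_square algebra_simps)
    ultimately show ?thesis by (simp only: plus_complex.sel add_0)
  qed
  finally show ?thesis
    unfolding imag_flux_def has_real_derivative_iff_has_vector_derivative .
qed

lemma imag_flux_tendsto: "(imag_flux \<kappa> c \<longlongrightarrow> 0) at_top"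
proof -
  have "((\<lambda>u. Im (momentum \<kappa> c u * cnj (profile \<kappa> c u))) \<longlongrightarrow> Im (0 * cnj 1)) at_top"
    by (intro tendsto_intros momentum_tendsto profile_tendsto)
  then show ?thesis by (simp add: imag_flux_def[abs_def])
qed

lemma imag_flux_nonneg: 
  assumes "Im c \<ge> 0" shows "imag_flux \<kappa> c u \<ge> 0"
  by (rule antitone_vanishing_nonneg[OF imag_flux_deriv _ imag_flux_tendsto order_refl])
     (use assms less_imp_le[OF weight_pos] in auto)

lemma imag_flux_antimono:
  assumes "Im c \<ge> 0" "u \<le> v" shows "imag_flux \<kappa> c v \<le> imag_flux \<kappa> c u"
proof (rule DERIV_nonpos_imp_nonincreasing[OF assms(2)])
  fix x
  show "\<exists>y. (imag_flux \<kappa> c has_real_derivative y) (at x) \<and> y \<le> 0"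
    using imag_flux_deriv[of \<kappa> c x] assms(1) less_imp_le[OF weight_pos[of \<kappa> x]] 
    by (intro exI[of _ "- (Im c * (weight \<kappa> x * norm (profile \<kappa> c x) ^ 2))"] conjI) auto
qed

text \<open>
By \<open>imag_flux_deriv\<close> the flux at \<open>u\<close> is \<open>Im c\<close> times the integral of \<open>P |h|\<^sup>2\<close> over \<open>[u, \<infinity>)\<close>. Far out \<open>h\<close> is
close to \<open>1\<close> uniformly for bounded \<open>c\<close>, so already the integral over one unit interval is bounded below. The
uniformity in \<open>c\<close> is what permits the passage to the real axis in \<open>phase_derivative_positive\<close>.
\<close>

lemma imag_flux_lower_bound:
  "\<exists>\<delta>>0. \<forall>c. norm c \<le> R \<and> Im c \<ge> 0 \<longrightarrow> imag_flux \<kappa> c u \<ge> \<delta> * Im c"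
proof -
  have "((\<lambda>v. exp (R * majorant \<kappa> v) - 1) \<longlongrightarrow> exp (R * 0) - 1) at_top"
    by (intro tendsto_intros majorant_tendsto_0)
  then have "\<forall>\<^sub>F v in at_top. exp (R * majorant \<kappa> v) - 1 < 1/2"
    by (rule order_tendstoD) simp
  then obtain U0 where U0: "\<And>v. v \<ge> U0 \<Longrightarrow> exp (R * majorant \<kappa> v) - 1 < 1/2"
    unfolding eventually_at_top_linorder by blast
  define U where "U = Max {U0, u, 0}"
  have U: "U \<ge> U0" "U \<ge> u" "U \<ge> 0" by (auto simp: U_def)
  \<comment> \<open>A lower bound for the weight on \<open>[U, U + 1]\<close>.\<close>
  define \<eta> where "\<eta> = exp (- exp (U + 1) - \<bar>2 * \<kappa> - 1\<bar> * (U + 1))"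
  have \<eta>: "\<eta> > 0" "weight \<kappa> v \<ge> \<eta>" if "U \<le> v" "v \<le> U + 1" for v
  proof -
    have "\<bar>2 * \<kappa> - 1\<bar> * (U + 1) \<ge> \<bar>2 * \<kappa> - 1\<bar> * v" using that by (intro mult_left_mono) auto
    moreover have "\<bar>2 * \<kappa> - 1\<bar> * v \<ge> - ((2 * \<kappa> - 1) * v)"
      using that U abs_ge_minus_self[of "(2 * \<kappa> - 1) * v"] by (simp add: abs_mult)
    moreover have "exp v \<le> exp (U + 1)" using that by simp
    ultimately show "weight \<kappa> v \<ge> \<eta>" unfolding \<eta>_def weight_def by (subst exp_le_cancel_iff) linarith
  qed (simp add: \<eta>_def)
  have "imag_flux \<kappa> c u \<ge> (\<eta> / 4) * Im c" if c: "norm c \<le> R" "Im c \<ge> 0" for c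
  proof -
    have hl: "norm (profile \<kappa> c v) \<ge> 1/2" if "v \<ge> U" for v
    proof -
      have "norm (profile \<kappa> c v - 1) \<le> exp (norm c * majorant \<kappa> v) - 1" by (rule profile_minus_1_le)
      also have "\<dots> \<le> exp (R * majorant \<kappa> v) - 1" using c majorant_nonneg[of \<kappa> v] by (simp add: mult_right_mono)
      also have "\<dots> < 1/2" using U0 U that by simp
      finally show ?thesis using norm_triangle_ineq2[of 1 "1 - profile \<kappa> c v"] by (simp add: norm_minus_commute)
    qed
    obtain \<xi> where \<xi>: "U < \<xi>" "\<xi> < U + 1" and
      eq: "imag_flux \<kappa> c (U + 1) - imag_flux \<kappa> c U = (U + 1 - U) * - (Im c * (weight \<kappa> \<xi> * norm (profile \<kappa> c \<xi>) ^ 2))"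
      using MVT2[of U "U + 1" "imag_flux \<kappa> c" "\<lambda>v. - (Im c * (weight \<kappa> v * norm (profile \<kappa> c v) ^ 2))"]
        imag_flux_deriv by auto
    have "norm (profile \<kappa> c \<xi>) ^ 2 \<ge> (1/2) ^ 2" using hl[of \<xi>] \<xi> by (intro power_mono) auto
    then have "weight \<kappa> \<xi> * norm (profile \<kappa> c \<xi>) ^ 2 \<ge> \<eta> * (1/2)^2"
      using \<eta> \<xi> by (intro mult_mono) (auto intro: less_imp_le)
    then have "Im c * (weight \<kappa> \<xi> * norm (profile \<kappa> c \<xi>) ^ 2) \<ge> Im c * (\<eta> * (1/2)^2)"
      using c by (intro mult_left_mono) auto
    then have "imag_flux \<kappa> c U \<ge> (\<eta> / 4) * Im c"
      using eq imag_flux_nonneg[OF c(2), of \<kappa> "U + 1"] by (simp add: power2_eq_square mult_ac)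
    then show ?thesis using imag_flux_antimono[OF c(2) U(2), of \<kappa>] by linarith
  qed
  moreover have "\<eta> / 4 > 0" using \<eta>(1)[of U] by simp
  ultimately show ?thesis by blast
qed

text \<open>
At a zero of \<open>h\<close> the flux vanishes, whereas the lower bound makes it positive in the open upper half-plane;
the lower half-plane follows by conjugation.
\<close>

lemma profile_zero_imp_real:
  assumes "profile \<kappa> c u = 0" shows "Im c = 0"
proof -
  have *: "Im c \<le> 0" if "profile \<kappa> c u = 0" for c :: complex
  proof -
    obtain \<delta> where "\<delta> > 0" "\<And>d. norm d \<le> norm c \<and> Im d \<ge> 0 \<Longrightarrow> imag_flux \<kappa> d u \<ge> \<delta> * Im d"
      using imag_flux_lower_bound[of "norm c" \<kappa> u] by blast
    moreover have "imag_flux \<kappa> c u = 0" using that by (simp add: imag_flux_def)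
    ultimately show ?thesis by (metis linorder_not_less mult_pos_pos nle_le order_less_le_trans order_refl)
  qed
  show ?thesis using *[OF assms] *[of "cnj c"] assms by (simp add: profile_cnj)
qed

lemma complex_deriv_eq_real_deriv:
  assumes F: "(F has_field_derivative D) (at (of_real c))" and f: "(f has_real_derivative d) (at c)"
    and Ff: "\<And>t. F (of_real t) = of_real (f t)"
  shows "D = of_real d"
proof -
  have "((\<lambda>t. F (of_real t)) has_vector_derivative D) (at c)"
    using has_vector_derivative_real_field[OF F] .
  moreover have "((\<lambda>t. F (of_real t)) has_vector_derivative of_real d) (at c)"
    unfolding Ff using f by (intro has_vector_derivative_of_real) (simp add: has_real_derivative_iff_has_vector_derivative)
  ultimately show ?thesis by (rule vector_derivative_unique_at)
qed

text \<open>
Along the vertical line through a real \<open>c\<close> the flux is \<open>0\<close> at \<open>c\<close> itself, at least \<open>\<delta> * t\<close> at height \<open>t\<close>, and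
its derivative at \<open>t = 0\<close> is the left-hand side below. Hence the point \<open>A + i h\<close> rotates clockwise with
positive speed as \<open>c\<close> increases; in particular it is never \<open>0\<close>, and zeros of \<open>h\<close> in \<open>c\<close> are simple.
\<close>

lemma phase_derivative_positive:
  fixes c :: real
  assumes h: "((\<lambda>c. profile \<kappa> c u) has_real_derivative h') (at c)"
    and A: "((\<lambda>c. momentum \<kappa> c u) has_real_derivative A') (at c)"
  shows "A' * profile \<kappa> c u - momentum \<kappa> c u * h' > 0"
proof -
  let ?c = "of_real c :: complex"
  obtain Dh where Dh: "((\<lambda>c. profile \<kappa> c u) has_field_derivative Dh) (at ?c)"
    using profile_param_deriv by blast
  obtain DA where DA: "((\<lambda>c. momentum \<kappa> c u) has_field_derivative DA) (at ?c)"
    using momentum_param_deriv by blast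
  have eh: "Dh = of_real h'" by (rule complex_deriv_eq_real_deriv[OF Dh h profile_of_real])
  have eA: "DA = of_real A'" by (rule complex_deriv_eq_real_deriv[OF DA A momentum_of_real])
  have line: "((\<lambda>t::real. F (?c + \<i> * of_real t)) has_vector_derivative \<i> * D) (at 0)"
    if "(F has_field_derivative D) (at ?c)" for F D
  proof -
    have "((\<lambda>t::real. ?c + \<i> * of_real t) has_vector_derivative \<i> * 1) (at 0)"
      by (rule derivative_eq_intros refl | simp)+
    from field_vector_diff_chain_at[OF this, of F D] that show ?thesis by (simp add: o_def mult.commute)
  qed
  define \<phi> where "\<phi> t = imag_flux \<kappa> (?c + \<i> * of_real t) u" for t
  define d where "d = A' * profile \<kappa> c u - momentum \<kappa> c u * h'"
  have \<phi>: "(\<phi> has_real_derivative d) (at 0)"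
  proof -
    have "((\<lambda>t. Im (momentum \<kappa> (?c + \<i> * of_real t) u * cnj (profile \<kappa> (?c + \<i> * of_real t) u)))
      has_vector_derivative Im (momentum \<kappa> (?c + \<i> * of_real 0) u * cnj (\<i> * Dh)
        + \<i> * DA * cnj (profile \<kappa> (?c + \<i> * of_real 0) u))) (at 0)"
      by (rule bounded_linear.has_vector_derivative[OF bounded_linear_Im
          has_vector_derivative_mult[OF line[OF DA] bounded_linear.has_vector_derivative[OF bounded_linear_cnj line[OF Dh]]]])
    then show ?thesis
      unfolding \<phi>_def imag_flux_def has_real_derivative_iff_has_vector_derivative
      by (simp add: eh eA profile_of_real momentum_of_real d_def)
  qed
  obtain \<delta> where \<delta>: "\<delta> > 0" "\<And>d. norm d \<le> \<bar>c\<bar> + 1 \<and> Im d \<ge> 0 \<Longrightarrow> imag_flux \<kappa> d u \<ge> \<delta> * Im d"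
    using imag_flux_lower_bound[of "\<bar>c\<bar> + 1" \<kappa> u] by blast
  have lb: "\<phi> t \<ge> \<delta> * t" if "0 \<le> t" "t \<le> 1" for t
  proof -
    have "norm (?c + \<i> * of_real t) \<le> \<bar>c\<bar> + 1"
      using norm_triangle_ineq[of ?c "\<i> * of_real t"] that by (simp add: norm_mult)
    then show ?thesis using \<delta>(2)[of "?c + \<i> * of_real t"] that by (simp add: \<phi>_def)
  qed
  have z: "\<phi> 0 = 0" by (simp add: \<phi>_def imag_flux_def profile_of_real momentum_of_real)
  have "d \<ge> \<delta>"
  proof (rule ccontr)
    assume "\<not> d \<ge> \<delta>"
    then have neg: "d - \<delta> < 0" by simp
    have "((\<lambda>t. \<phi> t - \<delta> * t) has_real_derivative d - \<delta>) (at 0)"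
      by (auto intro!: derivative_eq_intros \<phi>)
    from DERIV_neg_dec_right[OF this neg] obtain e where e: "e > 0"
      "\<And>h. h > 0 \<Longrightarrow> h < e \<Longrightarrow> \<phi> (0 + h) - \<delta> * (0 + h) < \<phi> 0 - \<delta> * 0" by blast
    define t where "t = min (e / 2) 1"
    have "0 < t" "t < e" "t \<le> 1" using e(1) by (auto simp: t_def min_def)
    then show False using e(2)[of t] lb[of t] z by auto
  qed
  then show ?thesis using \<delta>(1) by (simp add: d_def)
qed

section \<open>Signs for negative spectral parameter\<close>

text \<open>
For \<open>c \<le> 0\<close> all terms of the series are nonnegative, and the first one is \<open>1\<close>.
\<close>

lemma profile_ge_1:
  fixes c :: real
  assumes "c \<le> 0" shows "profile \<kappa> c u \<ge> 1"
proof -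
  have "(\<Sum>n<1. iterate \<kappa> n u * (- c) ^ n) \<le> (\<Sum>n. iterate \<kappa> n u * (- c) ^ n)"
    using summable_norm_cancel[OF profile_summable[of \<kappa> u c]] assms iterate_nonneg
    by (intro sum_le_suminf) (auto intro!: mult_nonneg_nonneg)
  then show ?thesis by (simp add: profile_def)
qed

lemma momentum_nonpos:
  fixes c :: real
  assumes "c \<le> 0" shows "momentum \<kappa> c u \<le> 0"
  unfolding momentum_def
  using assms flux_nonneg summable_norm_cancel[OF momentum_summable[of \<kappa> u c]]
  by (intro mult_nonpos_nonneg suminf_nonneg) (auto intro!: mult_nonneg_nonneg)

lemma norm_profile_le_profile:
  fixes c :: complex
  assumes "norm c \<le> r"
  shows "norm (profile \<kappa> c u) \<le> profile \<kappa> (- r) u"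
  unfolding profile_def
proof (rule norm_suminf_le)
  show "norm (of_real (iterate \<kappa> n u) * (- c) ^ n) \<le> of_real (iterate \<kappa> n u) * (- (- r)) ^ n" for n
    using iterate_nonneg[of \<kappa> n u] assms
    by (auto simp: norm_mult norm_power intro!: mult_left_mono power_mono)
qed (rule summable_norm_cancel[OF profile_summable])

section \<open>Identification with the Whittaker function\<close>

definition prefactor :: "real \<Rightarrow> real \<Rightarrow> real" where
  "prefactor \<kappa> x = exp (- x / 2) * x powr \<kappa>"

text \<open>
The parameter \<open>c\<close> that belongs to the index \<open>\<mu>\<close>. It depends only on \<open>\<mu>\<^sup>2\<close>, which is why the Whittaker
function is even in \<open>\<mu>\<close>.
\<close>

definition spectral :: "real \<Rightarrow> complex \<Rightarrow> complex" where
  "spectral \<kappa> \<mu> = (of_real \<kappa> - 1/2)\<^sup>2 - \<mu>\<^sup>2"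

definition whittaker_sol :: "real \<Rightarrow> complex \<Rightarrow> real \<Rightarrow> complex" where
  "whittaker_sol \<kappa> \<mu> x = of_real (prefactor \<kappa> x) * profile \<kappa> (spectral \<kappa> \<mu>) (ln x)"

lemma prefactor_pos: "x > 0 \<Longrightarrow> prefactor \<kappa> x > 0"
  by (simp add: prefactor_def)

lemma prefactor_deriv: "x > 0 \<Longrightarrow> (prefactor \<kappa> has_real_derivative prefactor \<kappa> x * (\<kappa> / x - 1/2)) (at x)"
  unfolding prefactor_def by (auto intro!: derivative_eq_intros simp: powr_diff field_simps)

lemma weight_ln: "x > 0 \<Longrightarrow> weight \<kappa> (ln x) = prefactor \<kappa> x ^ 2 / x"
proof -
  assume x: "x > 0"
  have "prefactor \<kappa> x = exp (- x / 2 + \<kappa> * ln x)"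
    using x by (simp add: prefactor_def powr_def exp_add[symmetric])
  then have "prefactor \<kappa> x ^ 2 / x = exp (2 * (- x / 2 + \<kappa> * ln x) - ln x)"
    using x by (simp only: exp_diff exp_double exp_ln)
  also have "\<dots> = weight \<kappa> (ln x)" using x by (simp add: weight_def algebra_simps)
  finally show ?thesis by simp
qed

text \<open>
In terms of \<open>x\<close> the weight is \<open>prefactor\<^sup>2 / x\<close>, so with \<open>v = prefactor\<close>, \<open>k(x) = h(ln x)\<close> and \<open>A(x)\<close> the
momentum at \<open>ln x\<close> the system reads \<open>k' = A / v\<^sup>2\<close>, \<open>A' = - c v\<^sup>2 k / x\<^sup>2\<close>. In \<open>(v k)''\<close> the terms with \<open>A\<close>
cancel.
\<close>

lemma whittaker_sol_eq: "whittaker_eq (of_real \<kappa>) \<mu> (whittaker_sol \<kappa> \<mu>)"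
proof -
  define c where "c = spectral \<kappa> \<mu>"
  define v where "v = prefactor \<kappa>"
  define k where "k x = profile \<kappa> c (ln x)" for x
  define A where "A x = momentum \<kappa> c (ln x)" for x
  let ?r = "\<lambda>x. \<kappa> / x - 1/2"
  have vpos: "v x > 0" if "x > 0" for x using prefactor_pos[OF that] by (simp add: v_def)
  have vd0: "(v has_real_derivative v x * ?r x) (at x)" if "x > 0" for x
    using prefactor_deriv[OF that] by (simp add: v_def)
  have vd: "((\<lambda>x. of_real (v x) :: complex) has_vector_derivative of_real (v x * ?r x)) (at x)" if "x > 0" for x
    using vd0[OF that] by (intro has_vector_derivative_of_real) (simp add: has_real_derivative_iff_has_vector_derivative)
  have vr: "((\<lambda>x. of_real (v x * ?r x) :: complex) has_vector_derivative of_real (v x * (?r x ^ 2 - \<kappa> / x ^ 2))) (at x)"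
    if "x > 0" for x
  proof -
    have "((\<lambda>x. v x * ?r x) has_real_derivative v x * (?r x ^ 2 - \<kappa> / x ^ 2)) (at x)"
      using that by (auto intro!: derivative_eq_intros vd0 simp: power2_eq_square field_simps)
    then show ?thesis
      by (intro has_vector_derivative_of_real) (simp add: has_real_derivative_iff_has_vector_derivative)
  qed
  have vi: "((\<lambda>x. of_real (1 / v x) :: complex) has_vector_derivative of_real (- ?r x / v x)) (at x)" if "x > 0" for x
  proof -
    have "((\<lambda>x. 1 / v x) has_real_derivative - ?r x / v x) (at x)"
      using that vpos[OF that] by (auto intro!: derivative_eq_intros vd0 simp: power2_eq_square field_simps)
    then show ?thesis
      by (intro has_vector_derivative_of_real) (simp add: has_real_derivative_iff_has_vector_derivative)
  qed
  have lnd: "(ln has_vector_derivative 1 / x) (at x)" if "x > 0" for x :: real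
    using that by (auto intro!: derivative_eq_intros simp: has_real_derivative_iff_has_vector_derivative[symmetric])
  have kd: "(k has_vector_derivative A x * of_real (1 / v x ^ 2)) (at x)" if x: "x > 0" for x
  proof -
    have "(profile \<kappa> c \<circ> ln has_vector_derivative (1 / x) *\<^sub>R (momentum \<kappa> c (ln x) / of_real (weight \<kappa> (ln x)))) (at x)"
      by (rule vector_diff_chain_at[OF lnd[OF x] profile_deriv])
    also have "(1 / x) *\<^sub>R (momentum \<kappa> c (ln x) / of_real (weight \<kappa> (ln x))) = A x * of_real (1 / v x ^ 2)"
      using x vpos[OF x] by (simp add: weight_ln A_def v_def[symmetric] scaleR_conv_of_real field_simps)
    finally show ?thesis by (simp add: o_def k_def[abs_def])
  qed
  have Ad: "(A has_vector_derivative - c * of_real (v x ^ 2 / x ^ 2) * k x) (at x)" if x: "x > 0" for x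
  proof -
    have "(momentum \<kappa> c \<circ> ln has_vector_derivative (1 / x) *\<^sub>R (- c * of_real (weight \<kappa> (ln x)) * profile \<kappa> c (ln x))) (at x)"
      by (rule vector_diff_chain_at[OF lnd[OF x] momentum_deriv])
    also have "(1 / x) *\<^sub>R (- c * of_real (weight \<kappa> (ln x)) * profile \<kappa> c (ln x)) = - c * of_real (v x ^ 2 / x ^ 2) * k x"
      using x by (simp add: weight_ln k_def v_def[symmetric] scaleR_conv_of_real power2_eq_square field_simps)
    finally show ?thesis by (simp add: o_def A_def[abs_def])
  qed
  define f' where "f' x = of_real (v x * ?r x) * k x + A x * of_real (1 / v x)" for x
  define f'' where "f'' x = (of_real (v x * ?r x) * (A x * of_real (1 / v x ^ 2)) + of_real (v x * (?r x ^ 2 - \<kappa> / x ^ 2)) * k x)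
     + (A x * of_real (- ?r x / v x) + (- c * of_real (v x ^ 2 / x ^ 2) * k x) * of_real (1 / v x))" for x
  have f: "whittaker_sol \<kappa> \<mu> = (\<lambda>x. of_real (v x) * k x)"
    by (simp add: whittaker_sol_def[abs_def] v_def k_def c_def)
  show ?thesis
    unfolding whittaker_eq_def f
  proof (rule exI[of _ f'], rule exI[of _ f''], intro allI impI conjI)
    fix x :: real assume x: "x > 0"
    have "of_real (v x) * (A x * of_real (1 / v x ^ 2)) = A x * of_real (1 / v x)"
      using vpos[OF x] by (simp add: power2_eq_square)
    then show "((\<lambda>x. of_real (v x) * k x) has_vector_derivative f' x) (at x)"
      using has_vector_derivative_mult[OF vd[OF x] kd[OF x]] unfolding f'_def by (simp only: add.commute)
    show "(f' has_vector_derivative f'' x) (at x)"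
      unfolding f'_def[abs_def] f''_def
      by (intro has_vector_derivative_add has_vector_derivative_mult vr vi kd Ad x)
    have v0: "of_real (v x) \<noteq> (0::complex)" and x0: "of_real x \<noteq> (0::complex)" using vpos[OF x] x by auto
    define V X K where "V = (of_real (v x) :: complex)" and "X = (of_real x :: complex)" and "K = (of_real \<kappa> :: complex)"
    have VX: "V \<noteq> 0" "X \<noteq> 0" using v0 x0 by (auto simp: V_def X_def)
    show "f'' x + (- 1 / 4 + of_real \<kappa> / of_real x + (1 / 4 - \<mu>\<^sup>2) / (of_real x)\<^sup>2) * (of_real (v x) * k x) = 0"
      unfolding f''_def c_def spectral_def of_real_mult of_real_diff of_real_divide of_real_power of_real_minus
        of_real_1 of_real_numeral V_def[symmetric] X_def[symmetric] K_def[symmetric]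
      using VX by (simp add: field_simps power2_eq_square)
  qed
qed

lemma whittaker_sol_asymp: "whittaker_asymp (of_real \<kappa>) (whittaker_sol \<kappa> \<mu>)"
  unfolding whittaker_asymp_def
proof (intro exI conjI allI impI)
  define c where "c = spectral \<kappa> \<mu>"
  define K where "K = norm c * (2 + majorant_coeff \<kappa>)"
  let ?\<epsilon> = "\<lambda>x. profile \<kappa> c (ln x) - 1"
  have K: "K \<ge> 0" using majorant_coeff_nonneg[of \<kappa>] by (simp add: K_def)
  have "norm (?\<epsilon> x) \<le> K * exp K * norm (1 / of_real x :: complex)" if x: "x \<ge> 1" for x
  proof -
    define y where "y = norm c * majorant \<kappa> (ln x)"
    have "majorant \<kappa> (ln x) \<le> (2 + majorant_coeff \<kappa>) * exp (- ln x)" using majorant_le[of "ln x" \<kappa>] x by simp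
    then have "y \<le> norm c * ((2 + majorant_coeff \<kappa>) * exp (- ln x))" unfolding y_def by (rule mult_left_mono) simp
    then have y: "y \<le> K / x" using x by (simp add: K_def exp_minus divide_inverse mult_ac)
    have "K / x \<le> K" using x K by (simp add: divide_le_eq mult_left_mono[of 1 x K, simplified])
    have y0: "y \<ge> 0" using majorant_nonneg by (simp add: y_def)
    have "norm (?\<epsilon> x) \<le> exp y - 1" using profile_minus_1_le[of \<kappa> c "ln x"] by (simp add: y_def)
    also have "\<dots> \<le> y * exp y"
      using mult_left_mono[OF exp_ge_add_one_self[of "- y"], of "exp y"] by (simp add: exp_minus algebra_simps)
    also have "\<dots> \<le> (K / x) * exp K"
      using y y0 \<open>K / x \<le> K\<close> by (intro mult_mono) auto
    finally show ?thesis using x by (simp add: norm_divide mult_ac)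
  qed
  then show "?\<epsilon> \<in> O[at_top](\<lambda>x. 1 / of_real x)"
    by (intro bigoI[of _ "K * exp K"]) (auto simp: eventually_at_top_linorder)
  show "whittaker_sol \<kappa> \<mu> x = of_real (exp (- x / 2)) * (of_real x powr of_real \<kappa>) * (1 + ?\<epsilon> x)" if "x > 0" for x
    using that by (simp add: whittaker_sol_def prefactor_def c_def powr_of_real)
qed

text \<open>
Uniqueness for the initial value problem in Gronwall's form: \<open>E = |f|\<^sup>2 + |f'|\<^sup>2\<close> satisfies \<open>E' \<ge> - K E\<close> on
\<open>[a, b]\<close>.
\<close>

lemma ode_zero_backwards:
  fixes f f' f'' Q :: "real \<Rightarrow> complex"
  assumes f: "\<And>x. x > 0 \<Longrightarrow> (f has_vector_derivative f' x) (at x)"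
    and f': "\<And>x. x > 0 \<Longrightarrow> (f' has_vector_derivative f'' x) (at x)"
    and eq: "\<And>x. x > 0 \<Longrightarrow> f'' x = - Q x * f x"
    and Q: "continuous_on {0<..} Q"
    and b: "f b = 0" "f' b = 0" "0 < a" "a \<le> b"
  shows "f a = 0"
proof -
  have "compact (Q ` {a..b})"
    by (rule compact_continuous_image[OF continuous_on_subset[OF Q]]) (use b in auto)
  then obtain M where M: "\<And>x. a \<le> x \<Longrightarrow> x \<le> b \<Longrightarrow> norm (Q x) \<le> M"
    using compact_imp_bounded bounded_iff by (metis atLeastAtMost_iff imageI)
  define E where "E x = f x \<bullet> f x + f' x \<bullet> f' x" for x
  let ?K = "M + 1"
  have E: "(E has_real_derivative 2 * (f x \<bullet> f' x) + 2 * (f' x \<bullet> f'' x)) (at x)" if "x > 0" for x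
  proof -
    have ip: "((\<lambda>x. g x \<bullet> g x) has_real_derivative 2 * (g x \<bullet> D)) (at x)" if "(g has_vector_derivative D) (at x)" for g :: "real \<Rightarrow> complex" and D
      using bounded_bilinear.has_vector_derivative[OF bounded_bilinear_inner that that]
      by (simp add: has_real_derivative_iff_has_vector_derivative inner_commute)
    show ?thesis unfolding E_def[abs_def] by (intro DERIV_add ip f f' that)
  qed
  have bd: "2 * (f x \<bullet> f' x) + 2 * (f' x \<bullet> f'' x) \<ge> - ?K * E x" if "a \<le> x" "x \<le> b" for x
  proof -
    have x: "x > 0" using that b by simp
    have M0: "M \<ge> 0" using M[OF that] norm_ge_zero order_trans by blast
    have "\<bar>f x \<bullet> f' x\<bar> \<le> norm (f x) * norm (f' x)" by (rule Cauchy_Schwarz_ineq2)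
    moreover have "\<bar>f' x \<bullet> f'' x\<bar> \<le> norm (f' x) * norm (f'' x)" by (rule Cauchy_Schwarz_ineq2)
    moreover have "norm (f' x) * norm (f'' x) \<le> norm (f' x) * (M * norm (f x))"
      unfolding eq[OF x] using M[OF that] by (intro mult_left_mono) (auto simp: norm_mult intro: mult_right_mono)
    ultimately have "2 * (f x \<bullet> f' x) + 2 * (f' x \<bullet> f'' x) \<ge> - (?K * (2 * (norm (f x) * norm (f' x))))"
      by (simp add: algebra_simps abs_le_iff)
    moreover have "2 * (norm (f x) * norm (f' x)) \<le> E x"
      using sum_squares_bound[of "norm (f x)" "norm (f' x)"] 
      by (simp add: E_def power2_norm_eq_inner[symmetric] mult_ac)
    moreover have "?K * (2 * (norm (f x) * norm (f' x))) \<le> ?K * E x"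
      using calculation(2) M0 by (intro mult_left_mono) auto
    ultimately show ?thesis by linarith
  qed
  have "E a * exp (?K * a) \<le> E b * exp (?K * b)"
  proof (rule DERIV_nonneg_imp_nondecreasing[OF b(4)])
    fix x assume x: "a \<le> x" "x \<le> b"
    let ?d = "2 * (f x \<bullet> f' x) + 2 * (f' x \<bullet> f'' x)"
    have "((\<lambda>x. E x * exp (?K * x)) has_real_derivative (?d + ?K * E x) * exp (?K * x)) (at x)"
      using x b by (auto intro!: derivative_eq_intros E simp: algebra_simps)
    moreover have "?d + ?K * E x \<ge> 0" using bd[OF x] by (simp add: algebra_simps)
    then have "(?d + ?K * E x) * exp (?K * x) \<ge> 0" by (rule mult_nonneg_nonneg) simp
    ultimately show "\<exists>y. ((\<lambda>x. E x * exp (?K * x)) has_real_derivative y) (at x) \<and> 0 \<le> y" by blast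
  qed
  also have "E b = 0" using b by (simp add: E_def)
  finally have "E a \<le> 0" by (simp add: mult_le_0_iff)
  then have "f a \<bullet> f a \<le> 0" using inner_ge_zero[of "f' a"] unfolding E_def by linarith
  then show ?thesis by (metis inner_eq_zero_iff inner_ge_zero order_antisym)
qed

text \<open>
The Wronskian \<open>w\<close> of two solutions \<open>f\<close>, \<open>W\<close> with the same asymptotics is constant, and \<open>(f / W)' = w / W\<^sup>2\<close>.
As \<open>W\<close> decays, \<open>w \<noteq> 0\<close> would let \<open>f / W\<close> grow without bound, although it tends to \<open>1\<close>. So \<open>f = W\<close> for large
\<open>x\<close>, and this propagates backwards by uniqueness for the initial value problem.
\<close>

lemma whittaker_unique:
  assumes eq: "whittaker_eq (of_real \<kappa>) \<mu> f" and as: "whittaker_asymp (of_real \<kappa>) f" and "x > 0"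
  shows "f x = whittaker_sol \<kappa> \<mu> x"
proof -
  define W where "W = whittaker_sol \<kappa> \<mu>"
  define Q where "Q x = - 1/4 + of_real \<kappa> / of_real x + (1/4 - \<mu>^2) / of_real x ^ 2" for x :: real
  obtain f' f'' where f: "\<And>x. x > 0 \<Longrightarrow> (f has_vector_derivative f' x) (at x)"
    "\<And>x. x > 0 \<Longrightarrow> (f' has_vector_derivative f'' x) (at x)"
    "\<And>x. x > 0 \<Longrightarrow> f'' x + Q x * f x = 0"
    using eq unfolding whittaker_eq_def Q_def by metis
  obtain W' W'' where W: "\<And>x. x > 0 \<Longrightarrow> (W has_vector_derivative W' x) (at x)"
    "\<And>x. x > 0 \<Longrightarrow> (W' has_vector_derivative W'' x) (at x)"
    "\<And>x. x > 0 \<Longrightarrow> W'' x + Q x * W x = 0"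
    using whittaker_sol_eq[of \<kappa> \<mu>] unfolding whittaker_eq_def Q_def W_def[symmetric] by metis
  have f3: "f'' x = - Q x * f x" and W3: "W'' x = - Q x * W x" if "x > 0" for x
    using f(3)[OF that] W(3)[OF that] by (simp_all add: add_eq_0_iff)
  have "((\<lambda>x. f' x * W x - f x * W' x) has_vector_derivative 0) (at x within {0<..})" if "x \<in> {0<..}" for x
  proof -
    have x: "x > 0" using that by simp
    have "((\<lambda>x. f' x * W x - f x * W' x) has_vector_derivative
       (f' x * W' x + f'' x * W x) - (f x * W'' x + f' x * W' x)) (at x)"
      by (intro has_vector_derivative_diff has_vector_derivative_mult f W x)
    then show ?thesis by (simp add: f3[OF x] W3[OF x] has_vector_derivative_at_within)
  qed
  then obtain w where w: "\<And>x. x > 0 \<Longrightarrow> f' x * W x - f x * W' x = w"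
    using has_vector_derivative_zero_constant[of "{0<..}" "\<lambda>x. f' x * W x - f x * W' x"] by (auto simp: convex_real_interval)
  define v where "v = prefactor \<kappa>"
  define k where "k x = profile \<kappa> (spectral \<kappa> \<mu>) (ln x)" for x
  have Wvk: "W x = of_real (v x) * k x" for x by (simp add: W_def whittaker_sol_def v_def k_def)
  have vpos: "v x > 0" if "x > 0" for x using prefactor_pos[OF that] by (simp add: v_def)
  have k1: "(k \<longlongrightarrow> 1) at_top"
    unfolding k_def[abs_def] by (rule filterlim_compose[OF profile_tendsto ln_at_top])
  have v0: "((\<lambda>x. v x ^ 2) \<longlongrightarrow> 0) at_top" unfolding v_def prefactor_def by real_asymp
  obtain \<epsilon> :: "real \<Rightarrow> complex" where \<epsilon>: "\<epsilon> \<in> O[at_top](\<lambda>x. 1 / of_real x)"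
    "\<And>x. x > 0 \<Longrightarrow> f x = of_real (exp (- x / 2)) * (of_real x powr of_real \<kappa>) * (1 + \<epsilon> x)"
    using as unfolding whittaker_asymp_def by blast
  have e0: "(\<epsilon> \<longlongrightarrow> 0) at_top"
  proof -
    have "((\<lambda>x::real. 1 / of_real x :: complex) \<longlongrightarrow> 0) at_top"
      using tendsto_of_real[of "\<lambda>x::real. 1 / x" 0 at_top, where 'a = complex] tendsto_divide_0[OF tendsto_const filterlim_at_top_imp_at_infinity[OF filterlim_ident], of 1]
      by simp
    note lim = this
    from \<epsilon>(1) obtain C where "\<forall>\<^sub>F x in at_top. norm (\<epsilon> x) \<le> C * norm (1 / of_real x :: complex)"
      by (auto elim!: landau_o.bigE)
    then show ?thesis by (intro tendsto_0_le[OF lim, of _ C]) (simp add: mult.commute)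
  qed
  define r where "r x = f x / W x" for x
  have ev: "\<forall>\<^sub>F x in at_top. x > 0 \<and> k x \<noteq> 0 \<and> Re (1 / (k x)\<^sup>2) > 1/2 \<and> v x ^ 2 < 1/2"
  proof -
    have "((\<lambda>x. Re (1 / (k x)\<^sup>2)) \<longlongrightarrow> Re (1 / 1\<^sup>2)) at_top"
      by (intro tendsto_intros k1) auto
    from order_tendstoD(1)[OF this, of "1/2"] have "\<forall>\<^sub>F x in at_top. Re (1 / (k x)\<^sup>2) > 1/2" by simp
    moreover have "\<forall>\<^sub>F x in at_top. k x \<noteq> 0" using k1 by (rule tendsto_imp_eventually_ne) simp
    moreover have "\<forall>\<^sub>F x in at_top. v x ^ 2 < 1/2" using order_tendstoD(2)[OF v0, of "1/2"] by simp
    ultimately show ?thesis using eventually_gt_at_top[of 0] by eventually_elim auto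
  qed
  then obtain X where X: "\<And>x. x \<ge> X \<Longrightarrow> x > 0 \<and> k x \<noteq> 0 \<and> Re (1 / (k x)\<^sup>2) > 1/2 \<and> v x ^ 2 < 1/2"
    unfolding eventually_at_top_linorder by blast
  have r1: "(r \<longlongrightarrow> 1) at_top"
  proof -
    have "((\<lambda>x. (1 + \<epsilon> x) / k x) \<longlongrightarrow> (1 + 0) / 1) at_top"
      by (intro tendsto_intros e0 k1) auto
    moreover have "\<forall>\<^sub>F x in at_top. (1 + \<epsilon> x) / k x = r x"
      using ev
    proof eventually_elim
      case (elim x)
      have "f x = of_real (v x) * (1 + \<epsilon> x)"
        using \<epsilon>(2)[of x] elim by (simp add: v_def prefactor_def powr_of_real)
      then show ?case using vpos[of x] elim by (simp add: r_def Wvk)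
    qed
    ultimately show ?thesis by (simp add: tendsto_cong)
  qed
  have rd: "(r has_vector_derivative w * (of_real (1 / v x ^ 2) * (1 / (k x)\<^sup>2))) (at x)" if "x \<ge> X" for x
  proof -
    have x: "x > 0" "k x \<noteq> 0" using X[OF that] by auto
    have Wx: "W x \<noteq> 0" using vpos[OF x(1)] x by (simp add: Wvk)
    have inv: "((\<lambda>x. inverse (W x)) has_vector_derivative - (inverse (W x) * W' x * inverse (W x))) (at x)"
      using field_vector_diff_chain_at[OF W(1)[OF x(1)] DERIV_inverse[OF Wx]]
      by (simp add: o_def mult_ac)
    have "(r has_vector_derivative f x * (- (inverse (W x) * W' x * inverse (W x))) + f' x * inverse (W x)) (at x)"
      unfolding r_def[abs_def] divide_inverse by (intro has_vector_derivative_mult f x inv)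
    also have "f x * (- (inverse (W x) * W' x * inverse (W x))) + f' x * inverse (W x) = w * inverse (W x ^ 2)"
      unfolding w[OF x(1), symmetric] using Wx by (simp add: field_simps power2_eq_square)
    also have "inverse (W x ^ 2) = of_real (1 / v x ^ 2) * (1 / (k x)\<^sup>2)"
      by (simp add: Wvk power_mult_distrib divide_inverse)
    finally show ?thesis .
  qed
  have w0: "w = 0"
  proof (rule ccontr)
    assume w: "w \<noteq> 0"
    \<comment> \<open>Dividing by \<open>w\<close> turns the derivative into \<open>1 / W\<^sup>2\<close>, whose real part is eventually at least \<open>1\<close>.\<close>
    define \<psi> where "\<psi> x = Re (r x / w)" for x
    have \<psi>d: "(\<psi> has_real_derivative (1 / v x ^ 2) * Re (1 / (k x)\<^sup>2)) (at x)" if "x \<ge> X" for x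
    proof -
      have "(\<psi> has_vector_derivative Re (w * (of_real (1 / v x ^ 2) * (1 / (k x)\<^sup>2)) / w)) (at x)"
        unfolding \<psi>_def divide_inverse[of _ w]
        by (rule bounded_linear.has_vector_derivative[OF bounded_linear_Re has_vector_derivative_mult_left[OF rd[OF that]]])
      moreover have "w * (of_real (1 / v x ^ 2) * (1 / (k x)\<^sup>2)) / w = of_real (1 / v x ^ 2) * (1 / (k x)\<^sup>2)"
        using w by simp
      ultimately show ?thesis
        unfolding has_real_derivative_iff_has_vector_derivative by (simp only: Re_complex_of_real times_complex.sel Im_complex_of_real mult_zero_left diff_zero)
    qed
    have inc: "\<psi> (x + 1) - \<psi> x \<ge> 1" if "x \<ge> X" for x
    proof -
      have "\<exists>z>x. z < x + 1 \<and> \<psi> (x + 1) - \<psi> x = (x + 1 - x) * ((1 / v z ^ 2) * Re (1 / (k z)\<^sup>2))"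
        by (rule MVT2) (use that in \<open>auto intro!: \<psi>d simp del: times_divide_eq_left\<close>)
      then obtain \<xi> where \<xi>: "x < \<xi>" "\<psi> (x + 1) - \<psi> x = (x + 1 - x) * ((1 / v \<xi> ^ 2) * Re (1 / (k \<xi>)\<^sup>2))"
        by blast
      have "1 / v \<xi> ^ 2 \<ge> 2" using X[of \<xi>] that \<xi> vpos[of \<xi>] by (simp add: divide_simps)
      then have "(1 / v \<xi> ^ 2) * Re (1 / (k \<xi>)\<^sup>2) \<ge> 2 * (1/2)"
        using X[of \<xi>] that \<xi> by (intro mult_mono) auto
      then show ?thesis using \<xi> by simp
    qed
    have lim: "(\<psi> \<longlongrightarrow> Re (1 / w)) at_top" unfolding \<psi>_def by (intro tendsto_intros r1 w)
    then have "((\<lambda>x. \<psi> (x + 1)) \<longlongrightarrow> Re (1 / w)) at_top"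
      by (rule filterlim_compose) real_asymp
    from tendsto_diff[OF this lim] have "((\<lambda>x. \<psi> (x + 1) - \<psi> x) \<longlongrightarrow> 0) at_top" by simp
    then have "\<forall>\<^sub>F x in at_top. \<psi> (x + 1) - \<psi> x < 1" by (rule order_tendstoD) simp
    then obtain Y where "\<And>x. x \<ge> Y \<Longrightarrow> \<psi> (x + 1) - \<psi> x < 1" unfolding eventually_at_top_linorder by blast
    from this[of "max X Y"] inc[of "max X Y"] show False by simp
  qed
  have "(r has_vector_derivative 0) (at x within {X..})" if "x \<in> {X..}" for x
    using rd[of x] that w0 by (simp add: has_vector_derivative_at_within)
  then obtain d where d: "\<And>x. x \<ge> X \<Longrightarrow> r x = d"
    using has_vector_derivative_zero_constant[of "{X..}" r] by (auto simp: convex_real_interval)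
  have "(r \<longlongrightarrow> d) at_top" by (rule tendsto_eventually) (use d in \<open>auto simp: eventually_at_top_linorder\<close>)
  then have "d = 1" by (rule tendsto_unique[OF trivial_limit_at_top_linorder _ r1])
  have fW: "f y = W y" if "y \<ge> X" for y
    using d[OF that] \<open>d = 1\<close> X[OF that] vpos[of y] by (simp add: r_def Wvk)
  define b where "b = max x X + 1"
  have b: "b > X" "b > 0" "x \<le> b" using \<open>x > 0\<close> by (auto simp: b_def)
  have "((\<lambda>x. f x - W x) has_vector_derivative 0) (at b)"
    by (rule has_vector_derivative_transform_within_open[OF has_vector_derivative_const, of "{X<..}"]) (use b fW in auto)
  moreover have diff: "((\<lambda>x. f x - W x) has_vector_derivative f' y - W' y) (at y)" if "y > 0" for y
    by (intro has_vector_derivative_diff f W that)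
  ultimately have b': "f' b - W' b = 0" using vector_derivative_unique_at b(2) by blast
  have "f x - W x = 0"
  proof (rule ode_zero_backwards[where b = b and a = x and f' = "\<lambda>x. f' x - W' x" and f'' = "\<lambda>x. f'' x - W'' x" and Q = Q])
    show "((\<lambda>x. f x - W x) has_vector_derivative f' y - W' y) (at y)" if "y > 0" for y
      using diff that .
    show "((\<lambda>x. f' x - W' x) has_vector_derivative f'' y - W'' y) (at y)" if "y > 0" for y
      by (intro has_vector_derivative_diff f W that)
    show "f'' y - W'' y = - Q y * (f y - W y)" if "y > 0" for y
      using f3[OF that] W3[OF that] by (simp add: algebra_simps)
    show "continuous_on {0<..} Q" unfolding Q_def by (intro continuous_intros) auto
  qed (use b b' fW \<open>x > 0\<close> in auto)
  then show ?thesis by (simp add: W_def)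
qed

theorem whittaker_W_eq:
  assumes "x > 0" shows "whittaker_W (of_real \<kappa>) \<mu> x = whittaker_sol \<kappa> \<mu> x"
  unfolding whittaker_W_def
proof (rule the_equality)
  show "\<exists>f. whittaker_eq (of_real \<kappa>) \<mu> f \<and> whittaker_asymp (of_real \<kappa>) f \<and> whittaker_sol \<kappa> \<mu> x = f x"
    using whittaker_sol_eq whittaker_sol_asymp by blast
qed (use whittaker_unique[OF _ _ assms] in auto)

section \<open>Growth in the spectral parameter\<close>

text \<open>
Minus the derivative of \<open>h\<close> at \<open>c = - m\<^sup>2\<close>; for such \<open>c\<close> the function \<open>h\<close> is positive and decreasing in \<open>u\<close>.
\<close>

definition decay :: "real \<Rightarrow> real \<Rightarrow> real \<Rightarrow> real" where
  "decay \<kappa> m u = - momentum \<kappa> (- m\<^sup>2) u / weight \<kappa> u"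

lemma decay_deriv:
  "(decay \<kappa> m has_real_derivative - m\<^sup>2 * profile \<kappa> (- m\<^sup>2) u + decay \<kappa> m u * (exp u - 2 * \<kappa> + 1)) (at u)"
proof -
  have w: "weight \<kappa> u \<noteq> 0" using weight_pos[of \<kappa> u] by linarith
  show ?thesis
    unfolding decay_def[abs_def]
    by (rule DERIV_cong[OF DERIV_divide[OF DERIV_minus[OF momentum_real_deriv] weight_deriv w]])
       (use w in \<open>simp add: field_simps\<close>)
qed

lemma profile_decay_deriv:
  "(profile \<kappa> (- m\<^sup>2) has_real_derivative - decay \<kappa> m u) (at u)"
  using profile_real_deriv[of \<kappa> "- m\<^sup>2" u] by (simp add: decay_def)

lemma decay_nonneg: "decay \<kappa> m u \<ge> 0"
  using momentum_nonpos[of "- m\<^sup>2" \<kappa> u] less_imp_le[OF weight_pos[of \<kappa> u]]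
  by (simp add: decay_def divide_nonpos_nonneg)

text \<open>
Going left from \<open>v = ln m\<close>, where the majorant still gives a bound \<open>exp (O(m))\<close>, the quantity \<open>m h + decay\<close>
grows at rate at most \<open>m + k\<close>. As the distance is \<open>ln m - u\<close>, this yields \<open>exp (O(m ln m))\<close>. The series bound
at \<open>u\<close> itself would only give \<open>exp (O(m\<^sup>2))\<close>, that is order two.
\<close>

lemma profile_growth_upper:
  fixes \<kappa> m u :: real
  assumes m: "m \<ge> 1" "u \<le> ln m"
  defines "K \<equiv> 2 + majorant_coeff \<kappa>" and "k \<equiv> \<bar>2 * \<kappa> - 1\<bar>"
  shows "profile \<kappa> (- m\<^sup>2) u \<le> (1 + K) * exp (m * K + (m + k) * (ln m - u))"
proof -
  let ?h = "profile \<kappa> (- m\<^sup>2)" and ?D = "decay \<kappa> m"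
  define Y where "Y v = m * ?h v + ?D v" for v
  have h0: "?h v \<ge> 0" for v using profile_ge_1[of "- m\<^sup>2" \<kappa> v] by simp
  have "Y u * exp ((m + k) * u) \<le> Y (ln m) * exp ((m + k) * ln m)"
  proof (rule DERIV_nonneg_imp_nondecreasing[OF m(2)])
    fix x
    have "((\<lambda>x. Y x * exp ((m + k) * x)) has_real_derivative
       (m * (- ?D x) + (- m\<^sup>2 * ?h x + ?D x * (exp x - 2 * \<kappa> + 1))) * exp ((m + k) * x)
        + exp ((m + k) * x) * (m + k) * Y x) (at x)"
      unfolding Y_def
      by (rule DERIV_mult DERIV_add DERIV_cmult profile_decay_deriv decay_deriv derivative_eq_intros refl | simp)+
    also have "(m * (- ?D x) + (- m\<^sup>2 * ?h x + ?D x * (exp x - 2 * \<kappa> + 1))) * exp ((m + k) * x)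
        + exp ((m + k) * x) * (m + k) * Y x
      = (?D x * (exp x - 2 * \<kappa> + 1 + k) + k * m * ?h x) * exp ((m + k) * x)"
      by (simp add: Y_def algebra_simps power2_eq_square)
    finally have "((\<lambda>x. Y x * exp ((m + k) * x)) has_real_derivative
       (?D x * (exp x - 2 * \<kappa> + 1 + k) + k * m * ?h x) * exp ((m + k) * x)) (at x)" .
    note dY = this
    have "exp x - 2 * \<kappa> + 1 + k \<ge> 0" using exp_gt_zero[of x] unfolding k_def by linarith
    then have "?D x * (exp x - 2 * \<kappa> + 1 + k) \<ge> 0" by (rule mult_nonneg_nonneg[OF decay_nonneg])
    moreover have "k * m * ?h x \<ge> 0" using h0[of x] m(1) by (simp add: k_def)
    ultimately have "(?D x * (exp x - 2 * \<kappa> + 1 + k) + k * m * ?h x) * exp ((m + k) * x) \<ge> 0" by simp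
    then show "\<exists>y. ((\<lambda>x. Y x * exp ((m + k) * x)) has_real_derivative y) (at x) \<and> 0 \<le> y"
      using dY by blast
  qed
  then have "Y u \<le> Y (ln m) * exp ((m + k) * ln m) / exp ((m + k) * u)" by (simp add: le_divide_eq)
  also have "\<dots> = Y (ln m) * exp ((m + k) * (ln m - u))" by (simp add: exp_diff right_diff_distrib)
  finally have 1: "Y u \<le> Y (ln m) * exp ((m + k) * (ln m - u))" .
  have K: "K \<ge> 0" using majorant_coeff_nonneg[of \<kappa>] by (simp add: K_def)
  have e: "exp (- ln m) = 1 / m" using m by (simp add: exp_minus divide_inverse)
  have M: "m\<^sup>2 * majorant \<kappa> (ln m) \<le> m * K"
  proof -
    have "m\<^sup>2 * majorant \<kappa> (ln m) \<le> m\<^sup>2 * (K * (1 / m))"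
      using majorant_le[of "ln m" \<kappa>] m unfolding e K_def by (intro mult_left_mono) auto
    then show ?thesis using m by (simp add: power2_eq_square)
  qed
  have hU: "?h (ln m) \<le> exp (m * K)"
  proof -
    have "?h (ln m) \<le> exp (m\<^sup>2 * majorant \<kappa> (ln m))" using profile_le[of \<kappa> "- m\<^sup>2" "ln m"] by simp
    also have "\<dots> \<le> exp (m * K)" using M by simp
    finally show ?thesis .
  qed
  have DU: "?D (ln m) \<le> m * K * exp (m * K)"
  proof -
    have "?D (ln m) \<le> m\<^sup>2 * (slope \<kappa> (ln m) * exp (m\<^sup>2 * majorant \<kappa> (ln m)))"
    proof -
      have "- momentum \<kappa> (- m\<^sup>2) (ln m) \<le> m\<^sup>2 * (weight \<kappa> (ln m) * slope \<kappa> (ln m) * exp (m\<^sup>2 * majorant \<kappa> (ln m)))"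
        using momentum_le[of \<kappa> "- m\<^sup>2" "ln m"] by simp
      then show ?thesis
        unfolding decay_def by (subst pos_divide_le_eq[OF weight_pos]) (simp only: mult_ac)
    qed
    also have "\<dots> \<le> m\<^sup>2 * (K * (1 / m) * exp (m * K))"
      using slope_le[of "ln m" \<kappa>] slope_nonneg[of \<kappa> "ln m"] m M K unfolding e K_def[symmetric]
      by (intro mult_left_mono mult_mono) auto
    also have "\<dots> = m * K * exp (m * K)" using m by (simp add: power2_eq_square)
    finally show ?thesis .
  qed
  have "Y (ln m) \<le> m * exp (m * K) + m * K * exp (m * K)"
    unfolding Y_def using hU DU m by (intro add_mono mult_left_mono) auto
  also have "\<dots> = m * ((1 + K) * exp (m * K))" by (simp add: algebra_simps)
  finally have 2: "Y (ln m) \<le> m * ((1 + K) * exp (m * K))" .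
  have "m * ?h u \<le> Y u" using decay_nonneg by (simp add: Y_def)
  also have "\<dots> \<le> m * ((1 + K) * exp (m * K)) * exp ((m + k) * (ln m - u))"
    using 1 2 by (auto intro: order_trans mult_right_mono)
  also have "\<dots> = m * ((1 + K) * exp (m * K + (m + k) * (ln m - u)))" by (simp add: exp_add mult_ac)
  finally show ?thesis using m by simp
qed

text \<open>
Where \<open>exp v \<le> m / 2\<close> the damping term is at most \<open>m * decay\<close>, and \<open>3 / 2 * m * h + decay\<close> grows to the left
at rate at least \<open>m / 2\<close>. To get rid of \<open>decay\<close> at the end, it is evaluated at a point of \<open>[u, u + 1]\<close>
supplied by the mean value theorem, where it is at most \<open>h(u)\<close>.
\<close>

lemma profile_growth_lower:
  fixes \<kappa> m u :: real
  assumes m: "m \<ge> 1" "m / 2 \<ge> 1 - 2 * \<kappa>" "u + 1 \<le> ln (m / 2)"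
  shows "exp (m / 2 * (ln (m / 2) - u - 1)) \<le> (3 / 2 * m + 1) * profile \<kappa> (- m\<^sup>2) u"
proof -
  let ?h = "profile \<kappa> (- m\<^sup>2)" and ?D = "decay \<kappa> m" and ?U = "ln (m / 2)"
  define Y where "Y v = 3 / 2 * m * ?h v + ?D v" for v
  have h0: "?h v \<ge> 1" for v using profile_ge_1[of "- m\<^sup>2" \<kappa> v] by simp
  have Ymono: "Y ?U * exp (m / 2 * ?U) \<le> Y v * exp (m / 2 * v)" if "v \<le> ?U" for v
  proof (rule DERIV_nonpos_imp_nonincreasing[OF that])
    fix x assume x: "v \<le> x" "x \<le> ?U"
    have "((\<lambda>x. Y x * exp (m / 2 * x)) has_real_derivative
       (3 / 2 * m * (- ?D x) + (- m\<^sup>2 * ?h x + ?D x * (exp x - 2 * \<kappa> + 1))) * exp (m / 2 * x)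
        + exp (m / 2 * x) * (m / 2) * Y x) (at x)"
      unfolding Y_def
      by (rule DERIV_mult DERIV_add DERIV_cmult profile_decay_deriv decay_deriv derivative_eq_intros refl | simp)+
    also have "(3 / 2 * m * (- ?D x) + (- m\<^sup>2 * ?h x + ?D x * (exp x - 2 * \<kappa> + 1))) * exp (m / 2 * x)
        + exp (m / 2 * x) * (m / 2) * Y x
      = - ((?D x * (m - (exp x - 2 * \<kappa> + 1)) + m\<^sup>2 / 4 * ?h x) * exp (m / 2 * x))"
      by (simp add: Y_def algebra_simps power2_eq_square)
    finally have "((\<lambda>x. Y x * exp (m / 2 * x)) has_real_derivative
        - ((?D x * (m - (exp x - 2 * \<kappa> + 1)) + m\<^sup>2 / 4 * ?h x) * exp (m / 2 * x))) (at x)" .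
    moreover have "exp x \<le> m / 2" using x(2) m(1) by (simp add: ln_ge_iff)
    then have "m - (exp x - 2 * \<kappa> + 1) \<ge> 0" using m(2) by linarith
    then have "(?D x * (m - (exp x - 2 * \<kappa> + 1)) + m\<^sup>2 / 4 * ?h x) * exp (m / 2 * x) \<ge> 0"
      using decay_nonneg[of \<kappa> m x] h0[of x] by (intro mult_nonneg_nonneg add_nonneg_nonneg) auto
    ultimately show "\<exists>y. ((\<lambda>x. Y x * exp (m / 2 * x)) has_real_derivative y) (at x) \<and> y \<le> 0"
      by (metis neg_le_0_iff_le)
  qed
  have "\<exists>z>u. z < u + 1 \<and> ?h (u + 1) - ?h u = (u + 1 - u) * (- ?D z)"
    by (rule MVT2) (auto intro: profile_decay_deriv)
  then obtain z where z: "u < z" "z < u + 1" "?h (u + 1) - ?h u = - ?D z" by auto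
  have "?h z \<le> ?h u"
    by (rule DERIV_nonpos_imp_nonincreasing)
       (use z profile_decay_deriv decay_nonneg neg_le_0_iff_le in \<open>auto, metis\<close>)
  moreover have "?D z \<le> ?h u" using z(3) h0[of "u + 1"] by linarith
  ultimately have "Y z \<le> (3 / 2 * m + 1) * ?h u"
    unfolding Y_def using mult_left_mono[of "?h z" "?h u" "3 / 2 * m"] m(1) unfolding distrib_right by linarith
  moreover have "Y ?U * exp (m / 2 * ?U) / exp (m / 2 * z) \<le> Y z"
    using Ymono[of z] z m(3) by (simp add: divide_le_eq)
  then have "Y ?U * exp (m / 2 * (?U - z)) \<le> Y z" by (simp add: exp_diff right_diff_distrib)
  moreover have "1 * exp (m / 2 * (?U - u - 1)) \<le> Y ?U * exp (m / 2 * (?U - z))"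
  proof (rule mult_mono)
    have "1 * 1 \<le> 3 / 2 * m * ?h ?U" using m(1) h0[of ?U] by (intro mult_mono) auto
    then show "1 \<le> Y ?U" using decay_nonneg[of \<kappa> m ?U] by (simp add: Y_def)
    then show "0 \<le> Y ?U" by simp
    show "exp (m / 2 * (?U - u - 1)) \<le> exp (m / 2 * (?U - z))" using z m(1) by (simp add: mult_left_mono)
  qed simp
  ultimately show ?thesis by linarith
qed

lemma profile_growth:
  "\<forall>\<^sub>F m::real in at_top. 1/4 * (m * ln m) \<le> ln (profile \<kappa> (- m\<^sup>2) u) \<and> ln (profile \<kappa> (- m\<^sup>2) u) \<le> 2 * (m * ln m)"
proof -
  define K k where "K = 2 + majorant_coeff \<kappa>" and "k = \<bar>2 * \<kappa> - 1\<bar>"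
  have K: "K \<ge> 0" using majorant_coeff_nonneg[of \<kappa>] by (simp add: K_def)
  have "\<forall>\<^sub>F m in at_top. ln (1 + K) + m * K + (m + k) * (ln m - u) \<le> 2 * (m * ln m)"
    by real_asymp
  moreover have "\<forall>\<^sub>F m in at_top. m / 2 * (ln (m / 2) - u - 1) - ln (3 / 2 * m + 1) \<ge> 1/4 * (m * ln m)"
    by real_asymp
  moreover have "\<forall>\<^sub>F m in at_top. u \<le> ln m" by real_asymp
  moreover have "\<forall>\<^sub>F m in at_top. u + 1 \<le> ln (m / 2)" by real_asymp
  moreover have "\<forall>\<^sub>F m in at_top. m / 2 \<ge> 1 - 2 * \<kappa>" by real_asymp
  ultimately show ?thesis using eventually_ge_at_top[of 1]
  proof eventually_elim
    case (elim m)
    have h: "profile \<kappa> (- m\<^sup>2) u \<ge> 1" by (rule profile_ge_1) simp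
    have "ln (profile \<kappa> (- m\<^sup>2) u) \<le> ln ((1 + K) * exp (m * K + (m + k) * (ln m - u)))"
      using profile_growth_upper[of m u \<kappa>] elim h unfolding K_def k_def by (subst ln_le_cancel_iff) auto
    also have "\<dots> = ln (1 + K) + (m * K + (m + k) * (ln m - u))" using K by (simp add: ln_mult)
    finally have 1: "ln (profile \<kappa> (- m\<^sup>2) u) \<le> 2 * (m * ln m)" using elim by linarith
    have "m / 2 * (ln (m / 2) - u - 1) = ln (exp (m / 2 * (ln (m / 2) - u - 1)))" by simp
    also have "\<dots> \<le> ln ((3 / 2 * m + 1) * profile \<kappa> (- m\<^sup>2) u)"
      using profile_growth_lower[of m \<kappa> u] elim h by (subst ln_le_cancel_iff) (auto intro!: mult_pos_pos)
    also have "\<dots> = ln (3 / 2 * m + 1) + ln (profile \<kappa> (- m\<^sup>2) u)" using elim h by (subst ln_mult) auto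
    finally show ?case using 1 elim by linarith
  qed
qed

text \<open>
Growth of \<open>ln (max_modulus F r)\<close> between multiples of \<open>r ln r\<close> gives order one, and \<open>r ln r / r \<rightarrow> \<infinity>\<close> gives
infinite type.
\<close>

lemma order_one_maximal_typeI:
  assumes "a > 0" "b > 0"
    and lo: "\<forall>\<^sub>F r in at_top. a * (r * ln r) \<le> ln (max_modulus F r)"
    and up: "\<forall>\<^sub>F r in at_top. ln (max_modulus F r) \<le> b * (r * ln r)"
  shows "order_one_maximal_type F"
  unfolding order_one_maximal_type_def
proof
  have "((\<lambda>r. ln (ln (max_modulus F r)) / ln r) \<longlongrightarrow> 1) at_top"
  proof (rule tendsto_sandwich)
    show "((\<lambda>r. ln (a * (r * ln r)) / ln r) \<longlongrightarrow> 1) at_top" using assms(1) by real_asymp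
    show "((\<lambda>r. ln (b * (r * ln r)) / ln r) \<longlongrightarrow> 1) at_top" using assms(2) by real_asymp
    show "\<forall>\<^sub>F r in at_top. ln (a * (r * ln r)) / ln r \<le> ln (ln (max_modulus F r)) / ln r"
      using lo eventually_gt_at_top[of 1]
    proof eventually_elim
      case (elim r)
      then have "a * (r * ln r) > 0" using assms(1) by simp
      then show ?case using elim by (intro divide_right_mono) auto
    qed
    show "\<forall>\<^sub>F r in at_top. ln (ln (max_modulus F r)) / ln r \<le> ln (b * (r * ln r)) / ln r"
      using lo up eventually_gt_at_top[of 1]
    proof eventually_elim
      case (elim r)
      then have "a * (r * ln r) > 0" using assms(1) by simp
      then show ?case using elim by (intro divide_right_mono) auto
    qed
  qed
  then show "entire_order F = 1"
    unfolding entire_order_def by (intro lim_imp_Limsup) (auto simp: one_ereal_def)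
  have "filterlim (\<lambda>r. a * ln r) at_top at_top" using assms(1) by real_asymp
  moreover have "\<forall>\<^sub>F r in at_top. a * ln r \<le> ln (max_modulus F r) / r"
    using lo eventually_gt_at_top[of 0] by eventually_elim (auto simp: le_divide_eq mult_ac)
  ultimately have "filterlim (\<lambda>r. ln (max_modulus F r) / r) at_top at_top"
    by (rule filterlim_at_top_mono)
  then show "Limsup at_top (\<lambda>r. ereal (ln (max_modulus F r) / r)) = \<infinity>"
    by (intro lim_imp_Limsup) (auto simp: tendsto_PInfty_eq_at_top)
qed

lemma spectral_norm_le: "norm (spectral \<kappa> \<mu>) \<le> (\<kappa> - 1/2)\<^sup>2 + (norm \<mu>)\<^sup>2"
proof -
  have "(of_real \<kappa> - 1/2)\<^sup>2 = (of_real ((\<kappa> - 1/2)\<^sup>2) :: complex)" by simp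
  then show ?thesis
    unfolding spectral_def using norm_triangle_ineq4[of "of_real ((\<kappa> - 1/2)\<^sup>2) :: complex" "\<mu>\<^sup>2"]
    by (simp only: norm_of_real norm_power) simp
qed

lemma spectral_of_real: "spectral \<kappa> (of_real t) = of_real ((\<kappa> - 1/2)\<^sup>2 - t\<^sup>2)"
  and spectral_imaginary: "spectral \<kappa> (\<i> * of_real t) = of_real ((\<kappa> - 1/2)\<^sup>2 + t\<^sup>2)"
  by (simp_all add: spectral_def power_mult_distrib)

lemma profile_holomorphic: "(\<lambda>c. profile \<kappa> c u) holomorphic_on A"
  using profile_param_deriv[of \<kappa> u] by (auto simp: holomorphic_on_def field_differentiable_def
    intro: has_field_derivative_at_within)

lemma profile_spectral_holomorphic: "(\<lambda>\<mu>. profile \<kappa> (spectral \<kappa> \<mu>) u) holomorphic_on A"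
proof -
  have "spectral \<kappa> holomorphic_on A" unfolding spectral_def by (intro holomorphic_intros)
  from holomorphic_on_compose_gen[OF this profile_holomorphic[of \<kappa> u UNIV]] show ?thesis by (simp add: o_def)
qed

text \<open>
On the circle \<open>|\<mu>| = r\<close> the parameter \<open>c\<close> has modulus at most \<open>r\<^sup>2 + (\<kappa> - 1/2)\<^sup>2\<close>, and by
\<open>norm_profile_le_profile\<close> the value at \<open>- |c|\<close> bounds \<open>|h|\<close>. At \<open>\<mu> = r\<close> one has \<open>c = - (r\<^sup>2 - (\<kappa> - 1/2)\<^sup>2)\<close>.
Both bounds are thus values of \<open>h\<close> at negative \<open>c\<close>.
\<close>

lemma profile_spectral_growth:
  assumes "p > 0"
  shows "order_one_maximal_type (\<lambda>\<mu>. of_real p * profile \<kappa> (spectral \<kappa> \<mu>) u)"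
    (is "order_one_maximal_type ?F")
proof -
  define d where "d = (\<kappa> - 1/2)\<^sup>2"
  define H where "H m = ln (profile \<kappa> (- m\<^sup>2) u)" for m :: real
  have d: "d \<ge> 0" by (simp add: d_def)
  have le: "norm (?F \<mu>) \<le> p * profile \<kappa> (- (r\<^sup>2 + d)) u" if "norm \<mu> = r" for \<mu> r
    using norm_profile_le_profile[of "spectral \<kappa> \<mu>" "r\<^sup>2 + d" \<kappa> u] spectral_norm_le[of \<kappa> \<mu>] that assms
    by (simp add: norm_mult d_def add.commute)
  have up: "max_modulus ?F r \<le> p * profile \<kappa> (- (r\<^sup>2 + d)) u" if "r \<ge> 0" for r
    unfolding max_modulus_def using that le[of _ r] by (intro cSUP_least) (auto simp: sphere_eq_empty)
  have lo: "max_modulus ?F r \<ge> p * profile \<kappa> (- (r\<^sup>2 - d)) u" if "r \<ge> 0" "r\<^sup>2 \<ge> d" for r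
  proof -
    have "norm (?F (of_real r)) \<le> max_modulus ?F r"
      unfolding max_modulus_def using that le[of _ r]
      by (intro cSUP_upper bdd_aboveI2[where M = "p * profile \<kappa> (- (r\<^sup>2 + d)) u"]) auto
    moreover have "norm (?F (of_real r)) = p * profile \<kappa> (- (r\<^sup>2 - d)) u"
      using profile_ge_1[of "d - r\<^sup>2" \<kappa> u] that assms
      by (simp only: spectral_of_real d_def[symmetric] profile_of_real norm_mult norm_of_real) simp
    ultimately show ?thesis by simp
  qed
  have lim1: "filterlim (\<lambda>r. sqrt (r\<^sup>2 + d)) at_top at_top" by real_asymp
  have lim2: "filterlim (\<lambda>r. sqrt (r\<^sup>2 - d)) at_top at_top" by real_asymp
  have ev1: "\<forall>\<^sub>F r in at_top. H (sqrt (r\<^sup>2 + d)) \<le> 2 * (sqrt (r\<^sup>2 + d) * ln (sqrt (r\<^sup>2 + d)))"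
    using eventually_compose_filterlim[OF profile_growth[of \<kappa> u] lim1] by (auto elim!: eventually_mono simp: H_def)
  have ev2: "\<forall>\<^sub>F r in at_top. H (sqrt (r\<^sup>2 - d)) \<ge> 1/4 * (sqrt (r\<^sup>2 - d) * ln (sqrt (r\<^sup>2 - d)))"
    using eventually_compose_filterlim[OF profile_growth[of \<kappa> u] lim2] by (auto elim!: eventually_mono simp: H_def)
  have r0: "\<forall>\<^sub>F r in at_top. r\<^sup>2 \<ge> d" by real_asymp
  have as1: "\<forall>\<^sub>F r in at_top. ln p + 2 * (sqrt (r\<^sup>2 + d) * ln (sqrt (r\<^sup>2 + d))) \<le> 3 * (r * ln r)" by real_asymp
  have as2: "\<forall>\<^sub>F r in at_top. ln p + 1/4 * (sqrt (r\<^sup>2 - d) * ln (sqrt (r\<^sup>2 - d))) \<ge> 1/8 * (r * ln r)" by real_asymp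
  show ?thesis
  proof (rule order_one_maximal_typeI[of "1/8" 3])
    have h1: "profile \<kappa> (- (r\<^sup>2 - d)) u \<ge> 1" "profile \<kappa> (- (r\<^sup>2 + d)) u \<ge> 1" if "r\<^sup>2 \<ge> d" for r
      using that d by (auto intro!: profile_ge_1)
    show "\<forall>\<^sub>F r in at_top. 1/8 * (r * ln r) \<le> ln (max_modulus ?F r)"
      using ev2 as2 r0 eventually_ge_at_top[of 0]
    proof eventually_elim
      case (elim r)
      have "ln p + H (sqrt (r\<^sup>2 - d)) = ln (p * profile \<kappa> (- (r\<^sup>2 - d)) u)"
        using h1[of r] elim assms by (simp add: H_def ln_mult)
      also have "\<dots> \<le> ln (max_modulus ?F r)"
        using lo[of r] h1[of r] elim assms by (intro ln_mono) auto
      finally show ?case using elim by linarith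
    qed
    show "\<forall>\<^sub>F r in at_top. ln (max_modulus ?F r) \<le> 3 * (r * ln r)"
      using ev1 as1 r0 eventually_ge_at_top[of 0]
    proof eventually_elim
      case (elim r)
      have pos: "0 < max_modulus ?F r"
        using lo[of r] h1[of r] elim assms by (intro less_le_trans[OF _ lo[of r]]) auto
      have "ln (max_modulus ?F r) \<le> ln (p * profile \<kappa> (- (r\<^sup>2 + d)) u)"
        using up[of r] pos elim by (intro ln_mono) auto
      also have "\<dots> = ln p + H (sqrt (r\<^sup>2 + d))"
        using h1[of r] elim assms d by (simp add: H_def ln_mult)
      finally show ?case using elim by linarith
    qed
  qed auto
qed

section \<open>Continuous phases and the counting of eigenvalues\<close>

text \<open>
A continuous logarithm of a differentiable function differs locally from the principal logarithm of a
quotient near \<open>1\<close> by a constant only.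
\<close>

lemma log_lift_deriv:
  fixes L F :: "real \<Rightarrow> complex"
  assumes cont: "isCont L x"
    and ex: "\<forall>\<^sub>F t in nhds x. exp (L t) = F t"
    and F: "(F has_vector_derivative D) (at x)"
  shows "(L has_vector_derivative D / F x) (at x)"
proof -
  have Fx: "exp (L x) = F x" using ex eventually_nhds_x_imp_x by blast
  then have nz: "F x \<noteq> 0" by (metis exp_not_eq_zero)
  have "((\<lambda>t. Ln (F t * inverse (F x))) has_vector_derivative D * inverse (F x) * inverse 1) (at x)"
  proof -
    have 1: "((\<lambda>t. F t * inverse (F x)) has_vector_derivative D * inverse (F x)) (at x)"
      by (rule has_vector_derivative_mult_left[OF F])
    have 2: "(Ln has_field_derivative inverse 1) (at (F x * inverse (F x)))"
      using nz has_field_derivative_Ln[of 1] by simp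
    show ?thesis using field_vector_diff_chain_at[OF 1 2] by (simp add: o_def)
  qed
  then have "((\<lambda>t. L x + Ln (F t * inverse (F x))) has_vector_derivative 0 + D / F x) (at x)"
    by (intro has_vector_derivative_add has_vector_derivative_const) (simp add: divide_inverse)
  then have main: "((\<lambda>t. L x + Ln (F t * inverse (F x))) has_vector_derivative D / F x) (at x)" by simp
  have "\<forall>\<^sub>F t in nhds x. dist (L t) (L x) < pi"
  proof -
    have "\<forall>\<^sub>F t in at x. dist (L t) (L x) < pi"
      using tendstoD[OF cont[unfolded isCont_def] pi_gt_zero] .
    then show ?thesis unfolding eventually_at_filter
      by (rule eventually_mono) (metis UNIV_I dist_self pi_gt_zero)
  qed
  with ex have "\<forall>\<^sub>F t in nhds x. L x + Ln (F t * inverse (F x)) = L t"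
  proof eventually_elim
    case (elim t)
    have "F t * inverse (F x) = exp (L t - L x)"
      using elim Fx by (simp add: exp_diff divide_inverse)
    moreover have "\<bar>Im (L t - L x)\<bar> < pi"
      using elim abs_Im_le_cmod[of "L t - L x"] by (simp add: dist_norm)
    ultimately show ?case by (simp add: Ln_exp)
  qed
  then obtain S where "open S" "x \<in> S" "\<And>t. t \<in> S \<Longrightarrow> L x + Ln (F t * inverse (F x)) = L t"
    unfolding eventually_nhds by blast
  then show ?thesis using has_vector_derivative_transform_within_open[OF main] by blast
qed

lemma log_lift_arg_deriv:
  fixes L :: "real \<Rightarrow> complex"
  assumes "isCont L x" and ex: "\<forall>\<^sub>F t in nhds x. exp (L t) = Complex (a t) (b t)"
    and a: "(a has_real_derivative a') (at x)" and b: "(b has_real_derivative b') (at x)"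
  shows "((\<lambda>t. Im (L t)) has_real_derivative (a x * b' - b x * a') / ((a x)\<^sup>2 + (b x)\<^sup>2)) (at x)"
proof -
  have "((\<lambda>t. of_real (a t) + \<i> * of_real (b t)) has_vector_derivative of_real a' + \<i> * of_real b') (at x)"
    using a b by (intro has_vector_derivative_add has_vector_derivative_mult_right has_vector_derivative_of_real)
       (simp_all add: has_real_derivative_iff_has_vector_derivative)
  then have "((\<lambda>t. Complex (a t) (b t)) has_vector_derivative Complex a' b') (at x)"
    by (simp add: Complex_eq)
  from bounded_linear.has_vector_derivative[OF bounded_linear_Im log_lift_deriv[OF assms(1,2) this]]
  show ?thesis
    by (simp add: has_real_derivative_iff_has_vector_derivative Im_divide mult.commute)
qed

text \<open>
If \<open>F\<close> and \<open>G\<close> never point in opposite directions, a continuous logarithm of \<open>F\<close> gives one of \<open>G\<close> whose phase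
stays within \<open>\<pi>\<close>. So different normalisations of the phase plane may be used on different intervals at the
cost of \<open>O(1)\<close>.
\<close>

lemma relift:
  fixes L F G :: "'a::topological_space \<Rightarrow> complex"
  assumes L: "continuous_on A L" "\<And>x. x \<in> A \<Longrightarrow> exp (L x) = F x"
    and G: "continuous_on A G" "\<And>x. x \<in> A \<Longrightarrow> G x / F x \<notin> \<real>\<^sub>\<le>\<^sub>0"
  obtains L' where "continuous_on A L'" "\<And>x. x \<in> A \<Longrightarrow> exp (L' x) = G x"
    "\<And>x. x \<in> A \<Longrightarrow> \<bar>Im (L' x) - Im (L x)\<bar> < pi"
proof
  let ?L' = "\<lambda>x. L x + Ln (G x / exp (L x))"
  have "G x / exp (L x) \<notin> \<real>\<^sub>\<le>\<^sub>0" if "x \<in> A" for x using L G that by simp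
  then show "continuous_on A ?L'"
    by (intro continuous_intros L G) auto
  fix x assume x: "x \<in> A"
  have nr: "G x / exp (L x) \<notin> \<real>\<^sub>\<le>\<^sub>0" using L G x by simp
  then have nz: "G x / exp (L x) \<noteq> 0" by (metis nonpos_Reals_zero_I)
  then show "exp (?L' x) = G x" by (simp add: exp_add exp_Ln)
  show "\<bar>Im (?L' x) - Im (L x)\<bar> < pi"
    using mpi_less_Im_Ln[OF nz] Im_Ln_less_pi[of "G x / exp (L x)"] nr nz by (auto simp: abs_less_iff)
qed

text \<open>
A map of the plane that preserves each of the two open half-planes and both rays of the horizontal axis never
reverses a vector.
\<close>

lemma shear_not_nonpos:
  assumes "Complex a b \<noteq> 0" "s > 0" "r > 0" "b' = s * b" "b = 0 \<Longrightarrow> a' = r * a"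
  shows "Complex a' b' / Complex a b \<notin> \<real>\<^sub>\<le>\<^sub>0"
proof
  assume "Complex a' b' / Complex a b \<in> \<real>\<^sub>\<le>\<^sub>0"
  then obtain t where t: "t \<le> 0" "Complex a' b' / Complex a b = of_real t"
    by (auto elim!: nonpos_Reals_cases)
  then have "Complex a' b' = of_real t * Complex a b" using assms(1) by (simp add: divide_eq_eq)
  then have eq: "a' = t * a" "b' = t * b" by (simp_all add: complex_eq_iff)
  from eq(2) assms have "(s - t) * b = 0" by (simp add: algebra_simps)
  then have b0: "b = 0" using assms t by auto
  with eq(1) assms have "(r - t) * a = 0" by (simp add: algebra_simps)
  then have "a = 0" using assms t by auto
  with b0 assms(1) show False by (simp add: complex_eq_iff)
qed

lemma multiple_of_pi_between:
  assumes "y - x \<ge> pi" shows "\<exists>k::int. x \<le> of_int k * pi \<and> of_int k * pi \<le> y"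
proof (intro exI conjI)
  have "x / pi \<le> of_int \<lceil>x / pi\<rceil>" by simp
  then show "x \<le> of_int \<lceil>x / pi\<rceil> * pi" by (simp only: pos_divide_le_eq[OF pi_gt_zero])
  have "of_int \<lceil>x / pi\<rceil> \<le> x / pi + 1" by linarith
  then have "of_int \<lceil>x / pi\<rceil> * pi \<le> (x / pi + 1) * pi" by (intro mult_right_mono) auto
  also have "\<dots> = x + pi" by (simp add: distrib_right)
  finally show "of_int \<lceil>x / pi\<rceil> * pi \<le> y" using assms by linarith
qed

lemma arg_change_less_pi:
  fixes \<theta> :: "real \<Rightarrow> real"
  assumes ab: "a \<le> b" and c: "continuous_on {a..b} \<theta>" and s: "\<And>t. a \<le> t \<Longrightarrow> t \<le> b \<Longrightarrow> sin (\<theta> t) \<noteq> 0"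
  shows "\<bar>\<theta> b - \<theta> a\<bar> < pi"
proof (rule ccontr)
  assume "\<not> ?thesis"
  then consider "\<theta> b - \<theta> a \<ge> pi" | "\<theta> a - \<theta> b \<ge> pi" by linarith
  then obtain t k where "a \<le> t" "t \<le> b" "\<theta> t = of_int k * pi"
  proof cases
    case 1
    from multiple_of_pi_between[OF this] obtain k :: int where "\<theta> a \<le> of_int k * pi" "of_int k * pi \<le> \<theta> b" by blast
    from IVT'[OF this ab c] that show ?thesis by blast
  next
    case 2
    from multiple_of_pi_between[OF this] obtain k :: int where "\<theta> b \<le> of_int k * pi" "of_int k * pi \<le> \<theta> a" by blast
    from IVT2'[OF this ab c] that show ?thesis by blast
  qed
  then show False using s[of t] sin_zero_iff_int2 by auto
qed

text \<open>
A decreasing phase takes each value \<open>k \<pi>\<close> between its end values exactly once.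
\<close>

lemma card_pi_crossings:
  fixes \<theta> :: "real \<Rightarrow> real"
  assumes C: "C \<ge> 0" and cont: "continuous_on {0..C} \<theta>"
    and dec: "\<And>s t. 0 \<le> s \<Longrightarrow> s < t \<Longrightarrow> t \<le> C \<Longrightarrow> \<theta> t < \<theta> s"
  defines "Z \<equiv> {c. 0 < c \<and> c \<le> C \<and> sin (\<theta> c) = 0}"
  shows "finite Z" "\<bar>pi * real (card Z) - (\<theta> 0 - \<theta> C)\<bar> \<le> pi"
proof -
  define I where "I = {\<lceil>\<theta> C / pi\<rceil>..<\<lceil>\<theta> 0 / pi\<rceil>}"
  have bij: "bij_betw (\<lambda>c. \<lfloor>\<theta> c / pi\<rfloor>) Z I"
  proof (rule bij_betwI')
    have k: "\<theta> c = of_int \<lfloor>\<theta> c / pi\<rfloor> * pi" if "c \<in> Z" for c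
      using that by (auto simp: Z_def sin_zero_iff_int2)
    fix c assume c: "c \<in> Z"
    show "\<lfloor>\<theta> c / pi\<rfloor> \<in> I"
    proof -
      have "\<theta> C \<le> \<theta> c" using c dec[of c C] by (cases "c = C") (auto simp: Z_def)
      then have "\<theta> C / pi \<le> \<theta> c / pi" by (simp add: divide_right_mono)
      moreover have "\<theta> c < \<theta> 0" using c dec[of 0 c] by (auto simp: Z_def)
      then have "\<theta> c / pi < \<theta> 0 / pi" by (simp add: divide_strict_right_mono)
      moreover have "\<theta> c / pi = of_int \<lfloor>\<theta> c / pi\<rfloor>" using k[OF c] by (metis nonzero_mult_div_cancel_right pi_neq_zero)
      ultimately show ?thesis unfolding I_def by (simp add: ceiling_le_iff less_ceiling_iff)
    qed
    fix d assume d: "d \<in> Z"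
    show "\<lfloor>\<theta> c / pi\<rfloor> = \<lfloor>\<theta> d / pi\<rfloor> \<longleftrightarrow> c = d"
    proof
      assume "\<lfloor>\<theta> c / pi\<rfloor> = \<lfloor>\<theta> d / pi\<rfloor>"
      then have "\<theta> c = \<theta> d" using k[OF c] k[OF d] by metis
      then show "c = d" using dec[of c d] dec[of d c] c d by (fastforce simp: Z_def)
    qed simp
  next
    fix k assume "k \<in> I"
    then have k: "\<theta> C \<le> of_int k * pi" "of_int k * pi < \<theta> 0"
      by (auto simp: I_def ceiling_le_iff less_ceiling_iff pos_divide_le_eq pos_less_divide_eq)
    obtain c where c: "0 \<le> c" "c \<le> C" "\<theta> c = of_int k * pi"
      using IVT2'[OF k(1) less_imp_le[OF k(2)] C cont] by blast
    then have "c \<in> Z" using k(2) unfolding Z_def by (cases "c = 0") (auto simp: sin_zero_iff_int2)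
    moreover have "k = \<lfloor>\<theta> c / pi\<rfloor>" using c by simp
    ultimately show "\<exists>c\<in>Z. k = \<lfloor>\<theta> c / pi\<rfloor>" by blast
  qed
  show "finite Z" using bij_betw_finite[OF bij] by (simp add: I_def)
  have "\<theta> C \<le> \<theta> 0" using dec[of 0 C] C by (cases "C = 0") auto
  then have le: "\<lceil>\<theta> C / pi\<rceil> \<le> \<lceil>\<theta> 0 / pi\<rceil>" by (intro ceiling_mono divide_right_mono) auto
  have "real (card Z) = of_int (\<lceil>\<theta> 0 / pi\<rceil> - \<lceil>\<theta> C / pi\<rceil>)"
    using bij_betw_same_card[OF bij] le by (simp add: I_def)
  then have "\<bar>real (card Z) - (\<theta> 0 / pi - \<theta> C / pi)\<bar> \<le> 1" by simp linarith
  then have "pi * \<bar>real (card Z) - (\<theta> 0 / pi - \<theta> C / pi)\<bar> \<le> pi * 1" by (intro mult_left_mono) auto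
  also have "pi * \<bar>real (card Z) - (\<theta> 0 / pi - \<theta> C / pi)\<bar> = \<bar>pi * (real (card Z) - (\<theta> 0 / pi - \<theta> C / pi))\<bar>"
    by (simp add: abs_mult)
  also have "pi * (real (card Z) - (\<theta> 0 / pi - \<theta> C / pi)) = pi * real (card Z) - (\<theta> 0 - \<theta> C)"
    by (simp add: right_diff_distrib)
  finally show "\<bar>pi * real (card Z) - (\<theta> 0 - \<theta> C)\<bar> \<le> pi" by simp
qed

lemma momentum_profile_nonzero: "Complex (momentum \<kappa> c u) (profile \<kappa> c u) \<noteq> 0"
proof
  obtain h' A' where "((\<lambda>c. profile \<kappa> c u) has_real_derivative h') (at c)"
    "((\<lambda>c. momentum \<kappa> c u) has_real_derivative A') (at c)"
    using profile_param_deriv momentum_param_deriv by blast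
  from phase_derivative_positive[OF this]
  show "Complex (momentum \<kappa> c u) (profile \<kappa> c u) = 0 \<Longrightarrow> False" by (auto simp: complex_eq_iff)
qed

text \<open>
The restriction to positive \<open>c\<close> loses no zeros, since \<open>h \<ge> 1\<close> for \<open>c \<le> 0\<close> (\<open>profile_ge_1\<close>).
\<close>

definition eigenvalues :: "real \<Rightarrow> real \<Rightarrow> real \<Rightarrow> real set" where
  "eigenvalues \<kappa> u C = {c. 0 < c \<and> c \<le> C \<and> profile \<kappa> c u = 0}"

text \<open>
The phase \<open>\<theta> u c\<close> of \<open>A + i h\<close> is continuous on the plane, decreasing in \<open>c\<close>, and independent of \<open>u\<close> for
\<open>c = 0\<close>, because there \<open>h = 1\<close> and \<open>A = 0\<close>. For large \<open>U\<close> the function \<open>h\<close> is positive for all \<open>c\<close> between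
\<open>0\<close> and \<open>C\<close>, so on that side the phase moves by less than \<open>\<pi>\<close>. The eigenvalue count, which is the change of
phase along \<open>u = u\<^sub>0\<close>, is thereby transferred to the side \<open>c = C\<close>. The final statement is about the phase of
\<open>g' + i g\<close>, which is within \<open>\<pi>\<close> of the other one by \<open>relift\<close>.
\<close>

lemma eigenvalue_count_by_phase:
  assumes C: "C \<ge> 0"
  shows "finite (eigenvalues \<kappa> u\<^sub>0 C)"
    and "\<exists>L. continuous_on UNIV L \<and> (\<forall>u. exp (L u) = Complex (wave' \<kappa> C u) (wave \<kappa> C u)) \<and>
      (\<forall>\<^sub>F U in at_top. \<bar>pi * real (card (eigenvalues \<kappa> u\<^sub>0 C)) - (Im (L U) - Im (L u\<^sub>0))\<bar> \<le> 4 * pi)"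
proof -
  let ?P = "\<lambda>p. Complex (momentum \<kappa> (snd p) (fst p)) (profile \<kappa> (snd p) (fst p))"
  have "continuous_on (UNIV :: (real \<times> real) set) ?P"
    using momentum_continuous[of \<kappa>] profile_continuous[of \<kappa>]
    unfolding Complex_eq case_prod_beta' by (intro continuous_intros)
  then obtain L where L: "continuous_on UNIV L" "\<And>p. ?P p = exp (L p)"
    using continuous_logarithm_on_contractible[of UNIV ?P] momentum_profile_nonzero by auto
  define \<theta> where "\<theta> u c = Im (L (u, c))" for u c
  have Lc: "continuous_on A (\<lambda>c. L (u, c))" "continuous_on A (\<lambda>u. L (u, c))" for A u c
    by (auto intro!: continuous_on_compose2[OF L(1)] continuous_intros)
  have \<theta>c: "continuous_on A (\<lambda>c. \<theta> u c)" "continuous_on A (\<lambda>u. \<theta> u c)" for A u c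
    unfolding \<theta>_def using Lc by (auto intro!: continuous_intros)
  have h\<theta>: "profile \<kappa> c u = 0 \<longleftrightarrow> sin (\<theta> u c) = 0" for u c
  proof -
    have "profile \<kappa> c u = Im (exp (L (u, c)))" using L(2)[of "(u, c)"] by (simp flip: L(2))
    then show ?thesis by (simp add: Im_exp \<theta>_def)
  qed
  have \<theta>dec: "\<theta> u t < \<theta> u s" if "s < t" for u s t
  proof (rule DERIV_neg_imp_decreasing[OF that])
    fix c
    obtain h' A' where d: "((\<lambda>c. profile \<kappa> c u) has_real_derivative h') (at c)"
      "((\<lambda>c. momentum \<kappa> c u) has_real_derivative A') (at c)"
      using profile_param_deriv momentum_param_deriv by blast
    have "isCont (\<lambda>c. L (u, c)) c" using Lc(1)[of UNIV] by (simp add: continuous_on_eq_continuous_at)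
    from log_lift_arg_deriv[OF this _ d(2,1)]
    have "((\<lambda>c. \<theta> u c) has_real_derivative (momentum \<kappa> c u * h' - profile \<kappa> c u * A')
        / ((momentum \<kappa> c u)\<^sup>2 + (profile \<kappa> c u)\<^sup>2)) (at c)"
      unfolding \<theta>_def by (simp flip: L(2))
    moreover have "(momentum \<kappa> c u * h' - profile \<kappa> c u * A') / ((momentum \<kappa> c u)\<^sup>2 + (profile \<kappa> c u)\<^sup>2) < 0"
      using phase_derivative_positive[OF d] momentum_profile_nonzero[of \<kappa> c u]
      by (intro divide_neg_pos) (auto simp: mult.commute sum_power2_gt_zero_iff complex_eq_iff)
    ultimately show "\<exists>y. ((\<lambda>c. \<theta> u c) has_real_derivative y) (at c) \<and> y < 0" by blast
  qed
  have E: "eigenvalues \<kappa> u\<^sub>0 C = {c. 0 < c \<and> c \<le> C \<and> sin (\<theta> u\<^sub>0 c) = 0}"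
    by (simp add: eigenvalues_def h\<theta>)
  note count = card_pi_crossings[OF C \<theta>c(1)[of _ u\<^sub>0] \<theta>dec, folded E]
  show "finite (eigenvalues \<kappa> u\<^sub>0 C)" using count by blast
  have c2: "\<bar>pi * real (card (eigenvalues \<kappa> u\<^sub>0 C)) - (\<theta> u\<^sub>0 0 - \<theta> u\<^sub>0 C)\<bar> \<le> pi" using count by blast
  \<comment> \<open>The side \<open>c = 0\<close> of the rectangle.\<close>
  have const: "\<theta> u 0 = \<theta> v 0" for u v
  proof -
    have "((\<lambda>u. L (u, 0)) has_vector_derivative 0) (at u)" for u
    proof -
      have "exp (L (u, 0)) = Complex 0 1" for u
      proof -
        have "profile \<kappa> (0::real) u = 1"
          using profile_minus_1_le[of \<kappa> "0::real" u] by simp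
        then show ?thesis using L(2)[of "(u, 0)"] by (simp add: momentum_def)
      qed
      moreover have "isCont (\<lambda>u. L (u, 0)) u" using Lc(2)[of UNIV] by (simp add: continuous_on_eq_continuous_at)
      ultimately show ?thesis using log_lift_deriv[where L = "\<lambda>u. L (u, 0)" and x = u and F = "\<lambda>_. Complex 0 1" and D = 0] by simp
    qed
    then have "\<And>u. ((\<lambda>u. L (u, 0)) has_vector_derivative 0) (at u within UNIV)" by simp
    then obtain d where "\<And>u. u \<in> UNIV \<Longrightarrow> L (u, 0) = d"
      by (rule has_vector_derivative_zero_constant[OF convex_UNIV]) blast
    then show ?thesis by (simp add: \<theta>_def)
  qed
  \<comment> \<open>The side \<open>u = U\<close> of the rectangle.\<close>
  have far: "\<forall>\<^sub>F U in at_top. \<bar>\<theta> U C - \<theta> U 0\<bar> < pi"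
  proof -
    have "((\<lambda>v. exp (C * majorant \<kappa> v) - 1) \<longlongrightarrow> exp (C * 0) - 1) at_top"
      by (intro tendsto_intros majorant_tendsto_0)
    then have "\<forall>\<^sub>F v in at_top. exp (C * majorant \<kappa> v) - 1 < 1"
      by (rule order_tendstoD) simp
    then show ?thesis
    proof eventually_elim
      case (elim U)
      have "sin (\<theta> U c) \<noteq> 0" if "0 \<le> c" "c \<le> C" for c
      proof -
        have "norm (profile \<kappa> c U - 1) \<le> exp (norm c * majorant \<kappa> U) - 1" by (rule profile_minus_1_le)
        also have "\<dots> \<le> exp (C * majorant \<kappa> U) - 1" using that majorant_nonneg by (simp add: mult_right_mono)
        also have "\<dots> < 1" by (rule elim)
        finally show ?thesis unfolding h\<theta>[symmetric] by auto
      qed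
      then show ?case using arg_change_less_pi[OF C \<theta>c(1)] by blast
    qed
  qed
  have amp0: "amp \<kappa> u \<noteq> 0" for u using amp_pos[of \<kappa> u] by linarith
  have wc: "continuous_on UNIV (\<lambda>u. Complex (wave' \<kappa> C u) (wave \<kappa> C u))"
    unfolding Complex_eq
    by (intro continuous_intros continuous_at_imp_continuous_on ballI DERIV_isCont[OF wave_deriv] DERIV_isCont[OF wave'_deriv])
  have nn: "Complex (wave' \<kappa> C u) (wave \<kappa> C u) / ?P (u, C) \<notin> \<real>\<^sub>\<le>\<^sub>0" for u
    using momentum_profile_nonzero[of \<kappa> C u]
    by (intro shear_not_nonpos[where s = "amp \<kappa> u" and r = "1 / amp \<kappa> u"])
       (auto simp: wave_def wave'_def)
  have ex: "exp (L (u, C)) = ?P (u, C)" for u by (rule L(2)[symmetric])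
  obtain L' where L': "continuous_on UNIV L'" "\<And>u. u \<in> UNIV \<Longrightarrow> exp (L' u) = Complex (wave' \<kappa> C u) (wave \<kappa> C u)"
    "\<And>u. u \<in> UNIV \<Longrightarrow> \<bar>Im (L' u) - Im (L (u, C))\<bar> < pi"
    by (rule relift[OF Lc(2)[of UNIV C] ex wc nn]) blast
  have "\<forall>\<^sub>F U in at_top. \<bar>pi * real (card (eigenvalues \<kappa> u\<^sub>0 C)) - (Im (L' U) - Im (L' u\<^sub>0))\<bar> \<le> 4 * pi"
    using far
  proof eventually_elim
    case (elim U)
    show ?case using elim c2 const[of u\<^sub>0 U] L'(3)[OF UNIV_I, of U] L'(3)[OF UNIV_I, of u\<^sub>0] unfolding \<theta>_def by linarith
  qed
  with L'(1,2) show "\<exists>L. continuous_on UNIV L \<and> (\<forall>u. exp (L u) = Complex (wave' \<kappa> C u) (wave \<kappa> C u)) \<and>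
      (\<forall>\<^sub>F U in at_top. \<bar>pi * real (card (eigenvalues \<kappa> u\<^sub>0 C)) - (Im (L U) - Im (L u\<^sub>0))\<bar> \<le> 4 * pi)"
    by blast
qed

section \<open>The phase in the classically allowed region\<close>

text \<open>
The mean value inequality in the form in which it controls phases: the total variation of \<open>f\<close> is measured by
an explicit function \<open>R\<close> and not by an integral.
\<close>

lemma increment_bound:
  fixes f R :: "real \<Rightarrow> real"
  assumes ab: "a \<le> b" and c: "continuous_on {a..b} f" "continuous_on {a..b} R"
    and d: "\<And>x. a < x \<Longrightarrow> x < b \<Longrightarrow> \<exists>f' R'. (f has_real_derivative f') (at x) \<and> (R has_real_derivative R') (at x) \<and> \<bar>f'\<bar> \<le> R'"
  shows "\<bar>f b - f a\<bar> \<le> R b - R a"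
proof -
  have "R a - f a \<le> R b - f b"
  proof (rule DERIV_nonneg_imp_increasing_open[OF ab])
    fix x assume "a < x" "x < b"
    then obtain f' R' where "(f has_real_derivative f') (at x)" "(R has_real_derivative R') (at x)" "\<bar>f'\<bar> \<le> R'"
      using d by blast
    then show "\<exists>y. ((\<lambda>x. R x - f x) has_real_derivative y) (at x) \<and> 0 \<le> y"
      by (intro exI[of _ "R' - f'"]) (auto intro!: derivative_eq_intros)
  qed (intro continuous_intros c)
  moreover have "R a + f a \<le> R b + f b"
  proof (rule DERIV_nonneg_imp_increasing_open[OF ab])
    fix x assume "a < x" "x < b"
    then obtain f' R' where "(f has_real_derivative f') (at x)" "(R has_real_derivative R') (at x)" "\<bar>f'\<bar> \<le> R'"
      using d by blast
    then show "\<exists>y. ((\<lambda>x. R x + f x) has_real_derivative y) (at x) \<and> 0 \<le> y"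
      by (intro exI[of _ "R' + f'"]) (auto intro!: derivative_eq_intros)
  qed (intro continuous_intros c)
  ultimately show ?thesis by linarith
qed

text \<open>
Pruefer's equation for the phase of \<open>(G', S G)\<close> with a variable scale \<open>S\<close>, where \<open>G'' = - q G\<close>. If \<open>S\<^sup>2\<close> is
close to \<open>q\<close>, the first two terms add up to about \<open>S\<close>.
\<close>

lemma pruefer_deriv:
  assumes L: "isCont L x" "\<forall>\<^sub>F t in nhds x. exp (L t) = Complex (G1 t) (S t * G t)"
    and G: "(G has_real_derivative G1 x) (at x)" "(G1 has_real_derivative - q * G x) (at x)"
    and S: "(S has_real_derivative S1) (at x)" "S x > 0"
  shows "((\<lambda>t. Im (L t)) has_real_derivative
     S x * (cos (Im (L x)))\<^sup>2 + q / S x * (sin (Im (L x)))\<^sup>2 + S1 / S x * (sin (Im (L x)) * cos (Im (L x)))) (at x)"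
proof -
  define \<rho> where "\<rho> = exp (Re (L x))"
  define sn cs where "sn = sin (Im (L x))" and "cs = cos (Im (L x))"
  have \<rho>: "\<rho> > 0" by (simp add: \<rho>_def)
  have "exp (L x) = Complex (G1 x) (S x * G x)" using L(2) eventually_nhds_x_imp_x by blast
  then have e: "G1 x = \<rho> * cs" "S x * G x = \<rho> * sn"
    by (simp_all add: \<rho>_def sn_def cs_def complex_eq_iff Re_exp Im_exp)
  have Gx: "G x = \<rho> * sn / S x" using e(2) S(2) by (simp add: field_simps)
  have one: "sn * sn + cs * cs = 1" by (simp add: sn_def cs_def flip: power2_eq_square)
  have "((\<lambda>t. S t * G t) has_real_derivative S1 * G x + G1 x * S x) (at x)"
    by (rule DERIV_mult[OF S(1) G(1)])
  from log_lift_arg_deriv[OF L G(2) this]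
  have "((\<lambda>t. Im (L t)) has_real_derivative
    (G1 x * (S1 * G x + G1 x * S x) - S x * G x * (- q * G x)) / ((G1 x)\<^sup>2 + (S x * G x)\<^sup>2)) (at x)" .
  also have "(G1 x)\<^sup>2 + (S x * G x)\<^sup>2 = \<rho> * \<rho> * (sn * sn + cs * cs)"
    unfolding e by (simp add: power2_eq_square algebra_simps)
  also have "\<dots> = \<rho> * \<rho>" by (simp add: one)
  also have "(G1 x * (S1 * G x + G1 x * S x) - S x * G x * (- q * G x)) / (\<rho> * \<rho>)
     = S x * cs\<^sup>2 + q / S x * sn\<^sup>2 + S1 / S x * (sn * cs)"
    unfolding e(1) Gx using \<rho> S(2) by (simp add: field_simps power2_eq_square)
  finally show ?thesis unfolding sn_def cs_def .
qed

text \<open>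
The local frequency without the contribution \<open>\<kappa> * exp u\<close> of the potential. That term would spoil the explicit
antiderivative \<open>wkb_phase\<close>, and its total effect on the phase is bounded.
\<close>

definition wkb_speed :: "real \<Rightarrow> real \<Rightarrow> real" where
  "wkb_speed T u = sqrt (T\<^sup>2 - exp (2 * u) / 4)"

definition wkb_phase :: "real \<Rightarrow> real \<Rightarrow> real" where
  "wkb_phase T u = wkb_speed T u - T * ln (2 * (T + wkb_speed T u)) + T * u"

lemma wkb_speed_deriv:
  assumes "exp (2 * u) / 4 < T\<^sup>2"
  shows "(wkb_speed T has_real_derivative - (exp (2 * u) / 4) / wkb_speed T u) (at u)"
  unfolding wkb_speed_def[abs_def] using assms by (auto intro!: derivative_eq_intros simp: field_simps)

lemma wkb_phase_deriv:
  assumes "exp (2 * u) / 4 < T\<^sup>2" "T > 0"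
  shows "(wkb_phase T has_real_derivative wkb_speed T u) (at u)"
proof -
  define S where "S = wkb_speed T u"
  have S: "S > 0" using assms by (simp add: S_def wkb_speed_def)
  have E: "exp (2 * u) / 4 = T\<^sup>2 - S\<^sup>2" using assms by (simp add: S_def wkb_speed_def)
  define S1 where "S1 = - (T\<^sup>2 - S\<^sup>2) / S"
  have d: "(wkb_speed T has_real_derivative S1) (at u)"
    using wkb_speed_deriv[OF assms(1)] unfolding S1_def E S_def[symmetric] by simp
  have "((\<lambda>u. ln (2 * (T + wkb_speed T u))) has_real_derivative (2 * S1) / (2 * (T + S))) (at u)"
    using assms(2) S by (auto intro!: derivative_eq_intros d simp: S_def[symmetric])
  then have "(wkb_phase T has_real_derivative S1 - T * ((2 * S1) / (2 * (T + S))) + T * 1) (at u)"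
    unfolding wkb_phase_def[abs_def] by (intro DERIV_add DERIV_diff DERIV_cmult d DERIV_ident)
  also have "S1 - T * ((2 * S1) / (2 * (T + S))) + T * 1 = S"
  proof -
    have S1: "S1 = (- (T - S) / S) * (T + S)"
      using S unfolding S1_def by (simp add: field_simps power2_eq_square)
    have "T + S \<noteq> 0" using assms(2) S by linarith
    moreover have "(2 * (x * y)) / (2 * y) = x" if "y \<noteq> 0" for x y :: real using that by simp
    ultimately have e: "(2 * S1) / (2 * (T + S)) = - (T - S) / S" unfolding S1 by blast
    show ?thesis unfolding e unfolding S1_def using S by (simp add: field_simps power2_eq_square)
  qed
  finally show ?thesis by (simp add: S_def)
qed

lemma half_sin_cos: "\<bar>sin x * cos x\<bar> \<le> 1/2" for x :: real
  using sum_squares_bound[of "\<bar>sin x\<bar>" "\<bar>cos x\<bar>"] sin_cos_squared_add[of x]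
  by (simp add: abs_mult)

text \<open>
Pruefer's equation reads \<open>\<theta>' = S + (\<kappa> e\<^sup>u / S) sin\<^sup>2 \<theta> - G S sin \<theta> cos \<theta>\<close> with \<open>G = E / S\<^sup>3\<close>,
\<open>E = exp (2 * u) / 4\<close>. The last term is not absolutely integrable with a bound independent of \<open>T\<close> up to the
turning point, but it oscillates: subtracting \<open>(G / 4) cos (2 \<theta>)\<close> from \<open>\<theta>\<close> replaces it by terms controlled by
\<open>G'\<close>. Since \<open>G\<close> increases and is at most \<open>1\<close> as long as \<open>S\<^sup>3 \<ge> T\<^sup>2\<close>, they contribute \<open>O(1)\<close>. The middle term
is bounded by \<open>2 |\<kappa>|\<close> times the derivative of \<open>arcsin (e\<^sup>u / (2 T))\<close>.
\<close>

lemma wkb_region_estimate: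
  fixes \<theta> :: "real \<Rightarrow> real"
  assumes T: "T > 0" and ab: "a \<le> b"
    and S: "\<And>u. u \<le> b \<Longrightarrow> exp (2 * u) / 4 < T\<^sup>2" "T\<^sup>2 \<le> wkb_speed T b ^ 3"
    and c: "continuous_on {a..b} \<theta>"
    and d: "\<And>u. a < u \<Longrightarrow> u < b \<Longrightarrow> (\<theta> has_real_derivative
       wkb_speed T u * (cos (\<theta> u))\<^sup>2 + ((wkb_speed T u)\<^sup>2 + \<kappa> * exp u) / wkb_speed T u * (sin (\<theta> u))\<^sup>2
        + (- (exp (2 * u) / 4) / wkb_speed T u) / wkb_speed T u * (sin (\<theta> u) * cos (\<theta> u))) (at u)"
  shows "\<bar>\<theta> b - \<theta> a - (wkb_phase T b - wkb_phase T a)\<bar> \<le> 6 * \<bar>\<kappa>\<bar> + 3/2"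
proof -
  define E where "E u = exp (2 * u) / 4" for u :: real
  define \<sigma> where "\<sigma> = wkb_speed T"
  define G where "G u = E u / \<sigma> u ^ 3" for u
  define G' where "G' u = 2 * E u / \<sigma> u ^ 3 + 3 * (E u)\<^sup>2 / \<sigma> u ^ 5" for u
  define A where "A u = arcsin (exp u / (2 * T))" for u
  define \<theta>' where "\<theta>' u = \<sigma> u + (\<kappa> * exp u / \<sigma> u) * (sin (\<theta> u))\<^sup>2 - G u * \<sigma> u * (sin (\<theta> u) * cos (\<theta> u))" for u
  have \<sigma>0: "\<sigma> u > 0" if "u \<le> b" for u using S(1)[OF that] by (simp add: \<sigma>_def wkb_speed_def)
  have E2: "E u = T\<^sup>2 - (\<sigma> u)\<^sup>2" if "u \<le> b" for u
    using S(1)[OF that] by (simp add: E_def \<sigma>_def wkb_speed_def)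
  have E0: "E u > 0" for u by (simp add: E_def)
  have Ed: "(E has_real_derivative 2 * E u) (at u)" for u
    unfolding E_def by (auto intro!: derivative_eq_intros)
  have \<sigma>d: "(\<sigma> has_real_derivative - E u / \<sigma> u) (at u)" if "u \<le> b" for u
    using wkb_speed_deriv[OF S(1)[OF that]] by (simp add: \<sigma>_def E_def)
  have Gd: "(G has_real_derivative G' u) (at u)" if "u \<le> b" for u
    unfolding G_def G'_def using \<sigma>0[OF that]
    by (auto intro!: derivative_eq_intros Ed \<sigma>d[OF that] simp: field_simps power2_eq_square eval_nat_numeral)
  have Ad: "(A has_real_derivative exp u / 2 / \<sigma> u) (at u)" if "u \<le> b" for u
  proof -
    let ?y = "exp u / (2 * T)"
    have sq: "\<sigma> u / T = sqrt (1 - ?y\<^sup>2)"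
    proof -
      have "1 - ?y\<^sup>2 = (T\<^sup>2 - exp (2 * u) / 4) / T\<^sup>2"
        using T by (simp add: field_simps power2_eq_square exp_add[symmetric])
      then show ?thesis using T by (simp add: \<sigma>_def wkb_speed_def real_sqrt_divide)
    qed
    have "?y\<^sup>2 < 1"
    proof -
      have "sqrt (1 - ?y\<^sup>2) > 0" using sq \<sigma>0[OF that] T by (metis divide_pos_pos)
      then show ?thesis by simp
    qed
    then have y1: "?y < 1" using abs_square_less_1[of ?y] T by simp
    have ym: "-1 < ?y" using T by (meson divide_pos_pos exp_gt_zero less_trans mult_pos_pos neg_less_0_iff_less zero_less_numeral zero_less_one)
    have "(A has_real_derivative inverse (sqrt (1 - ?y\<^sup>2)) * (exp u / (2 * T))) (at u)"
      unfolding A_def by (rule DERIV_chain2[where f = arcsin and g = "\<lambda>u. exp u / (2 * T)", OF DERIV_arcsin[OF ym y1]]) (use T in \<open>auto intro!: derivative_eq_intros\<close>)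
    also have "inverse (sqrt (1 - ?y\<^sup>2)) * (exp u / (2 * T)) = exp u / 2 / \<sigma> u"
      unfolding sq[symmetric] using T \<sigma>0[OF that] by (simp add: field_simps)
    finally show ?thesis .
  qed
  have \<theta>d: "(\<theta> has_real_derivative \<theta>' u) (at u)" if "a < u" "u < b" for u
  proof -
    have s: "\<sigma> u > 0" using \<sigma>0 that by simp
    have "\<sigma> u * (cos (\<theta> u))\<^sup>2 + ((\<sigma> u)\<^sup>2 + \<kappa> * exp u) / \<sigma> u * (sin (\<theta> u))\<^sup>2
        + (- E u / \<sigma> u) / \<sigma> u * (sin (\<theta> u) * cos (\<theta> u))
      = \<sigma> u * ((sin (\<theta> u))\<^sup>2 + (cos (\<theta> u))\<^sup>2) + (\<kappa> * exp u / \<sigma> u) * (sin (\<theta> u))\<^sup>2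
        - G u * \<sigma> u * (sin (\<theta> u) * cos (\<theta> u))"
    proof -
      have "w * y\<^sup>2 + (w\<^sup>2 + k) / w * x\<^sup>2 + (- e / w) / w * (x * y) = w * (x\<^sup>2 + y\<^sup>2) + k / w * x\<^sup>2 - e / w ^ 3 * w * (x * y)"
        if "w > 0" for w k e x y :: real
        using that by (simp add: field_simps power2_eq_square eval_nat_numeral)
      from this[OF s] show ?thesis unfolding G_def .
    qed
    then have "\<sigma> u * (cos (\<theta> u))\<^sup>2 + ((\<sigma> u)\<^sup>2 + \<kappa> * exp u) / \<sigma> u * (sin (\<theta> u))\<^sup>2
        + (- E u / \<sigma> u) / \<sigma> u * (sin (\<theta> u) * cos (\<theta> u)) = \<theta>' u"
      by (simp add: \<theta>'_def)
    then show ?thesis using d[OF that] unfolding \<sigma>_def E_def by simp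
  qed
  have G'0: "G' u \<ge> 0" if "u \<le> b" for u
    unfolding G'_def using \<sigma>0[OF that] E0[of u] by (intro add_nonneg_nonneg divide_nonneg_nonneg) auto
  have G0: "0 \<le> G u" if "u \<le> b" for u unfolding G_def using \<sigma>0[OF that] E0[of u] by simp
  have "G b \<le> 1"
  proof -
    have "E b \<le> \<sigma> b ^ 3" using E2[of b] S(2) by (simp add: \<sigma>_def[symmetric]) (smt (verit) zero_le_power2)
    then show ?thesis using \<sigma>0[of b] by (simp add: G_def)
  qed
  moreover have "G u \<le> G b" if "u \<le> b" for u
    by (rule DERIV_nonneg_imp_nondecreasing[OF that]) (use Gd G'0 in blast)
  ultimately have G1: "G u \<le> 1" if "u \<le> b" for u using that by (meson order_trans)
  \<comment> \<open>\<open>f\<close> is the corrected phase minus the main term, \<open>R\<close> the function that controls its variation.\<close>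
  define f where "f u = \<theta> u - G u / 4 * cos (2 * \<theta> u) - wkb_phase T u" for u
  define R where "R u = 3 * \<bar>\<kappa>\<bar> * A u + G u" for u
  have cont: "continuous_on {a..b} G" "continuous_on {a..b} A" "continuous_on {a..b} (wkb_phase T)"
    using DERIV_isCont[OF Gd] DERIV_isCont[OF Ad] DERIV_isCont[OF wkb_phase_deriv[OF S(1) T]]
    by (auto intro!: continuous_at_imp_continuous_on)
  have "\<bar>f b - f a\<bar> \<le> R b - R a"
  proof (rule increment_bound[OF ab])
    show "continuous_on {a..b} f" unfolding f_def by (intro continuous_intros c cont) auto
    show "continuous_on {a..b} R" unfolding R_def by (intro continuous_intros cont)
    fix u assume u: "a < u" "u < b"
    then have ub: "u \<le> b" by simp
    define sn cs where "sn = sin (\<theta> u)" and "cs = cos (\<theta> u)"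
    have s: "\<sigma> u > 0" by (rule \<sigma>0[OF ub])
    have cs2: "cos (2 * \<theta> u) = cs\<^sup>2 - sn\<^sup>2" and sn2: "sin (2 * \<theta> u) = 2 * (sn * cs)"
      by (simp_all add: cos_double sin_double sn_def cs_def)
    define f' where "f' = (\<kappa> * exp u / \<sigma> u) * sn\<^sup>2 * (1 + G u * (sn * cs)) - (G u)\<^sup>2 * \<sigma> u * (sn * cs)\<^sup>2 - G' u / 4 * cos (2 * \<theta> u)"
    define R' where "R' = 3 * \<bar>\<kappa>\<bar> * (exp u / 2 / \<sigma> u) + G' u"
    have "(f has_real_derivative \<theta>' u - (G' u / 4 * cos (2 * \<theta> u) + (- sin (2 * \<theta> u) * (2 * \<theta>' u)) * (G u / 4)) - \<sigma> u) (at u)"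
    proof -
      have "((\<lambda>u. cos (2 * \<theta> u)) has_real_derivative - sin (2 * \<theta> u) * (2 * \<theta>' u)) (at u)"
        by (auto intro!: derivative_eq_intros \<theta>d u)
      then show ?thesis unfolding f_def
        using wkb_phase_deriv[OF S(1)[OF ub] T]
        by (intro DERIV_diff DERIV_mult DERIV_cdivide Gd ub \<theta>d u) (simp_all add: \<sigma>_def)
    qed
    also have "\<theta>' u - (G' u / 4 * cos (2 * \<theta> u) + (- sin (2 * \<theta> u) * (2 * \<theta>' u)) * (G u / 4)) - \<sigma> u = f'"
      unfolding sn2 f'_def \<theta>'_def sn_def[symmetric] cs_def[symmetric]
      by (simp add: algebra_simps power2_eq_square add_divide_distrib)
    finally have fd: "(f has_real_derivative f') (at u)" .
    have Rd: "(R has_real_derivative R') (at u)"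
      unfolding R_def R'_def by (intro DERIV_add DERIV_cmult Ad Gd ub)
    have sc: "\<bar>sn * cs\<bar> \<le> 1/2" unfolding sn_def cs_def by (rule half_sin_cos)
    have "\<bar>(\<kappa> * exp u / \<sigma> u) * sn\<^sup>2 * (1 + G u * (sn * cs))\<bar> \<le> (\<bar>\<kappa>\<bar> * exp u / \<sigma> u) * 1 * (3 / 2)"
    proof -
      have "\<bar>G u * (sn * cs)\<bar> \<le> 1 * (1/2)"
        unfolding abs_mult[of "G u"] using G0[OF ub] G1[OF ub] sc by (intro mult_mono) auto
      then have "\<bar>1 + G u * (sn * cs)\<bar> \<le> 3/2" by linarith
      moreover have "\<bar>sn\<^sup>2\<bar> \<le> 1" by (simp add: sn_def power_le_one abs_square_le_1)
      moreover have "\<bar>\<kappa> * exp u / \<sigma> u\<bar> = \<bar>\<kappa>\<bar> * exp u / \<sigma> u" using s by (simp add: abs_mult)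
      ultimately show ?thesis unfolding abs_mult using s by (intro mult_mono) (auto simp: abs_mult)
    qed
    moreover have "\<bar>(G u)\<^sup>2 * \<sigma> u * (sn * cs)\<^sup>2\<bar> \<le> G' u / 12"
    proof -
      have "(sn * cs)\<^sup>2 \<le> (1/2)\<^sup>2" using sc by (simp add: abs_le_square_iff[symmetric])
      then have "(G u)\<^sup>2 * \<sigma> u * (sn * cs)\<^sup>2 \<le> (G u)\<^sup>2 * \<sigma> u * (1/2)\<^sup>2"
        using s by (intro mult_left_mono) auto
      also have "(G u)\<^sup>2 * \<sigma> u * (1/2)\<^sup>2 = (3 * (E u)\<^sup>2 / \<sigma> u ^ 5) / 12"
        unfolding G_def using s by (simp add: field_simps eval_nat_numeral)
      also have "\<dots> \<le> G' u / 12" unfolding G'_def using s E0[of u] by (intro divide_right_mono) auto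
      finally show ?thesis using s by (simp add: abs_mult)
    qed
    moreover have "\<bar>G' u / 4 * cos (2 * \<theta> u)\<bar> \<le> G' u / 4 * 1"
      unfolding abs_mult using G'0[OF ub] by (intro mult_mono) auto
    moreover have "(\<bar>\<kappa>\<bar> * exp u / \<sigma> u) * 1 * (3 / 2) = 3 * \<bar>\<kappa>\<bar> * (exp u / 2 / \<sigma> u)" by simp
    ultimately have "\<bar>f'\<bar> \<le> R'" using G'0[OF ub] unfolding f'_def R'_def by linarith
    with fd Rd show "\<exists>f' R'. (f has_real_derivative f') (at u) \<and> (R has_real_derivative R') (at u) \<and> \<bar>f'\<bar> \<le> R'"
      by blast
  qed
  moreover have "R b - R a \<le> 6 * \<bar>\<kappa>\<bar> + 1"
  proof -
    have "A b - A a \<le> pi / 2"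
    proof -
      have y: "0 \<le> exp u / (2 * T)" "exp u / (2 * T) \<le> 1" if "u \<le> b" for u
      proof -
        have "(exp u / (2 * T))\<^sup>2 \<le> 1"
          using S(1)[OF that] T by (simp add: power_divide divide_le_eq power2_eq_square exp_add[symmetric])
        then show "exp u / (2 * T) \<le> 1" using abs_square_le_1[of "exp u / (2 * T)"] T by simp
      qed (use T in simp)
      have "A b \<le> pi / 2" unfolding A_def using y[of b] by (intro arcsin_ubound) auto
      moreover have "A a \<ge> 0" unfolding A_def using y[of a] ab arcsin_le_arcsin[of 0 "exp a / (2 * T)"] by simp
      ultimately show ?thesis by simp
    qed
    then have "3 * \<bar>\<kappa>\<bar> * (A b - A a) \<le> 3 * \<bar>\<kappa>\<bar> * 2"
      using pi_half_less_two by (intro mult_left_mono) auto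
    then show ?thesis using G1[of b] G0[of a] ab by (simp add: R_def algebra_simps)
  qed
  moreover have "\<bar>G u / 4 * cos (2 * \<theta> u)\<bar> \<le> 1/4" if "u \<le> b" for u
  proof -
    have "\<bar>G u / 4 * cos (2 * \<theta> u)\<bar> \<le> 1/4 * 1"
      unfolding abs_mult using G0[OF that] G1[OF that] by (intro mult_mono) auto
    then show ?thesis by simp
  qed
  note this[of a] this[of b]
  ultimately show ?thesis using ab unfolding f_def by (simp add: abs_le_iff)
qed

section \<open>The turning point and the total phase\<close>

lemma wave_nonzero: "Complex (wave' \<kappa> C u) (wave \<kappa> C u) \<noteq> 0"
proof
  assume "Complex (wave' \<kappa> C u) (wave \<kappa> C u) = 0"
  then have z: "wave' \<kappa> C u = 0" "wave \<kappa> C u = 0" by (simp_all add: complex_eq_iff)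
  have "amp \<kappa> u \<noteq> 0" using amp_pos[of \<kappa> u] by linarith
  with z have "profile \<kappa> C u = 0" "momentum \<kappa> C u = 0" by (auto simp: wave_def wave'_def)
  then show False using momentum_profile_nonzero[of \<kappa> C u] by (simp add: complex_eq_iff)
qed

text \<open>
The phases of \<open>(g', g)\<close> and \<open>(g', S g)\<close> differ by less than \<open>\<pi>\<close>, and the scale \<open>S\<close> can be adapted to the
interval.
\<close>

lemma rescaled_lift:
  fixes L :: "real \<Rightarrow> complex"
  assumes L: "continuous_on UNIV L" "\<And>u. exp (L u) = Complex (wave' \<kappa> C u) (wave \<kappa> C u)"
    and S: "continuous_on A S" "\<And>u. u \<in> A \<Longrightarrow> S u > 0"
  obtains L' where "continuous_on A L'" "\<And>u. u \<in> A \<Longrightarrow> exp (L' u) = Complex (wave' \<kappa> C u) (S u * wave \<kappa> C u)"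
    "\<And>u. u \<in> A \<Longrightarrow> \<bar>Im (L' u) - Im (L u)\<bar> < pi"
proof -
  have LA: "continuous_on A L" using L(1) continuous_on_subset by blast
  have w: "continuous_on A (\<lambda>u. Complex (wave' \<kappa> C u) (S u * wave \<kappa> C u))"
    unfolding Complex_eq
    by (intro continuous_intros S continuous_at_imp_continuous_on ballI DERIV_isCont[OF wave_deriv] DERIV_isCont[OF wave'_deriv])
  have nn: "Complex (wave' \<kappa> C u) (S u * wave \<kappa> C u) / Complex (wave' \<kappa> C u) (wave \<kappa> C u) \<notin> \<real>\<^sub>\<le>\<^sub>0" if "u \<in> A" for u
    using wave_nonzero[of \<kappa> C u] S(2)[OF that]
    by (intro shear_not_nonpos[where s = "S u" and r = 1]) auto
  show ?thesis
    by (rule relift[OF LA L(2) w nn]) (use that in blast)+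
qed

lemma interior_lift:
  fixes L F :: "real \<Rightarrow> complex"
  assumes "continuous_on {a..b} L" "\<And>u. u \<in> {a..b} \<Longrightarrow> exp (L u) = F u" "a < u" "u < b"
  shows "isCont L u" "\<forall>\<^sub>F t in nhds u. exp (L t) = F t"
proof -
  have u: "u \<in> {a<..<b}" using assms by simp
  have "continuous_on {a<..<b} L" by (rule continuous_on_subset[OF assms(1)]) auto
  then show "isCont L u" using u continuous_on_eq_continuous_at[OF open_greaterThanLessThan] by blast
  show "\<forall>\<^sub>F t in nhds u. exp (L t) = F t"
    unfolding eventually_nhds using u assms(2) by (intro exI[of _ "{a<..<b}"]) auto
qed

text \<open>
With \<open>T = t ^ 3\<close>, the half-line is cut at \<open>u\<^sub>1\<close> and \<open>u\<^sub>2\<close>, on either side of the turning point. Up to \<open>u\<^sub>1\<close>,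
where the local frequency has dropped to \<open>t\<^sup>2 = T powr (2/3)\<close>, the WKB estimate applies. Between \<open>u\<^sub>1\<close> and
\<open>u\<^sub>2\<close> the squared frequency is \<open>O(t ^ 4)\<close>, and with the constant scale \<open>t\<^sup>2\<close> the phase speed is \<open>O(t\<^sup>2)\<close> on
an interval of length \<open>O(1 / t\<^sup>2)\<close>. Beyond \<open>u\<^sub>2\<close> the region is classically forbidden, and \<open>g\<close> has no zeros.
The term \<open>wkb_phase T u\<^sub>0\<close> enters with a plus sign because the phase accumulates
\<open>wkb_phase T u\<^sub>1 - wkb_phase T u\<^sub>0\<close>, and the first of these is \<open>O(1)\<close>.
\<close>

lemma phase_estimate:
  fixes \<kappa> t u\<^sub>0 :: real
  defines "T \<equiv> t ^ 3" and "k \<equiv> \<bar>\<kappa>\<bar>"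
  defines "C \<equiv> (\<kappa> - 1/2)\<^sup>2 + T\<^sup>2"
  defines "u\<^sub>1 \<equiv> ln (2 * t\<^sup>2 * sqrt (t\<^sup>2 - 1))" and "u\<^sub>2 \<equiv> ln (2 * t ^ 3 + 4 * k)"
  assumes t: "t \<ge> 2" and u01: "u\<^sub>0 \<le> u\<^sub>1"
    and turn: "(t\<^sup>2 + (t ^ 4 + 6 * k * t ^ 3 + 8 * k\<^sup>2) / t\<^sup>2) * (u\<^sub>2 - u\<^sub>1) \<le> 3"
    and F1: "\<bar>wkb_phase T u\<^sub>1\<bar> \<le> 1"
    and L: "continuous_on UNIV L" "\<And>u. exp (L u) = Complex (wave' \<kappa> C u) (wave \<kappa> C u)"
    and U: "U \<ge> u\<^sub>2"
  shows "\<bar>Im (L U) - Im (L u\<^sub>0) + wkb_phase T u\<^sub>0\<bar> \<le> 6 * k + 6 + 5 * pi"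
proof -
  have T: "T > 0" using t by (simp add: T_def)
  have T2: "T\<^sup>2 = t ^ 6" by (simp add: T_def flip: power_mult)
  have k: "k \<ge> 0" by (simp add: k_def)
  have t1: "t\<^sup>2 - 1 > 0" using t power_mono[of 2 t 2] by simp
  have q: "wavenumber \<kappa> C u = T\<^sup>2 - exp (2 * u) / 4 + \<kappa> * exp u" for u
    by (simp add: wavenumber_def C_def)
  have x1: "exp u\<^sub>1 = 2 * t\<^sup>2 * sqrt (t\<^sup>2 - 1)" using t t1 by (simp add: u\<^sub>1_def)
  have x2: "exp u\<^sub>2 = 2 * t ^ 3 + 4 * k" using t k by (simp add: u\<^sub>2_def add_pos_nonneg)
  have sq: "exp (2 * u) = (exp u)\<^sup>2" for u :: real by (simp add: exp_double)
  have E1: "exp (2 * u\<^sub>1) / 4 = t ^ 6 - t ^ 4"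
  proof -
    have "exp (2 * u\<^sub>1) = 4 * (t\<^sup>2)\<^sup>2 * (sqrt (t\<^sup>2 - 1))\<^sup>2" unfolding sq x1 by (simp add: power_mult_distrib)
    also have "(sqrt (t\<^sup>2 - 1))\<^sup>2 = t\<^sup>2 - 1" using t1 by simp
    finally show ?thesis by (simp add: algebra_simps eval_nat_numeral)
  qed
  have Emono: "exp (2 * u) / 4 \<le> exp (2 * v) / 4" if "u \<le> v" for u v :: real using that by simp
  have tp: "t ^ 4 > 0" using t by simp
  have S1: "exp (2 * u) / 4 < T\<^sup>2" if "u \<le> u\<^sub>1" for u
    using Emono[OF that] tp unfolding E1 T2 by linarith
  \<comment> \<open>Thus \<open>S\<^sup>3 = T\<^sup>2\<close> at \<open>u\<^sub>1\<close>, the last point up to which the WKB estimate holds.\<close>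
  have sp1: "wkb_speed T u\<^sub>1 = t\<^sup>2"
  proof -
    have "T\<^sup>2 - exp (2 * u\<^sub>1) / 4 = (t\<^sup>2)\<^sup>2" unfolding E1 T2 by (simp flip: power_mult)
    then show ?thesis by (simp only: wkb_speed_def real_sqrt_abs abs_power2)
  qed
  have u12: "u\<^sub>1 \<le> u\<^sub>2"
  proof -
    have "sqrt (t\<^sup>2 - 1) \<le> t" using t by (intro real_le_lsqrt) auto
    then have "2 * t\<^sup>2 * sqrt (t\<^sup>2 - 1) \<le> 2 * t\<^sup>2 * t" using t by (intro mult_left_mono) auto
    then have "exp u\<^sub>1 \<le> exp u\<^sub>2" unfolding x1 x2 using k by (simp add: eval_nat_numeral)
    then show ?thesis by simp
  qed
  have wd: "(wave \<kappa> C has_real_derivative wave' \<kappa> C u) (at u)"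
    "(wave' \<kappa> C has_real_derivative - (wavenumber \<kappa> C u) * wave \<kappa> C u) (at u)" for u
    using wave_deriv wave'_deriv by auto
  have spos: "wkb_speed T u > 0" if "u \<le> u\<^sub>1" for u using S1[OF that] by (simp add: wkb_speed_def)
  have "continuous_on {u\<^sub>0..u\<^sub>1} (wkb_speed T)"
    by (intro continuous_at_imp_continuous_on ballI DERIV_isCont[OF wkb_speed_deriv] S1) simp
  from rescaled_lift[OF L this] obtain L1 where L1: "continuous_on {u\<^sub>0..u\<^sub>1} L1"
    "\<And>u. u \<in> {u\<^sub>0..u\<^sub>1} \<Longrightarrow> exp (L1 u) = Complex (wave' \<kappa> C u) (wkb_speed T u * wave \<kappa> C u)"
    "\<And>u. u \<in> {u\<^sub>0..u\<^sub>1} \<Longrightarrow> \<bar>Im (L1 u) - Im (L u)\<bar> < pi"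
    using spos by (metis atLeastAtMost_iff)
  have part1: "\<bar>Im (L1 u\<^sub>1) - Im (L1 u\<^sub>0) - (wkb_phase T u\<^sub>1 - wkb_phase T u\<^sub>0)\<bar> \<le> 6 * \<bar>\<kappa>\<bar> + 3/2"
  proof (rule wkb_region_estimate[OF T u01 S1, where \<theta> = "\<lambda>u. Im (L1 u)" and \<kappa> = \<kappa>])
    show "T\<^sup>2 \<le> wkb_speed T u\<^sub>1 ^ 3" unfolding sp1 T2 by (simp flip: power_mult)
    show "continuous_on {u\<^sub>0..u\<^sub>1} (\<lambda>u. Im (L1 u))" by (intro continuous_intros L1)
    fix u assume u: "u\<^sub>0 < u" "u < u\<^sub>1"
    have ub: "u \<le> u\<^sub>1" using u by simp
    have "wavenumber \<kappa> C u = (wkb_speed T u)\<^sup>2 + \<kappa> * exp u"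
      using S1[OF ub] by (simp add: q wkb_speed_def)
    with pruefer_deriv[OF interior_lift[OF L1(1,2) u] wd wkb_speed_deriv[OF S1[OF ub]] spos[OF ub]]
    show "((\<lambda>u. Im (L1 u)) has_real_derivative
       wkb_speed T u * (cos (Im (L1 u)))\<^sup>2 + ((wkb_speed T u)\<^sup>2 + \<kappa> * exp u) / wkb_speed T u * (sin (Im (L1 u)))\<^sup>2
        + (- (exp (2 * u) / 4) / wkb_speed T u) / wkb_speed T u * (sin (Im (L1 u)) * cos (Im (L1 u)))) (at u)"
      by simp
  qed auto
  define s where "s = t\<^sup>2"
  have s: "s > 0" using t by (simp add: s_def)
  from rescaled_lift[OF L continuous_on_const[of "{u\<^sub>1..u\<^sub>2}" s]] s
  obtain L2 where L2: "continuous_on {u\<^sub>1..u\<^sub>2} L2"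
    "\<And>u. u \<in> {u\<^sub>1..u\<^sub>2} \<Longrightarrow> exp (L2 u) = Complex (wave' \<kappa> C u) (s * wave \<kappa> C u)"
    "\<And>u. u \<in> {u\<^sub>1..u\<^sub>2} \<Longrightarrow> \<bar>Im (L2 u) - Im (L u)\<bar> < pi"
    by metis
  \<comment> \<open>\<open>B\<close> bounds the squared frequency on \<open>[u\<^sub>1, u\<^sub>2]\<close>.\<close>
  define B where "B = t ^ 4 + 6 * k * t ^ 3 + 8 * k\<^sup>2"
  have part2: "\<bar>Im (L2 u\<^sub>2) - Im (L2 u\<^sub>1)\<bar> \<le> (s + B / s) * u\<^sub>2 - (s + B / s) * u\<^sub>1"
  proof (rule increment_bound[OF u12, of "\<lambda>u. Im (L2 u)" "\<lambda>u. (s + B / s) * u"])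
    show "continuous_on {u\<^sub>1..u\<^sub>2} (\<lambda>u. Im (L2 u))" by (intro continuous_intros L2)
    show "continuous_on {u\<^sub>1..u\<^sub>2} (\<lambda>u. (s + B / s) * u)" by (intro continuous_intros)
    fix u assume u: "u\<^sub>1 < u" "u < u\<^sub>2"
    define w where "w = wavenumber \<kappa> C u"
    have eu: "exp u \<le> 2 * t ^ 3 + 4 * k" using u x2 by (metis exp_le_cancel_iff less_imp_le)
    have ku: "\<bar>\<kappa> * exp u\<bar> \<le> k * (2 * t ^ 3 + 4 * k)"
      unfolding abs_mult k_def[symmetric] using eu k by (intro mult_left_mono) auto
    have "exp (2 * u) / 4 \<ge> t ^ 6 - t ^ 4" using Emono[of u\<^sub>1 u] u E1 by simp
    moreover have "exp (2 * u) / 4 \<le> (2 * t ^ 3 + 4 * k)\<^sup>2 / 4"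
      unfolding sq using eu by (intro divide_right_mono power_mono) auto
    moreover have "(2 * t ^ 3 + 4 * k)\<^sup>2 / 4 = t ^ 6 + 4 * (k * t ^ 3) + 4 * k\<^sup>2"
      by (simp add: power2_sum algebra_simps flip: power_mult)
    moreover have "k * (2 * t ^ 3 + 4 * k) = 2 * (k * t ^ 3) + 4 * k\<^sup>2" by (simp add: algebra_simps power2_eq_square)
    moreover have "k * t ^ 3 \<ge> 0" using k t by simp
    moreover have "B = t ^ 4 + 6 * (k * t ^ 3) + 8 * k\<^sup>2" by (simp add: B_def)
    ultimately have wB: "\<bar>w\<bar> \<le> B" using ku tp unfolding w_def q T2 by linarith
    have "((\<lambda>u. Im (L2 u)) has_real_derivative s * (cos (Im (L2 u)))\<^sup>2 + w / s * (sin (Im (L2 u)))\<^sup>2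
       + 0 / s * (sin (Im (L2 u)) * cos (Im (L2 u)))) (at u)"
      unfolding w_def by (rule pruefer_deriv[OF interior_lift[OF L2(1,2) u] wd DERIV_const s])
    moreover have "\<bar>s * (cos (Im (L2 u)))\<^sup>2 + w / s * (sin (Im (L2 u)))\<^sup>2 + 0 / s * (sin (Im (L2 u)) * cos (Im (L2 u)))\<bar> \<le> s + B / s"
    proof -
      have "\<bar>s * (cos (Im (L2 u)))\<^sup>2\<bar> \<le> s * 1"
        unfolding abs_mult using s by (intro mult_mono) (auto simp: abs_square_le_1)
      moreover have "\<bar>w / s * (sin (Im (L2 u)))\<^sup>2\<bar> \<le> B / s * 1"
        unfolding abs_mult using s wB by (intro mult_mono) (auto simp: abs_square_le_1 divide_right_mono)
      moreover have "0 / s * (sin (Im (L2 u)) * cos (Im (L2 u))) = 0" by simp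
      ultimately show ?thesis by linarith
    qed
    ultimately show "\<exists>f' R'. ((\<lambda>u. Im (L2 u)) has_real_derivative f') (at u) \<and>
       ((\<lambda>u. (s + B / s) * u) has_real_derivative R') (at u) \<and> \<bar>f'\<bar> \<le> R'"
      by (intro exI conjI) (assumption, rule DERIV_cmult[OF DERIV_ident], simp)
  qed
  have turn': "(s + B / s) * u\<^sub>2 - (s + B / s) * u\<^sub>1 \<le> 3"
    using turn unfolding s_def B_def by (simp add: right_diff_distrib)
  have part3: "\<bar>Im (L U) - Im (L u\<^sub>2)\<bar> < pi"
  proof (rule arg_change_less_pi[OF U])
    show "continuous_on {u\<^sub>2..U} (\<lambda>u. Im (L u))"
      by (intro continuous_intros continuous_on_subset[OF L(1)]) auto
    fix u assume u: "u\<^sub>2 \<le> u"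
    have "profile \<kappa> C u \<noteq> 0"
    proof (rule profile_nonzero_if_wavenumber_nonpos)
      fix v assume "u \<le> v"
      then have "exp v \<ge> 2 * t ^ 3 + 4 * k" using u x2 by (metis exp_le_cancel_iff order_trans)
      then have y: "exp v / 2 \<ge> T + 2 * k" by (simp add: T_def)
      have "(T + 2 * k) * T \<le> (exp v / 2) * (exp v / 2 - 2 * k)"
        using y k T by (intro mult_mono) auto
      moreover have "T\<^sup>2 \<le> (T + 2 * k) * T" using k T by (simp add: algebra_simps power2_eq_square)
      moreover have "(exp v / 2) * (exp v / 2 - 2 * k) = exp (2 * v) / 4 - k * exp v"
        unfolding sq by (simp add: algebra_simps power2_eq_square)
      moreover have "\<kappa> * exp v \<le> k * exp v" by (simp add: k_def)
      ultimately show "wavenumber \<kappa> C v \<le> 0" unfolding q by linarith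
    qed
    then have "wave \<kappa> C u \<noteq> 0" using less_imp_neq[OF amp_pos[of \<kappa> u]] by (auto simp: wave_def)
    moreover have "wave \<kappa> C u = exp (Re (L u)) * sin (Im (L u))"
      using L(2)[of u] by (simp add: complex_eq_iff Im_exp)
    ultimately show "sin (Im (L u)) \<noteq> 0" by auto
  qed
  have in1: "u\<^sub>0 \<in> {u\<^sub>0..u\<^sub>1}" "u\<^sub>1 \<in> {u\<^sub>0..u\<^sub>1}" and in2: "u\<^sub>1 \<in> {u\<^sub>1..u\<^sub>2}" "u\<^sub>2 \<in> {u\<^sub>1..u\<^sub>2}"
    using u01 u12 by auto
  show ?thesis
    using part1 part2 part3 turn' F1 L1(3)[OF in1(1)] L1(3)[OF in1(2)] L2(3)[OF in2(1)] L2(3)[OF in2(2)]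
    unfolding k_def by linarith
qed

text \<open>
What remains is calculus: the conditions of \<open>phase_estimate\<close> hold for large \<open>t\<close>, and \<open>- wkb_phase T u\<^sub>0\<close>
equals \<open>T ln T + (2 ln 2 - 1 - u\<^sub>0) T\<close> up to \<open>o(1)\<close>.
\<close>

lemma eigenvalue_count_asymptotics:
  fixes \<kappa> u\<^sub>0 :: real
  shows "\<exists>K. \<forall>\<^sub>F T in at_top. 
    \<bar>pi * real (card (eigenvalues \<kappa> u\<^sub>0 ((\<kappa> - 1/2)\<^sup>2 + T\<^sup>2))) - (T * ln T + (2 * ln 2 - 1 - u\<^sub>0) * T)\<bar> \<le> K"
proof -
  define k x where "k = \<bar>\<kappa>\<bar>" and "x = exp u\<^sub>0"
  have k: "k \<ge> 0" and x: "x > 0" by (auto simp: k_def x_def)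
  let ?u1 = "\<lambda>t. ln (2 * t\<^sup>2 * sqrt (t\<^sup>2 - 1)) :: real" and ?u2 = "\<lambda>t. ln (2 * t ^ 3 + 4 * k)"
  have e1: "\<forall>\<^sub>F t in at_top. (t\<^sup>2 + (t ^ 4 + 6 * k * t ^ 3 + 8 * k\<^sup>2) / t\<^sup>2) * (?u2 t - ?u1 t) \<le> 3"
  proof -
    have "((\<lambda>t. (t\<^sup>2 + (t ^ 4 + 6 * k * t ^ 3 + 8 * k\<^sup>2) / t\<^sup>2) * (?u2 t - ?u1 t)) \<longlongrightarrow> 1) at_top"
      by real_asymp
    from order_tendstoD(2)[OF this, of 3] show ?thesis by (auto elim: eventually_mono)
  qed
  have e2: "\<forall>\<^sub>F t in at_top. u\<^sub>0 \<le> ?u1 t" by real_asymp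
  have e3: "\<forall>\<^sub>F t in at_top. \<bar>wkb_phase (t ^ 3) (?u1 t)\<bar> \<le> 1"
  proof -
    have "((\<lambda>t::real. t\<^sup>2 - t ^ 3 * ln (2 * (t ^ 3 + t\<^sup>2)) + t ^ 3 * ?u1 t) \<longlongrightarrow> - 1/3) at_top" by real_asymp
    from tendstoD[OF this, of "1/3"]
    have "\<forall>\<^sub>F t in at_top. \<bar>t\<^sup>2 - t ^ 3 * ln (2 * (t ^ 3 + t\<^sup>2)) + t ^ 3 * ?u1 t\<bar> \<le> 1"
      by (rule eventually_mono) (simp, unfold dist_real_def, linarith)
    with eventually_ge_at_top[of 2] show ?thesis
    proof eventually_elim
      case (elim t)
      have t1: "t\<^sup>2 - 1 > 0" using elim power_mono[of 2 t 2] by simp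
      have "exp (2 * ?u1 t) = (exp (?u1 t))\<^sup>2" by (simp add: exp_double)
      also have "exp (?u1 t) = 2 * t\<^sup>2 * sqrt (t\<^sup>2 - 1)" using elim t1 by simp
      also have "(2 * t\<^sup>2 * sqrt (t\<^sup>2 - 1))\<^sup>2 = 4 * (t\<^sup>2)\<^sup>2 * (t\<^sup>2 - 1)" using t1 by (simp add: power_mult_distrib)
      finally have "(t ^ 3)\<^sup>2 - exp (2 * ?u1 t) / 4 = (t\<^sup>2)\<^sup>2" by (simp add: algebra_simps eval_nat_numeral)
      then have "wkb_speed (t ^ 3) (?u1 t) = t\<^sup>2" by (simp only: wkb_speed_def real_sqrt_abs abs_power2)
      then show ?case using elim by (simp add: wkb_phase_def)
    qed
  qed
  have e4: "\<forall>\<^sub>F T in at_top. \<bar>- wkb_phase T u\<^sub>0 - (T * ln T + (2 * ln 2 - 1 - u\<^sub>0) * T)\<bar> \<le> 1"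
  proof -
    let ?S = "\<lambda>T. sqrt (T\<^sup>2 - x\<^sup>2 / 4)"
    have "((\<lambda>T. T * ln ((T + ?S T) / (2 * T)) + (T - ?S T)) \<longlongrightarrow> 0) at_top"
      using x by real_asymp
    from tendstoD[OF this, of 1]
    have "\<forall>\<^sub>F T in at_top. \<bar>T * ln ((T + ?S T) / (2 * T)) + (T - ?S T)\<bar> < 1"
      by (simp add: dist_real_def)
    with eventually_ge_at_top[of x] show ?thesis
    proof eventually_elim
      case (elim T)
      have T: "T > 0" using x elim by simp
      have "x\<^sup>2 \<le> T\<^sup>2" using elim x by (intro power_mono) auto
      then have "T\<^sup>2 - x\<^sup>2 / 4 \<ge> 0" using zero_le_power2[of x] by linarith
      then have "?S T \<ge> 0" by simp
      then have "T + ?S T > 0" using T by linarith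
      then have pos: "(T + ?S T) / (2 * T) > 0" by (rule divide_pos_pos) (use T in simp)
      have ln4: "ln (4::real) = 2 * ln 2" using ln_realpow[of 2 2] by simp
      have lnm: "ln (r * (4 * T)) = ln r + (ln 4 + ln T)" if "r > 0" for r
        using that T by (simp add: ln_mult_pos)
      have "2 * (T + ?S T) = ((T + ?S T) / (2 * T)) * (4 * T)" using T by (simp add: field_simps)
      then have "ln (2 * (T + ?S T)) = ln (((T + ?S T) / (2 * T)) * (4 * T))" by (rule arg_cong)
      then have l: "ln (2 * (T + ?S T)) = ln ((T + ?S T) / (2 * T)) + (2 * ln 2 + ln T)"
        unfolding lnm[OF pos] ln4 .
      have sp: "wkb_speed T u\<^sub>0 = ?S T" by (simp add: wkb_speed_def x_def exp_double)
      have "- wkb_phase T u\<^sub>0 - (T * ln T + (2 * ln 2 - 1 - u\<^sub>0) * T)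
          = T * ln ((T + ?S T) / (2 * T)) + (T - ?S T)"
        unfolding wkb_phase_def sp l by (simp add: algebra_simps)
      then show ?case using elim by simp
    qed
  qed
  let ?P = "\<lambda>t::real. t \<ge> 2 \<and> u\<^sub>0 \<le> ?u1 t \<and> (t\<^sup>2 + (t ^ 4 + 6 * k * t ^ 3 + 8 * k\<^sup>2) / t\<^sup>2) * (?u2 t - ?u1 t) \<le> 3
     \<and> \<bar>wkb_phase (t ^ 3) (?u1 t)\<bar> \<le> 1"
  have "\<forall>\<^sub>F t in at_top. ?P t"
    using e1 e2 e3 eventually_ge_at_top[of 2] by eventually_elim auto
  moreover have "filterlim (\<lambda>T::real. T powr (1/3)) at_top at_top" by real_asymp
  ultimately have ev: "\<forall>\<^sub>F T in at_top. ?P (T powr (1/3))"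
    by (rule eventually_compose_filterlim)
  have "\<forall>\<^sub>F T in at_top. \<bar>pi * real (card (eigenvalues \<kappa> u\<^sub>0 ((\<kappa> - 1/2)\<^sup>2 + T\<^sup>2))) - (T * ln T + (2 * ln 2 - 1 - u\<^sub>0) * T)\<bar>
      \<le> 4 * pi + (6 * k + 6 + 5 * pi) + 1"
    using ev e4 eventually_gt_at_top[of 0]
  proof eventually_elim
    case (elim T)
    define t where "t = T powr (1/3)"
    have tT: "t ^ 3 = T" using elim by (simp add: t_def powr_power)
    define C where "C = (\<kappa> - 1/2)\<^sup>2 + T\<^sup>2"
    have C: "C \<ge> 0" by (simp add: C_def)
    obtain L where L: "continuous_on UNIV L" "\<And>u. exp (L u) = Complex (wave' \<kappa> C u) (wave \<kappa> C u)"
      and cnt: "\<forall>\<^sub>F U in at_top. \<bar>pi * real (card (eigenvalues \<kappa> u\<^sub>0 C)) - (Im (L U) - Im (L u\<^sub>0))\<bar> \<le> 4 * pi"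
      using eigenvalue_count_by_phase(2)[OF C, of \<kappa> u\<^sub>0] by blast
    have "\<forall>\<^sub>F U in at_top. U \<ge> ?u2 t \<and> \<bar>pi * real (card (eigenvalues \<kappa> u\<^sub>0 C)) - (Im (L U) - Im (L u\<^sub>0))\<bar> \<le> 4 * pi"
      using cnt eventually_ge_at_top by (rule eventually_conj[rotated])
    then obtain U where U: "U \<ge> ?u2 t" "\<bar>pi * real (card (eigenvalues \<kappa> u\<^sub>0 C)) - (Im (L U) - Im (L u\<^sub>0))\<bar> \<le> 4 * pi"
      using eventually_happens'[OF trivial_limit_at_top_linorder] by blast
    have "\<bar>Im (L U) - Im (L u\<^sub>0) + wkb_phase T u\<^sub>0\<bar> \<le> 6 * k + 6 + 5 * pi"
      using phase_estimate[of t u\<^sub>0 \<kappa> L U] elim(1) U(1) L unfolding t_def[symmetric] k_def[symmetric] tT C_def by blast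
    then show ?case using U(2) elim(2) unfolding C_def by linarith
  qed
  then show ?thesis by blast
qed

section \<open>Zeros in the plane of the index\<close>

text \<open>
For real \<open>c\<close> with \<open>h = 0\<close>, \<open>phase_derivative_positive\<close> reduces to \<open>- A * h' > 0\<close>, the prime being the
derivative in \<open>c\<close>.
\<close>

lemma profile_zero_simple:
  fixes c :: complex
  assumes "profile \<kappa> c u = 0" shows "deriv (\<lambda>c. profile \<kappa> c u) c \<noteq> 0"
proof -
  define r where "r = Re c"
  have c: "c = of_real r" using profile_zero_imp_real[OF assms] by (simp add: r_def complex_eq_iff)
  obtain h' A' where d: "((\<lambda>c. profile \<kappa> c u) has_real_derivative h') (at r)"
    "((\<lambda>c. momentum \<kappa> c u) has_real_derivative A') (at r)"
    using profile_param_deriv momentum_param_deriv by blast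
  obtain D where D: "((\<lambda>c. profile \<kappa> c u) has_field_derivative D) (at c)"
    using profile_param_deriv by blast
  have "D = of_real h'"
    by (rule complex_deriv_eq_real_deriv[OF D[unfolded c] d(1) profile_of_real])
  moreover have "profile \<kappa> r u = 0" using assms unfolding c profile_of_real by simp
  then have "h' \<noteq> 0" using phase_derivative_positive[OF d] by auto
  ultimately show ?thesis using DERIV_imp_deriv[OF D] by simp
qed

text \<open>
The substitution \<open>w \<mapsto> s - w\<^sup>2\<close> is locally injective away from \<open>0\<close> and doubles the order at \<open>0\<close>.
\<close>

lemma zorder_quadratic_substitution:
  fixes H :: "complex \<Rightarrow> complex"
  assumes H: "H holomorphic_on UNIV" and a: "a \<noteq> 0"
    and z: "H (s - \<mu>\<^sup>2) = 0" and d: "deriv H (s - \<mu>\<^sup>2) \<noteq> 0"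
  shows "zorder (\<lambda>w. a * H (s - w\<^sup>2)) \<mu> = (if \<mu> = 0 then 2 else 1)"
proof -
  let ?F = "\<lambda>w. a * H (s - w\<^sup>2)"
  have Hd: "(H has_field_derivative deriv H w) (at w)" for w
    using H by (simp add: holomorphic_derivI)
  have H'd: "(deriv H has_field_derivative deriv (deriv H) w) (at w)" for w
    using holomorphic_deriv[OF H open_UNIV] by (simp add: holomorphic_derivI)
  have Fd: "(?F has_field_derivative a * (deriv H (s - w\<^sup>2) * (- 2 * w))) (at w)" for w
    by (rule DERIV_cmult[OF DERIV_chain2[OF Hd]]) (auto intro!: derivative_eq_intros)
  then have dF: "deriv ?F = (\<lambda>w. a * (deriv H (s - w\<^sup>2) * (- 2 * w)))"
    by (intro ext DERIV_imp_deriv)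
  have Fh: "?F holomorphic_on UNIV"
    unfolding holomorphic_on_open[OF open_UNIV] using Fd by blast
  show ?thesis
  proof (cases "\<mu> = 0")
    case False
    have "zorder ?F \<mu> = 1"
      by (rule zorder_zero_eqI[OF Fh]) (use False z d a in \<open>auto simp: dF\<close>)
    then show ?thesis using False by simp
  next
    case True
    have sq: "((\<lambda>w. s - w\<^sup>2) has_field_derivative - 2 * w) (at w)" for w :: complex
      by (auto intro!: derivative_eq_intros)
    have "((\<lambda>w. a * (deriv H (s - w\<^sup>2) * (- 2 * w))) has_field_derivative
       a * ((deriv (deriv H) (s - 0\<^sup>2) * (- 2 * 0)) * (- 2 * 0) + (- 2) * deriv H (s - 0\<^sup>2))) (at 0)"
      by (rule DERIV_cmult[OF DERIV_mult[OF DERIV_chain2[OF H'd sq]]]) (auto intro!: derivative_eq_intros)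
    then have d2: "deriv (deriv ?F) 0 = - 2 * a * deriv H s"
      unfolding dF by (intro DERIV_imp_deriv) (simp add: mult_ac)
    have "zorder ?F \<mu> = 2"
    proof (rule zorder_zero_eqI[OF Fh])
      fix i assume "i < nat 2"
      then consider "i = 0" | "i = 1" by fastforce
      then show "(deriv ^^ i) ?F \<mu> = 0" by cases (use True z in \<open>auto simp: dF\<close>)
    next
      have n2: "nat 2 = Suc (Suc 0)" by simp
      show "(deriv ^^ nat 2) ?F \<mu> \<noteq> 0" unfolding n2 using True d a by (simp add: d2)
    qed auto
    then show ?thesis using True by simp
  qed
qed

definition spectral_fibre :: "real \<Rightarrow> real \<Rightarrow> complex set" where
  "spectral_fibre \<kappa> c = {\<mu>. spectral \<kappa> \<mu> = of_real c}"

lemma spectral_fibre_eq: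
  "spectral_fibre \<kappa> c = {csqrt (of_real ((\<kappa> - 1/2)\<^sup>2 - c)), - csqrt (of_real ((\<kappa> - 1/2)\<^sup>2 - c))}"
proof -
  let ?s = "csqrt (of_real ((\<kappa> - 1/2)\<^sup>2 - c))"
  have "spectral \<kappa> \<mu> = of_real c \<longleftrightarrow> \<mu>\<^sup>2 = ?s\<^sup>2" for \<mu>
    unfolding spectral_def power2_csqrt by (auto simp: algebra_simps)
  then show ?thesis unfolding spectral_fibre_def power2_eq_iff by auto
qed

lemma spectral_cases:
  assumes "Im (spectral \<kappa> \<mu>) = 0"
  shows "Re \<mu> = 0 \<or> Im \<mu> = 0"
proof -
  have "(of_real \<kappa> - 1/2)\<^sup>2 = (of_real ((\<kappa> - 1/2)\<^sup>2) :: complex)" by simp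
  then have "Im (spectral \<kappa> \<mu>) = - Im (\<mu>\<^sup>2)"
    unfolding spectral_def by (simp only: minus_complex.sel Im_complex_of_real)
  then show ?thesis using assms by (simp add: Im_power2)
qed

lemma Re_spectral: "Re (spectral \<kappa> \<mu>) = (\<kappa> - 1/2)\<^sup>2 - (Re \<mu>)\<^sup>2 + (Im \<mu>)\<^sup>2"
proof -
  have "(of_real \<kappa> - 1/2)\<^sup>2 = (of_real ((\<kappa> - 1/2)\<^sup>2) :: complex)" by simp
  then have "Re (spectral \<kappa> \<mu>) = (\<kappa> - 1/2)\<^sup>2 - Re (\<mu>\<^sup>2)"
    unfolding spectral_def by (simp only: minus_complex.sel Re_complex_of_real)
  then show ?thesis by (simp add: Re_power2)
qed

text \<open>
All zeros lie on the axes, where \<open>c = (\<kappa> - 1/2)\<^sup>2 - (Re \<mu>)\<^sup>2 + (Im \<mu>)\<^sup>2\<close> with one of the two squares equal to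
\<open>0\<close>; so the condition \<open>|Im \<mu>| \<le> T\<close> is equivalent to \<open>c \<le> (\<kappa> - 1/2)\<^sup>2 + T\<^sup>2\<close>, and real zeros satisfy it for
every \<open>T\<close>.
\<close>

lemma strip_zeros_eq_fibres:
  assumes T: "T \<ge> 0" and p: "p \<noteq> 0"
  shows "strip_zeros (\<lambda>\<mu>. p * profile \<kappa> (spectral \<kappa> \<mu>) u) T
       = (\<Union>c\<in>eigenvalues \<kappa> u ((\<kappa> - 1/2)\<^sup>2 + T\<^sup>2). spectral_fibre \<kappa> c)"
proof (intro equalityI subsetI)
  fix \<mu> assume "\<mu> \<in> strip_zeros (\<lambda>\<mu>. p * profile \<kappa> (spectral \<kappa> \<mu>) u) T"
  then have z: "profile \<kappa> (spectral \<kappa> \<mu>) u = 0" and i: "\<bar>Im \<mu>\<bar> \<le> T" using p by (auto simp: strip_zeros_def)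
  define c where "c = Re (spectral \<kappa> \<mu>)"
  have sc: "spectral \<kappa> \<mu> = of_real c" using profile_zero_imp_real[OF z] by (simp add: c_def complex_eq_iff)
  have hz: "profile \<kappa> c u = 0" using z unfolding sc profile_of_real by simp
  then have "c > 0" using profile_ge_1[of c \<kappa> u] by force
  moreover have "c \<le> (\<kappa> - 1/2)\<^sup>2 + T\<^sup>2"
  proof -
    have "(Im \<mu>)\<^sup>2 \<le> T\<^sup>2" using i T abs_le_square_iff[of "Im \<mu>" T] by simp
    then show ?thesis using zero_le_power2[of "Re \<mu>"] unfolding c_def Re_spectral by linarith
  qed
  ultimately show "\<mu> \<in> (\<Union>c\<in>eigenvalues \<kappa> u ((\<kappa> - 1/2)\<^sup>2 + T\<^sup>2). spectral_fibre \<kappa> c)"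
    using sc hz by (auto simp: eigenvalues_def spectral_fibre_def)
next
  fix \<mu> assume "\<mu> \<in> (\<Union>c\<in>eigenvalues \<kappa> u ((\<kappa> - 1/2)\<^sup>2 + T\<^sup>2). spectral_fibre \<kappa> c)"
  then obtain c where c: "c \<le> (\<kappa> - 1/2)\<^sup>2 + T\<^sup>2" "profile \<kappa> c u = 0" "spectral \<kappa> \<mu> = of_real c"
    by (auto simp: eigenvalues_def spectral_fibre_def)
  have "Re \<mu> = 0 \<or> Im \<mu> = 0" by (rule spectral_cases[of \<kappa>]) (simp add: c)
  moreover have "c = (\<kappa> - 1/2)\<^sup>2 - (Re \<mu>)\<^sup>2 + (Im \<mu>)\<^sup>2" using Re_spectral[of \<kappa> \<mu>] c(3) by simp
  ultimately have "(Im \<mu>)\<^sup>2 \<le> T\<^sup>2" using c(1) by auto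
  then have "\<bar>Im \<mu>\<bar> \<le> T" using T abs_le_square_iff[of "Im \<mu>" T] by simp
  then show "\<mu> \<in> strip_zeros (\<lambda>\<mu>. p * profile \<kappa> (spectral \<kappa> \<mu>) u) T"
    using c(2,3) by (simp add: strip_zeros_def profile_of_real)
qed

lemma zorder_at_zero:
  assumes p: "p \<noteq> 0" and z: "profile \<kappa> (spectral \<kappa> \<mu>) u = 0"
  shows "zorder (\<lambda>\<mu>. p * profile \<kappa> (spectral \<kappa> \<mu>) u) \<mu> = (if \<mu> = 0 then 2 else 1)"
  unfolding spectral_def
  by (rule zorder_quadratic_substitution[OF profile_holomorphic p])
     (use z profile_zero_simple[OF z] in \<open>simp_all add: spectral_def\<close>)

lemma finite_strip_zeros:
  assumes p: "p \<noteq> 0"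
  shows "finite (strip_zeros (\<lambda>\<mu>. p * profile \<kappa> (spectral \<kappa> \<mu>) u) T)"
proof (cases "T \<ge> 0")
  case True
  have "finite (eigenvalues \<kappa> u ((\<kappa> - 1/2)\<^sup>2 + T\<^sup>2))" by (rule eigenvalue_count_by_phase(1)) simp
  then show ?thesis unfolding strip_zeros_eq_fibres[OF True p] by (simp add: spectral_fibre_eq)
next
  case False
  then have "strip_zeros (\<lambda>\<mu>. p * profile \<kappa> (spectral \<kappa> \<mu>) u) T = {}" by (auto simp: strip_zeros_def)
  then show ?thesis by simp
qed

text \<open>
A fibre of \<open>\<mu> \<mapsto> c\<close> consists of two opposite simple zeros or of the double zero at \<open>0\<close>, so it contributes \<open>2\<close>
in either case.
\<close>

lemma zero_count_eq:
  assumes T: "T \<ge> 0" and p: "p \<noteq> 0"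
  shows "zero_count (\<lambda>\<mu>. p * profile \<kappa> (spectral \<kappa> \<mu>) u) T
       = 2 * int (card (eigenvalues \<kappa> u ((\<kappa> - 1/2)\<^sup>2 + T\<^sup>2)))"
proof -
  let ?F = "\<lambda>\<mu>. p * profile \<kappa> (spectral \<kappa> \<mu>) u"
  let ?E = "eigenvalues \<kappa> u ((\<kappa> - 1/2)\<^sup>2 + T\<^sup>2)"
  have fin: "finite ?E" by (rule eigenvalue_count_by_phase(1)) simp
  have fib: "(\<Sum>\<mu>\<in>spectral_fibre \<kappa> c. zorder ?F \<mu>) = 2" if c: "c \<in> ?E" for c
  proof -
    let ?s = "csqrt (of_real ((\<kappa> - 1/2)\<^sup>2 - c))"
    have "profile \<kappa> (spectral \<kappa> \<mu>) u = 0" if "\<mu> \<in> spectral_fibre \<kappa> c" for \<mu>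
      using that c by (simp add: spectral_fibre_def eigenvalues_def profile_of_real)
    then have "(\<Sum>\<mu>\<in>spectral_fibre \<kappa> c. zorder ?F \<mu>) = (\<Sum>\<mu>\<in>spectral_fibre \<kappa> c. if \<mu> = 0 then 2 else 1)"
      by (intro sum.cong refl zorder_at_zero p)
    also have "\<dots> = 2"
    proof (cases "?s = 0")
      case True
      then show ?thesis unfolding spectral_fibre_eq by simp
    next
      case False
      have "z \<noteq> - z" if "z \<noteq> 0" for z :: complex
        using that by (simp add: eq_neg_iff_add_eq_0 flip: mult_2)
      from this[OF False] False show ?thesis unfolding spectral_fibre_eq by simp
    qed
    finally show ?thesis .
  qed
  have "zero_count ?F T = (\<Sum>c\<in>?E. \<Sum>\<mu>\<in>spectral_fibre \<kappa> c. zorder ?F \<mu>)"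
    unfolding zero_count_def strip_zeros_eq_fibres[OF T p]
  proof (rule sum.UNION_disjoint[OF fin])
    show "\<forall>c\<in>?E. finite (spectral_fibre \<kappa> c)" by (simp add: spectral_fibre_eq)
    show "\<forall>c\<in>?E. \<forall>d\<in>?E. c \<noteq> d \<longrightarrow> spectral_fibre \<kappa> c \<inter> spectral_fibre \<kappa> d = {}"
      by (auto simp: spectral_fibre_def)
  qed
  also have "\<dots> = (\<Sum>c\<in>?E. 2)" by (intro sum.cong refl fib)
  finally show ?thesis by simp
qed

text \<open>
Eigenvalues beyond \<open>(\<kappa> - 1/2)\<^sup>2\<close> come from imaginary \<open>\<mu>\<close>. With finitely many such zeros the number of
eigenvalues would be bounded, against its asymptotic formula.
\<close>

lemma infinite_imaginary_zeros:
  assumes p: "p \<noteq> 0"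
  shows "infinite {t::real. p * profile \<kappa> (spectral \<kappa> (\<i> * of_real t)) u = 0}" (is "infinite ?S")
proof
  assume fin: "finite ?S"
  define d where "d = (\<kappa> - 1/2)\<^sup>2"
  let ?B = "eigenvalues \<kappa> u d \<union> (\<lambda>t. d + t\<^sup>2) ` ?S"
  have fB: "finite ?B" using fin eigenvalue_count_by_phase(1)[of d] by (simp add: d_def)
  have sub: "eigenvalues \<kappa> u C \<subseteq> ?B" for C
  proof
    fix c assume c: "c \<in> eigenvalues \<kappa> u C"
    show "c \<in> ?B"
    proof (cases "c \<le> d")
      case True then show ?thesis using c by (simp add: eigenvalues_def)
    next
      case False
      then have "c = d + (sqrt (c - d))\<^sup>2" by simp
      moreover have "sqrt (c - d) \<in> ?S"
        using c False by (simp add: spectral_imaginary d_def[symmetric] profile_of_real eigenvalues_def del: of_real_add)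
      ultimately show ?thesis by blast
    qed
  qed
  obtain K where K: "\<forall>\<^sub>F T in at_top. 
    \<bar>pi * real (card (eigenvalues \<kappa> u (d + T\<^sup>2))) - (T * ln T + (2 * ln 2 - 1 - u) * T)\<bar> \<le> K"
    using eigenvalue_count_asymptotics[of \<kappa> u] by (auto simp: d_def)
  have "filterlim (\<lambda>T. T * ln T + (2 * ln 2 - 1 - u) * T) at_top at_top" by real_asymp
  then have "\<forall>\<^sub>F T in at_top. T * ln T + (2 * ln 2 - 1 - u) * T > pi * real (card ?B) + K"
    by (rule filterlim_at_top_dense[THEN iffD1, rule_format])
  with K have "\<forall>\<^sub>F T in at_top. pi * real (card (eigenvalues \<kappa> u (d + T\<^sup>2))) > pi * real (card ?B)"
    by eventually_elim linarith
  then obtain T :: real where "pi * real (card (eigenvalues \<kappa> u (d + T\<^sup>2))) > pi * real (card ?B)"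
    using eventually_happens'[OF trivial_limit_at_top_linorder] by blast
  then have "card (eigenvalues \<kappa> u (d + T\<^sup>2)) > card ?B" by simp
  then show False using card_mono[OF fB sub] by (simp add: leD)
qed

text \<open>
For real \<open>\<mu> = t\<close> the wavenumber is \<open>- t\<^sup>2 - V\<close>, and \<open>V = (exp v / 2 - \<kappa>)\<^sup>2 - \<kappa>\<^sup>2\<close>; it is nonpositive
everywhere if \<open>t\<^sup>2 \<ge> \<kappa>\<^sup>2\<close>, or if \<open>\<kappa> \<le> 0\<close>, when \<open>V \<ge> 0\<close>.
\<close>

lemma profile_nonzero_real_parameter:
  assumes "\<kappa> \<le> 0 \<or> \<kappa>\<^sup>2 \<le> t\<^sup>2"
  shows "profile \<kappa> (spectral \<kappa> (of_real t)) u \<noteq> 0"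
proof -
  have "profile \<kappa> ((\<kappa> - 1/2)\<^sup>2 - t\<^sup>2) u \<noteq> 0"
  proof (rule profile_nonzero_if_wavenumber_nonpos)
    fix v :: real
    have q: "wavenumber \<kappa> ((\<kappa> - 1/2)\<^sup>2 - t\<^sup>2) v = \<kappa> * exp v - exp (2 * v) / 4 - t\<^sup>2"
      by (simp add: wavenumber_def)
    from assms show "wavenumber \<kappa> ((\<kappa> - 1/2)\<^sup>2 - t\<^sup>2) v \<le> 0"
    proof
      assume "\<kappa> \<le> 0"
      then have "\<kappa> * exp v \<le> 0" by (simp add: mult_nonpos_nonneg)
      then show ?thesis unfolding q using exp_gt_zero[of "2 * v"] zero_le_power2[of t] by linarith
    next
      assume "\<kappa>\<^sup>2 \<le> t\<^sup>2"
      moreover have "\<kappa> * exp v - exp (2 * v) / 4 = \<kappa>\<^sup>2 - (exp v / 2 - \<kappa>)\<^sup>2"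
        unfolding exp_double by (simp add: power2_eq_square algebra_simps)
      ultimately show ?thesis unfolding q using zero_le_power2[of "exp v / 2 - \<kappa>"] by linarith
    qed
  qed
  then show ?thesis unfolding spectral_of_real profile_of_real by simp
qed

theorem theorem4p1:
  fixes \<kappa> u\<^sub>0 :: real and Z :: "complex \<Rightarrow> complex"
  assumes Z: "\<And>\<mu>. Z \<mu> = whittaker_W (of_real \<kappa>) \<mu> (exp u\<^sub>0)"
  shows "Z holomorphic_on UNIV \<and>
    order_one_maximal_type Z \<and>
    (\<forall>t::real. Z (of_real t) \<in> \<real> \<and> Z (\<i> * of_real t) \<in> \<real>) \<and>
    (\<forall>\<mu>. Z \<mu> = Z (- \<mu>)) \<and>
    (\<forall>\<mu>. Z \<mu> = 0 \<longrightarrow> Re \<mu> = 0 \<or> Im \<mu> = 0) \<and>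
    (\<forall>\<mu>. Z \<mu> = 0 \<and> \<mu> \<noteq> 0 \<longrightarrow> zorder Z \<mu> = 1) \<and>
    (Z 0 = 0 \<longrightarrow> zorder Z 0 = 2) \<and>
    finite {t::real. Z (of_real t) = 0} \<and>
    (\<kappa> \<le> 0 \<longrightarrow> (\<forall>t::real. Z (of_real t) \<noteq> 0)) \<and>
    (\<kappa> \<ge> 0 \<longrightarrow> (\<forall>t::real. Z (of_real t) = 0 \<longrightarrow> - \<kappa> < t \<and> t < \<kappa>)) \<and>
    infinite {t::real. Z (\<i> * of_real t) = 0} \<and>
    (\<forall>T. finite (strip_zeros Z T)) \<and>
    (\<lambda>T::real. of_int (zero_count Z T)
            - (2 / pi * T * ln T + 2 / pi * (2 * ln 2 - 1 - u\<^sub>0) * T)) \<in> O[at_top](\<lambda>_. 1)"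
proof -
  define p where "p = prefactor \<kappa> (exp u\<^sub>0)"
  have p: "p > 0" by (simp add: p_def prefactor_pos)
  then have p0: "(of_real p :: complex) \<noteq> 0" by simp
  have ZF: "Z = (\<lambda>\<mu>. of_real p * profile \<kappa> (spectral \<kappa> \<mu>) u\<^sub>0)"
    by (rule ext) (simp add: Z whittaker_W_eq whittaker_sol_def p_def)
  have zero: "Z \<mu> = 0 \<longleftrightarrow> profile \<kappa> (spectral \<kappa> \<mu>) u\<^sub>0 = 0" for \<mu> using p0 by (simp add: ZF)
  have hol: "Z holomorphic_on UNIV"
    unfolding ZF by (intro holomorphic_intros profile_spectral_holomorphic)
  have order: "order_one_maximal_type Z" unfolding ZF by (rule profile_spectral_growth[OF p])
  have reals: "Z (of_real t) \<in> \<real>" "Z (\<i> * of_real t) \<in> \<real>" for t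
    unfolding ZF spectral_of_real spectral_imaginary profile_of_real by simp_all
  have even: "Z \<mu> = Z (- \<mu>)" for \<mu> by (simp add: ZF spectral_def)
  have axes: "Re \<mu> = 0 \<or> Im \<mu> = 0" if "Z \<mu> = 0" for \<mu>
    by (rule spectral_cases[OF profile_zero_imp_real]) (use that zero in simp)
  have zord: "zorder Z \<mu> = (if \<mu> = 0 then 2 else 1)" if "Z \<mu> = 0" for \<mu>
    unfolding ZF by (rule zorder_at_zero[OF p0]) (use that zero in simp)
  have strip: "finite (strip_zeros Z T)" for T unfolding ZF by (rule finite_strip_zeros[OF p0])
  have "of_real ` {t::real. Z (of_real t) = 0} \<subseteq> strip_zeros Z 0" by (auto simp: strip_zeros_def)
  from finite_subset[OF this strip] have fin: "finite {t::real. Z (of_real t) = 0}"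
    by (rule finite_imageD) (simp add: inj_on_def)
  have k1: "Z (of_real t) \<noteq> 0" if "\<kappa> \<le> 0 \<or> \<kappa>\<^sup>2 \<le> t\<^sup>2" for t :: real
    using profile_nonzero_real_parameter[OF that] zero by blast
  have k2: "- \<kappa> < t \<and> t < \<kappa>" if "\<kappa> \<ge> 0" "Z (of_real t) = 0" for t :: real
  proof -
    have "\<not> \<kappa>\<^sup>2 \<le> t\<^sup>2" using k1[of t] that by blast
    then have "\<bar>t\<bar> < \<bar>\<kappa>\<bar>" using abs_le_square_iff[of \<kappa> t] by simp
    then show ?thesis using that by auto
  qed
  have inf: "infinite {t::real. Z (\<i> * of_real t) = 0}"
    unfolding ZF by (rule infinite_imaginary_zeros[OF p0])
  obtain K where K: "\<forall>\<^sub>F T in at_top.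
      \<bar>pi * real (card (eigenvalues \<kappa> u\<^sub>0 ((\<kappa> - 1/2)\<^sup>2 + T\<^sup>2))) - (T * ln T + (2 * ln 2 - 1 - u\<^sub>0) * T)\<bar> \<le> K"
    using eigenvalue_count_asymptotics by blast
  have count: "(\<lambda>T::real. of_int (zero_count Z T)
            - (2 / pi * T * ln T + 2 / pi * (2 * ln 2 - 1 - u\<^sub>0) * T)) \<in> O[at_top](\<lambda>_. 1 :: real)"
  proof (rule bigoI[of _ "2 / pi * K"])
    show "\<forall>\<^sub>F T in at_top. norm (of_int (zero_count Z T)
            - (2 / pi * T * ln T + 2 / pi * (2 * ln 2 - 1 - u\<^sub>0) * T)) \<le> 2 / pi * K * norm (1::real)"
      using K eventually_ge_at_top[of 0]
    proof eventually_elim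
      case (elim T)
      define n where "n = real (card (eigenvalues \<kappa> u\<^sub>0 ((\<kappa> - 1/2)\<^sup>2 + T\<^sup>2)))"
      define M where "M = T * ln T + (2 * ln 2 - 1 - u\<^sub>0) * T"
      have "of_int (zero_count Z T) = 2 * n"
        unfolding ZF zero_count_eq[OF elim(2) p0] by (simp add: n_def)
      moreover have "2 * n - (2 / pi * T * ln T + 2 / pi * (2 * ln 2 - 1 - u\<^sub>0) * T) = 2 / pi * (pi * n - M)"
        by (simp add: M_def field_simps)
      moreover have "\<bar>2 / pi * (pi * n - M)\<bar> \<le> 2 / pi * K"
        using elim(1) unfolding abs_mult n_def M_def by (intro mult_mono) auto
      ultimately show ?case by simp
    qed
  qed
  have simple: "\<forall>\<mu>. Z \<mu> = 0 \<and> \<mu> \<noteq> 0 \<longrightarrow> zorder Z \<mu> = 1" and double: "Z 0 = 0 \<longrightarrow> zorder Z 0 = 2"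
    using zord by simp_all
  have neg: "\<kappa> \<le> 0 \<longrightarrow> (\<forall>t::real. Z (of_real t) \<noteq> 0)" using k1 by blast
  show ?thesis
    by (intro conjI hol order simple double fin neg inf count)
       (use reals in blast, use even in blast, use axes in blast, use k2 in blast, use strip in blast)
qed

end
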